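(* For every integer $n \geqslant 1$, the $n$-dimensional cross-polytope can be constructively (in the weak sense) lattice packed in $\mathbb{R}^n$ with density $$\max_{t \geqslant 1} \frac{(2t)^{n-1}}{n!\, g^{\textsc{s}}(t-1, n)} \;>\; \max_{t \geqslant 1} \frac{(2t)^{n-1}}{n!\, \tilde{\operatorname{p}}(n)^{t-1}},$$ where the maxima are over integers $t$, $g^{\textsc{s}}(h,n)$ denotes the size of the smallest Abelian group containing a Sidon set of order $h$ and cardinality $n$, and $\tilde{\operatorname{p}}(n)$ denotes the smallest prime power greater than or equal to $n$.
   Context: The $n$-dimensional cross-polytope is $C_n = \{ \boldsymbol{y} \in \mathbb{R}^n : \sum_{i=1}^n |y_i| \leqslant 1 \}$, the unit ball of the $\ell_1$ metric. The cross-polytope of radius $r$ is $rC_n = \{ r\boldsymbol{y} : \boldsymbol{y} \in C_n \}$, which has volume $\frac{(2r)^n}{n!}$. A lattice packing of cross-polytopes of radius $r$ is an arrangement of the form $\mathcal{L} + rC_n = \{ \boldsymbol{x} + \boldsymbol{y} : \boldsymbol{x} \in \mathcal{L}, \boldsymbol{y} \in rC_n \}$, where $\mathcal{L}$ is a lattice (a discrete additive subgroup of $\mathbb{R}^n$, of full rank) with minimum $\ell_1$ distance between distinct points $\geqslant 2r$. The density of such a packing is $\frac{(2r)^n}{n!\, \det \mathcal{L}}$, where $\det \mathcal{L}$ is the volume of a fundamental cell of $\mathcal{L}$. A collection of elements $b_1, \ldots, b_n$ of an Abelian group $(G,+)$ is called a Sidon set of order $h$ (and cardinality $n$) if the sums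 $b_{i_1} + b_{i_2} + \cdots + b_{i_h}$, $1 \leqslant i_1 \leqslant i_2 \leqslant \cdots \leqslant i_h \leqslant n$, are all different; equivalently, the sums $\sum_{i=1}^n r_i b_i$, over all integer tuples with $r_i \geqslant 0$ and $\sum_{i=1}^n r_i = h$, are all different, where $r_i b_i$ is the sum of $r_i$ copies of $b_i$. "Constructively in the weak sense" is an informal qualifier, meaning that the packing arises from other natural mathematical objects (here, Sidon sets in finite Abelian groups); it does not assert a polynomial-time construction.
   Formalization: The strict inequality is stated only for n ≥ 4 (both sides are equal for n = 1, 2, 3); for all n ≥ 1 it is stated as ≥. The left-hand maximum over t is a finite supremum, not claimed to be attained; it equals the maximum if that exists. *)

theory Defs
  imports
    "HOL-Analysis.Analysis"
    "HOL-Algebra.FiniteProduct"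
    "HOL-Number_Theory.Prime_Powers"
begin

definition l1_norm :: "real ^ 'n \<Rightarrow> real" where
  "l1_norm x = (\<Sum>i\<in>UNIV. \<bar>x $ i\<bar>)"

definition euclidean_lattice :: "(real ^ 'n) set \<Rightarrow> bool" where
  "euclidean_lattice L \<longleftrightarrow>
     0 \<in> L \<and> (\<forall>x\<in>L. \<forall>y\<in>L. x - y \<in> L) \<and> discrete L \<and> span L = UNIV"

definition lattice_basis :: "('n \<Rightarrow> real ^ 'n) \<Rightarrow> (real ^ 'n) set \<Rightarrow> bool" where
  "lattice_basis b L \<longleftrightarrow>
     inj b \<and> independent (range b) \<and>
     L = range (\<lambda>z :: 'n \<Rightarrow> int. \<Sum>i\<in>UNIV. of_int (z i) *\<^sub>R b i)"

definition fundamental_cell :: "('n \<Rightarrow> real ^ 'n) \<Rightarrow> (real ^ 'n) set" where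
  "fundamental_cell b = {\<Sum>i\<in>UNIV. c i *\<^sub>R b i | c. \<forall>i. 0 \<le> c i \<and> c i < 1}"

(* A lattice has a basis, and the volume of the fundamental cell is the same for all its bases. *)
definition lattice_det :: "(real ^ 'n) set \<Rightarrow> real" where
  "lattice_det L =
     (THE d. \<exists>b. lattice_basis b L \<and> d = measure lebesgue (fundamental_cell b))"

(* The translates x + r C_n, x in L, of the cross-polytope r C_n = {y. l1_norm y <= r} have
   disjoint interiors iff distinct points of L are at l1 distance at least 2 r. *)
definition cross_polytope_packing :: "(real ^ 'n) set \<Rightarrow> real \<Rightarrow> bool" where
  "cross_polytope_packing L r \<longleftrightarrow>
     euclidean_lattice L \<and> r > 0 \<and>
     (\<forall>x\<in>L. \<forall>y\<in>L. x \<noteq> y \<longrightarrow> l1_norm (x - y) \<ge> 2 * r)"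

(* (2 r)^n / n! is the volume of r C_n. *)
definition packing_density :: "(real ^ 'n) set \<Rightarrow> real \<Rightarrow> real" where
  "packing_density L r = (2 * r) ^ CARD('n) / (fact CARD('n) * lattice_det L)"

(* The Abelian group G is written multiplicatively, as everywhere in HOL-Algebra; r i is the
   number of copies of b i in a sum of h terms. The b i need not be distinct; for h >= 1 the
   condition makes them distinct, and for h = 0 it always holds. *)
definition sidon_set :: "('a, 'c) monoid_scheme \<Rightarrow> nat \<Rightarrow> nat \<Rightarrow> (nat \<Rightarrow> 'a) \<Rightarrow> bool" where
  "sidon_set G h n b \<longleftrightarrow>
     (\<forall>i<n. b i \<in> carrier G) \<and>
     inj_on (\<lambda>r :: nat \<Rightarrow> nat. finprod G (\<lambda>i. b i [^]\<^bsub>G\<^esub> r i) {..<n})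
       {r. (\<forall>i\<ge>n. r i = 0) \<and> (\<Sum>i<n. r i) = h}"

(* g^S(h, n). Every finite group is isomorphic to one whose carrier is a set of naturals, so
   nothing is lost by fixing the type of the elements. *)
definition min_sidon_group_order :: "nat \<Rightarrow> nat \<Rightarrow> nat" where
  "min_sidon_group_order h n =
     (LEAST m. \<exists>(G :: nat monoid) b.
        comm_group G \<and> finite (carrier G) \<and> card (carrier G) = m \<and> sidon_set G h n b)"

definition next_primepow :: "nat \<Rightarrow> nat" where
  "next_primepow n = (LEAST q. q \<ge> n \<and> primepow q)"

definition sidon_density :: "nat \<Rightarrow> nat \<Rightarrow> real" where
  "sidon_density n t =
     (2 * real t) ^ (n - 1) / (fact n * real (min_sidon_group_order (t - 1) n))"

(* The suprema over t >= 1 of sidon_density n t and primepow_density n t are both 1 for n = 1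
   and n = 2, and both 8/9 for n = 3; so the first can exceed the second only for n >= 4. *)
definition primepow_density :: "nat \<Rightarrow> nat \<Rightarrow> real" where
  "primepow_density n t =
     (2 * real t) ^ (n - 1) / (fact n * real (next_primepow n) ^ (t - 1))"

end

theory Submission
  imports
    Defs
    "HOL-Algebra.Algebraic_Closure"
    "HOL-Algebra.Elementary_Groups"
    "HOL-Algebra.Multiplicative_Group"
    "HOL-Number_Theory.Residues"
begin

text \<open>
  For a Sidon set \<open>b\<^sub>1, \<dots>, b\<^sub>n\<close> of order \<open>t - 1\<close> in \<open>G\<close>, the integer vectors \<open>x\<close> with
  \<open>\<Sum> x\<^sub>i \<equiv> 0 (mod 2 t)\<close> and \<open>\<Sum> x\<^sub>i b\<^sub>i = 0\<close> form a lattice of index at most \<open>2 t |G|\<close> with minimum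
  \<open>l\<^sub>1\<close> distance at least \<open>2 t\<close>. It is not clear that the supremum over \<open>t\<close> is attained by one of these
  lattices, but after division by \<open>t\<close> they have bounded determinant, so that by Mahler compactness some limit lattice packs
  with at least this density; decreasing the radius then gives the density exactly. The comparison
  with prime powers is the Bose--Chowla bound \<open>g(h, n) < q\<^sup>h\<close> for \<open>h \<ge> 2\<close> and every prime power \<open>q \<ge> n\<close>.
  It is strict at the maximizing \<open>t\<close> as soon as \<open>t \<ge> 3\<close>, which holds for \<open>n \<ge> 5\<close>; for \<open>n = 4\<close> the
  perfect difference set \<open>{0, 1, 3, 9}\<close> modulo \<open>13\<close> does better.
\<close>

section \<open>Finite fields\<close>

text \<open>The two densities behave differently for large \<open>t\<close>. The prime power density
  has a polynomial numerator and an exponential denominator, so it tends to zero and has a maximum.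
  For fixed \<open>n\<close> the least order of a group with a Sidon set is itself at least a
  constant times \<open>t ^ (n - 1)\<close>, so the Sidon density is only known to be bounded. This
  is why a supremum appears, and why it is realized by a limit lattice that need not come from any
  single Sidon set. The obstacle to strictness are the orders 0 and 1. The least groups there have 1
  and \<open>n\<close> elements, so if \<open>n\<close> is a prime power, the two densities coincide
  at \<open>t = 1\<close> and \<open>t = 2\<close>. The maximum of the prime power density therefore
  has to be located, or beaten at another \<open>t\<close>. In the limit, separation does two jobs:
  together with bounded determinants it gives bases of bounded length, and it keeps the limit of
  these bases from degenerating. Only one-sided estimates of cell volumes are needed, since a
  smaller determinant means a greater density.\<close>

lemma (in cring) binomial_ring:
  assumes x: "x \<in> carrier R" and y: "y \<in> carrier R"
  shows "(x \<oplus> y) [^] (n::nat) =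
    (\<Oplus>k\<in>{..n}. [(n choose k)] \<cdot> (x [^] k \<otimes> y [^] (n - k)))"
proof (induction n)
  case 0
  then show ?case using x y by simp
next
  case (Suc n)
  define f where "f k = [(n choose k)] \<cdot> (x [^] k \<otimes> y [^] (n - k))" for k
  \<comment> \<open>Multiplication by \<open>x\<close> shifts the index, so \<open>g\<close> starts
    with zero, while \<open>h\<close> ends with zero; their termwise sum is Pascal's rule.\<close>
  define g where "g k = (case k of 0 \<Rightarrow> \<zero> | Suc j \<Rightarrow> [(n choose j)] \<cdot> (x [^] Suc j \<otimes> y [^] (n - j)))" for k
  define h where "h k = [(n choose k)] \<cdot> (x [^] k \<otimes> y [^] (Suc n - k))" for k
  have fc: "f k \<in> carrier R" for k using x y by (simp add: f_def)
  have gc: "g k \<in> carrier R" for k using x y by (simp add: g_def split: nat.split)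
  have hc: "h k \<in> carrier R" for k using x y by (simp add: h_def)
  have 1: "(\<Oplus>k\<in>{..n}. f k) \<otimes> x = (\<Oplus>k\<in>{..Suc n}. g k)"
  proof -
    have "(\<Oplus>k\<in>{..n}. f k) \<otimes> x = (\<Oplus>k\<in>{..n}. f k \<otimes> x)"
      using x fc by (intro finsum_ldistr) auto
    also have "\<dots> = (\<Oplus>k\<in>{..n}. g (Suc k))"
      using x y by (intro finsum_cong') (auto simp: f_def g_def add_pow_ldistr add_pow_rdistr m_ac)
    also have "\<dots> = (\<Oplus>k\<in>{..Suc n}. g k)"
      using gc by (subst finsum_Suc2) (auto simp: g_def[of 0])
    finally show ?thesis .
  qed
  have 2: "(\<Oplus>k\<in>{..n}. f k) \<otimes> y = (\<Oplus>k\<in>{..Suc n}. h k)"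
  proof -
    have "(\<Oplus>k\<in>{..n}. f k) \<otimes> y = (\<Oplus>k\<in>{..n}. f k \<otimes> y)"
      using y fc by (intro finsum_ldistr) auto
    also have "\<dots> = (\<Oplus>k\<in>{..n}. h k)"
      using x y by (intro finsum_cong') (auto simp: f_def h_def add_pow_ldistr add_pow_rdistr m_ac Suc_diff_le)
    also have "\<dots> = (\<Oplus>k\<in>{..Suc n}. h k)"
    proof -
      have "h (Suc n) = \<zero>" using x y by (simp only: h_def binomial_n_n binomial_eq_0[OF lessI]) (simp add: add_pow_def)
      then show ?thesis using hc by (subst finsum_Suc) auto
    qed
    finally show ?thesis .
  qed
  have "(x \<oplus> y) [^] Suc n = (\<Oplus>k\<in>{..n}. f k) \<otimes> (x \<oplus> y)"
    using Suc by (simp add: f_def)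
  also have "\<dots> = (\<Oplus>k\<in>{..Suc n}. g k) \<oplus> (\<Oplus>k\<in>{..Suc n}. h k)"
    using x y fc 1 2 by (simp add: r_distr finsum_closed Pi_def del: finsum_Suc)
  also have "\<dots> = (\<Oplus>k\<in>{..Suc n}. g k \<oplus> h k)"
    using gc hc by (intro finsum_addf[symmetric]) auto
  also have "\<dots> = (\<Oplus>k\<in>{..Suc n}. [(Suc n choose k)] \<cdot> (x [^] k \<otimes> y [^] (Suc n - k)))"
  proof (intro finsum_cong')
    fix k assume "k \<in> {..Suc n}"
    show "g k \<oplus> h k = [(Suc n choose k)] \<cdot> (x [^] k \<otimes> y [^] (Suc n - k))"
    proof (cases k)
      case 0
      then show ?thesis using x y by (simp add: g_def h_def)
    next
      case (Suc j)
      then show ?thesis using x y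
        by (simp add: g_def h_def add.nat_pow_mult)
    qed
  qed (use x y in auto)
  finally show ?case .
qed

text \<open>All inner binomial coefficients are divisible by \<open>p\<close> and vanish.
  Commutative rings are the right generality, since the power version is applied to a polynomial
  ring as well as to fields.\<close>

lemma (in cring) frobenius_add:
  assumes p: "Factorial_Ring.prime (p::nat)" and char: "[p] \<cdot> \<one> = \<zero>"
    and x: "x \<in> carrier R" and y: "y \<in> carrier R"
  shows "(x \<oplus> y) [^] p = x [^] p \<oplus> y [^] p"
proof -
  define f where "f k = [(p choose k)] \<cdot> (x [^] k \<otimes> y [^] (p - k))" for k
  have fc: "f k \<in> carrier R" for k using x y by (simp add: f_def)
  have f0: "f k = \<zero>" if "0 < k" "k < p" for k
  proof -
    have "p dvd (p choose k)" using that p by (intro dvd_choose_prime) auto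
    then obtain c where c: "p choose k = p * c" by blast
    let ?z = "x [^] k \<otimes> y [^] (p - k)"
    have z: "?z \<in> carrier R" using x y by simp
    have "[p] \<cdot> ?z = ([p] \<cdot> \<one>) \<otimes> ?z" using z add_pow_ldistr[of \<one> ?z p] by simp
    also have "\<dots> = \<zero>" using z char by simp
    finally have "[p] \<cdot> ?z = \<zero>" .
    then show ?thesis
      using z by (simp add: f_def c add.nat_pow_pow[symmetric])
  qed
  have p0: "p > 0" using p prime_gt_0_nat by blast
  have "{..p} = insert 0 (insert p {0<..<p})" using p0 by auto
  then have "(x \<oplus> y) [^] p = (\<Oplus>k\<in>insert 0 (insert p {0<..<p}). f k)"
    using binomial_ring[OF x y, of p] by (simp add: f_def)
  also have "\<dots> = f 0 \<oplus> (f p \<oplus> (\<Oplus>k\<in>{0<..<p}. f k))"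
    using p0 fc by (simp add: finsum_insert)
  also have "(\<Oplus>k\<in>{0<..<p}. f k) = (\<Oplus>k\<in>{0<..<p}. \<zero>)"
    using f0 by (intro finsum_cong') auto
  finally show ?thesis using x y by (simp add: f_def a_comm)
qed

lemma (in cring) frobenius_pow_add:
  assumes p: "Factorial_Ring.prime (p::nat)" and char: "[p] \<cdot> \<one> = \<zero>"
    and x: "x \<in> carrier R" and y: "y \<in> carrier R"
  shows "(x \<oplus> y) [^] (p ^ m) = x [^] (p ^ m) \<oplus> y [^] (p ^ m)"
proof (induction m)
  case 0
  then show ?case using x y by simp
next
  case (Suc m)
  have "(x \<oplus> y) [^] (p ^ Suc m) = ((x \<oplus> y) [^] (p ^ m)) [^] p"
    using x y by (simp add: nat_pow_pow mult.commute)
  also have "\<dots> = x [^] (p ^ Suc m) \<oplus> y [^] (p ^ Suc m)"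
    using x y p char by (simp add: Suc frobenius_add nat_pow_pow mult.commute)
  finally show ?case .
qed

text \<open>Separability: at a root \<open>a\<close> the additivity of Frobenius turns \<open>X\<^sup>Q - X\<close> into
  \<open>(X - a)\<^sup>Q - (X - a)\<close>, which \<open>X - a\<close> divides only once.\<close>

lemma (in algebraically_closed) card_frobenius_fixed:
  assumes p: "Factorial_Ring.prime (p::nat)" and char: "[p] \<cdot> \<one> = \<zero>" and m: "m > 0"
  shows "card {a \<in> carrier L. a [^] (p ^ m) = a} = p ^ m"
proof -
  define Q where "Q = p ^ m"
  have Q2: "Q \<ge> 2"
    using prime_ge_2_nat[OF p] m unfolding Q_def
    by (metis One_nat_def Suc_leI dual_order.trans power_increasing power_one_right prime_gt_0_nat p)
  let ?P = "poly_ring L"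
  interpret UP: domain ?P using univ_poly_is_domain[OF carrier_is_subring] .
  have sub: "subring (carrier L) L" by (rule carrier_is_subring)
  have Xc: "X \<in> carrier ?P" using var_closed[OF sub] by simp
  have eval_hom: "ring_hom_ring ?P L (\<lambda>q. eval q a)" if "a \<in> carrier L" for a
    using eval_ring_hom[OF sub that] by simp
  define f where "f = X [^]\<^bsub>?P\<^esub> Q \<ominus>\<^bsub>?P\<^esub> X"
  have fc: "f \<in> carrier ?P" using Xc by (simp add: f_def)
  have degX: "degree X = 1" by (simp add: var_def)
  have degXQ: "degree (X [^]\<^bsub>?P\<^esub> Q) = Q"
    unfolding unitary_monom_eq_var_pow[OF sub, of Q, symmetric] by (simp add: monom_def)
  have degf: "degree f = Q"
  proof -
    have "degree (\<ominus>\<^bsub>?P\<^esub> X) = 1" using univ_poly_a_inv_degree[OF sub Xc] degX by simp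
    moreover have "polynomial (carrier L) (X [^]\<^bsub>?P\<^esub> Q)"
      "polynomial (carrier L) (\<ominus>\<^bsub>?P\<^esub> X)"
      using Xc by (simp_all add: univ_poly_carrier)
    ultimately show ?thesis
      unfolding f_def a_minus_def univ_poly_add
      using poly_add_degree_eq[OF sub, of "X [^]\<^bsub>?P\<^esub> Q" "\<ominus>\<^bsub>?P\<^esub> X"] degXQ Q2
      by simp
  qed
  then have f0: "f \<noteq> []" using Q2 by auto
  have evalf: "eval f a = a [^] Q \<ominus> a" if a: "a \<in> carrier L" for a
  proof -
    interpret H: ring_hom_ring ?P L "\<lambda>q. eval q a" by (rule eval_hom[OF a])
    show ?thesis unfolding f_def using Xc a
      by (simp add: a_minus_def H.hom_nat_pow eval_var del: eval.simps)
  qed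
  have root: "is_root f a \<longleftrightarrow> a \<in> carrier L \<and> a [^] Q = a" for a
    using evalf[of a] f0 r_right_minus_eq[of "a [^] Q" a] nat_pow_closed[of a Q]
    unfolding is_root_def by metis
  have mult: "alg_mult f a = 1" if r: "is_root f a" for a
  proof -
    have a: "a \<in> carrier L" and aQ: "a [^] Q = a" using root r by auto
    interpret H: ring_hom_ring ?P L "\<lambda>q. eval q a" by (rule eval_hom[OF a])
    let ?l = "[\<one>, \<ominus> a]"
    have lc: "?l \<in> carrier ?P" using a by (auto simp flip: univ_poly_carrier simp: polynomial_def)
    have l0: "?l \<noteq> \<zero>\<^bsub>?P\<^esub>" by (simp add: univ_poly_zero)
    define c where "c = poly_of_const a"
    interpret C: ring_hom_ring L ?P poly_of_const
      using canonical_embedding_ring_hom[OF sub] by simp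
    have cc: "c \<in> carrier ?P" using a by (simp add: c_def)
    have cQ: "c [^]\<^bsub>?P\<^esub> Q = c" unfolding c_def using a aQ C.hom_nat_pow[of a Q] by simp
    have "poly_of_const ([n] \<cdot> \<one>) = [n] \<cdot>\<^bsub>?P\<^esub> \<one>\<^bsub>?P\<^esub>" for n :: nat
      by (induction n) auto
    then have charP: "[p] \<cdot>\<^bsub>?P\<^esub> \<one>\<^bsub>?P\<^esub> = \<zero>\<^bsub>?P\<^esub>"
      using char C.hom_zero by metis
    have X: "X = ?l \<oplus>\<^bsub>?P\<^esub> c"
      using a by (auto simp: var_def c_def poly_of_const_def univ_poly_add l_neg)
    have "f = (?l [^]\<^bsub>?P\<^esub> Q \<oplus>\<^bsub>?P\<^esub> c) \<ominus>\<^bsub>?P\<^esub> (?l \<oplus>\<^bsub>?P\<^esub> c)"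
      unfolding f_def X Q_def using UP.frobenius_pow_add[OF p charP lc cc, of m] cQ
      by (simp add: Q_def)
    also have "\<dots> = ?l [^]\<^bsub>?P\<^esub> Q \<ominus>\<^bsub>?P\<^esub> ?l"
    proof -
      have "(u \<oplus>\<^bsub>?P\<^esub> c) \<ominus>\<^bsub>?P\<^esub> (v \<oplus>\<^bsub>?P\<^esub> c) = u \<ominus>\<^bsub>?P\<^esub> v"
        if "u \<in> carrier ?P" "v \<in> carrier ?P" for u v
      proof -
        have "(u \<oplus>\<^bsub>?P\<^esub> c) \<ominus>\<^bsub>?P\<^esub> (v \<oplus>\<^bsub>?P\<^esub> c)
          = u \<oplus>\<^bsub>?P\<^esub> (c \<oplus>\<^bsub>?P\<^esub> (\<ominus>\<^bsub>?P\<^esub> c \<oplus>\<^bsub>?P\<^esub> \<ominus>\<^bsub>?P\<^esub> v))"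
          using that cc by (simp add: a_minus_def UP.minus_add UP.a_assoc UP.a_comm[of "\<ominus>\<^bsub>?P\<^esub> v"])
        then show ?thesis using that cc by (simp add: UP.r_neg2 a_minus_def)
      qed
      then show ?thesis using lc by simp
    qed
    finally have fl: "f = ?l [^]\<^bsub>?P\<^esub> Q \<ominus>\<^bsub>?P\<^esub> ?l" .
    have evl: "eval ?l a = \<zero>" using a by (simp add: r_neg)
    have "\<not> (?l [^]\<^bsub>?P\<^esub> (2::nat)) pdivides f"
    proof
      assume "(?l [^]\<^bsub>?P\<^esub> (2::nat)) pdivides f"
      then obtain g where g: "g \<in> carrier ?P" "f = ?l [^]\<^bsub>?P\<^esub> (2::nat) \<otimes>\<^bsub>?P\<^esub> g"
        by (auto simp: pdivides_def factor_def)
      obtain k where k: "Q = Suc (Suc k)" using Q2 by (metis Suc_diff_Suc Suc_le_lessD numeral_2_eq_2 add_2_eq_Suc le_iff_add)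
      have pk: "?l [^]\<^bsub>?P\<^esub> Q = ?l \<otimes>\<^bsub>?P\<^esub> (?l \<otimes>\<^bsub>?P\<^esub> ?l [^]\<^bsub>?P\<^esub> k)"
        using lc k UP.nat_pow_Suc2 by (simp add: UP.m_ac)
      have l2: "?l [^]\<^bsub>?P\<^esub> (2::nat) \<otimes>\<^bsub>?P\<^esub> g = ?l \<otimes>\<^bsub>?P\<^esub> (?l \<otimes>\<^bsub>?P\<^esub> g)"
        using lc g by (simp add: numeral_2_eq_2 UP.m_ac)
      let ?u = "?l \<otimes>\<^bsub>?P\<^esub> ?l [^]\<^bsub>?P\<^esub> k" and ?v = "?l \<otimes>\<^bsub>?P\<^esub> g"
      have uc: "?u \<in> carrier ?P" "?v \<in> carrier ?P" using lc g by auto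
      have "?l \<otimes>\<^bsub>?P\<^esub> ?u \<ominus>\<^bsub>?P\<^esub> ?l = ?l \<otimes>\<^bsub>?P\<^esub> ?v"
        using fl g(2) pk l2 by simp
      then have "?l \<otimes>\<^bsub>?P\<^esub> (?u \<ominus>\<^bsub>?P\<^esub> \<one>\<^bsub>?P\<^esub>) = ?l \<otimes>\<^bsub>?P\<^esub> ?v"
        using lc uc by (simp add: a_minus_def UP.r_distr UP.r_minus)
      then have "?u \<ominus>\<^bsub>?P\<^esub> \<one>\<^bsub>?P\<^esub> = ?v"
        using UP.m_lcancel[OF l0 lc, of "?u \<ominus>\<^bsub>?P\<^esub> \<one>\<^bsub>?P\<^esub>" ?v] uc by simp
      \<comment> \<open>With one factor cancelled, both products still contain \<open>?l\<close> and
        vanish at \<open>a\<close>, which leaves the contradiction that minus one is zero.\<close>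
      then have "eval (?u \<ominus>\<^bsub>?P\<^esub> \<one>\<^bsub>?P\<^esub>) a = eval ?v a" by simp
      then have "eval ?l a \<otimes> eval (?l [^]\<^bsub>?P\<^esub> k) a \<ominus> \<one> = eval ?l a \<otimes> eval g a"
        using lc uc g by (simp add: a_minus_def del: eval.simps)
      then have "\<ominus> \<one> = \<zero>"
        using lc g evl H.hom_closed[of g] H.hom_closed[of "?l [^]\<^bsub>?P\<^esub> k"]
        by (simp add: a_minus_def del: eval.simps)
      then have "\<one> = \<zero>" by (metis minus_minus minus_zero one_closed)
      then show False using one_not_zero by simp
    qed
    then have "\<not> alg_mult f a \<ge> 2"
      using le_alg_mult_imp_pdivides[OF a fc, of 2] by auto
    moreover have "alg_mult f a > 0" using alg_mult_gt_zero_iff_is_root[OF fc] r by simp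
    ultimately show ?thesis by simp
  qed
  \<comment> \<open>Over an algebraically closed field the multiset of roots has
    \<open>degree f\<close> elements; multiplicity one turns this into a count of distinct
    roots.\<close>
  have "size (roots f) = Q" using roots_over_carrier[OF fc] degf by (simp add: splitted_def)
  moreover have "size (roots f) = card (set_mset (roots f))"
    unfolding size_multiset_overloaded_eq
    using mult roots_mem_iff_is_root[OF fc] by (simp flip: alg_mult_eq_count_roots[OF fc])
  moreover have "set_mset (roots f) = {a \<in> carrier L. a [^] Q = a}"
    using roots_mem_iff_is_root[OF fc] root by auto
  ultimately show ?thesis by (simp add: Q_def)
qed

section \<open>Linear relations between powers\<close>

lemma (in abelian_monoid) finsum_lessThan_Suc:
  assumes "\<And>j. j \<le> n \<Longrightarrow> f j \<in> carrier G"
  shows "(\<Oplus>j\<in>{..<Suc n}. f j) = f n \<oplus> (\<Oplus>j\<in>{..<n}. f j)"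
  using assms by (simp add: lessThan_Suc finsum_insert Pi_def)

lemma (in abelian_monoid) finsum_lessThan_Suc_shift:
  assumes "\<And>j. j \<le> n \<Longrightarrow> f j \<in> carrier G"
  shows "(\<Oplus>j\<in>{..<Suc n}. f j) = f 0 \<oplus> (\<Oplus>j\<in>{..<n}. f (Suc j))"
proof -
  have "(\<Oplus>j\<in>{..<Suc n}. f j) = f 0 \<oplus> (\<Oplus>j\<in>Suc ` {..<n}. f j)"
    unfolding lessThan_Suc_eq_insert_0 using assms
    by (intro finsum_insert) auto
  also have "(\<Oplus>j\<in>Suc ` {..<n}. f j) = (\<Oplus>j\<in>{..<n}. f (Suc j))"
    using assms by (intro finsum_reindex) auto
  finally show ?thesis .
qed

text \<open>Polynomials in \<open>u\<close> are represented by coefficient functions;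
  \<open>d\<close> is the number of terms, so the degree is less than \<open>d\<close>.\<close>

definition (in ring) pow_comb :: "(nat \<Rightarrow> 'a) \<Rightarrow> 'a \<Rightarrow> nat \<Rightarrow> 'a" where
  "pow_comb c u d = (\<Oplus>j\<in>{..<d}. c j \<otimes> u [^] j)"

definition (in ring) pow_span :: "'a set \<Rightarrow> 'a \<Rightarrow> nat \<Rightarrow> 'a set" where
  "pow_span F u d = (\<lambda>c. pow_comb c u d) ` ({..<d} \<rightarrow> F)"

locale subfield_elem = field +
  fixes F u
  assumes F: "subfield F R" and u: "u \<in> carrier R"
begin

lemma F_carrier: "x \<in> F \<Longrightarrow> x \<in> carrier R"
  using subfieldE(3)[OF F] by blast

lemma F_closed [simp]:
  "x \<in> F \<Longrightarrow> y \<in> F \<Longrightarrow> x \<oplus> y \<in> F" "x \<in> F \<Longrightarrow> y \<in> F \<Longrightarrow> x \<otimes> y \<in> F"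
  "x \<in> F \<Longrightarrow> \<ominus> x \<in> F" "\<zero> \<in> F" "\<one> \<in> F"
  "x \<in> F \<Longrightarrow> y \<in> F \<Longrightarrow> x \<ominus> y \<in> F"
  using subringE[OF subfieldE(1)[OF F]] by (auto simp: a_minus_def)

lemma pow_comb_closed [simp]:
  "(\<And>j. j < d \<Longrightarrow> c j \<in> F) \<Longrightarrow> pow_comb c u d \<in> carrier R"
  using F_carrier u by (auto simp: pow_comb_def intro!: finsum_closed)

lemma pow_comb_Suc:
  assumes "\<And>j. j \<le> d \<Longrightarrow> c j \<in> F"
  shows "pow_comb c u (Suc d) = c d \<otimes> u [^] d \<oplus> pow_comb c u d"
  unfolding pow_comb_def using assms F_carrier u by (intro finsum_lessThan_Suc) auto

lemma pow_comb_add: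
  assumes "\<And>j. j < d \<Longrightarrow> c j \<in> F" "\<And>j. j < d \<Longrightarrow> e j \<in> F"
  shows "pow_comb (\<lambda>j. c j \<oplus> e j) u d = pow_comb c u d \<oplus> pow_comb e u d"
proof -
  have "pow_comb c u d \<oplus> pow_comb e u d = (\<Oplus>j\<in>{..<d}. c j \<otimes> u [^] j \<oplus> e j \<otimes> u [^] j)"
    unfolding pow_comb_def using assms F_carrier u by (intro finsum_addf[symmetric]) auto
  also have "\<dots> = pow_comb (\<lambda>j. c j \<oplus> e j) u d"
    unfolding pow_comb_def using assms F_carrier u
    by (intro finsum_cong') (auto simp: l_distr)
  finally show ?thesis by simp
qed

lemma pow_comb_smult:
  assumes "\<And>j. j < d \<Longrightarrow> c j \<in> F" "a \<in> F"
  shows "pow_comb (\<lambda>j. a \<otimes> c j) u d = a \<otimes> pow_comb c u d"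
proof -
  have "a \<otimes> pow_comb c u d = (\<Oplus>j\<in>{..<d}. a \<otimes> (c j \<otimes> u [^] j))"
    unfolding pow_comb_def using assms F_carrier u by (intro finsum_rdistr) auto
  also have "\<dots> = pow_comb (\<lambda>j. a \<otimes> c j) u d"
    unfolding pow_comb_def using assms F_carrier u
    by (intro finsum_cong') (auto simp: m_assoc)
  finally show ?thesis by simp
qed

lemma pow_comb_shift:
  assumes "\<And>j. j < d \<Longrightarrow> c j \<in> F"
  shows "u \<otimes> pow_comb c u d = pow_comb (case_nat \<zero> c) u (Suc d)"
proof -
  have "u \<otimes> pow_comb c u d = (\<Oplus>j\<in>{..<d}. u \<otimes> (c j \<otimes> u [^] j))"
    unfolding pow_comb_def using assms F_carrier u by (intro finsum_rdistr) auto
  also have "\<dots> = (\<Oplus>j\<in>{..<d}. c j \<otimes> u [^] Suc j)"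
    using assms F_carrier u by (intro finsum_cong') (auto simp: m_ac)
  also have "\<dots> = pow_comb (case_nat \<zero> c) u (Suc d)"
    unfolding pow_comb_def using assms F_carrier u
    by (subst finsum_lessThan_Suc_shift) (auto split: nat.split intro!: finsum_closed)
  finally show ?thesis .
qed

lemma pow_span_add: "x \<in> pow_span F u d \<Longrightarrow> y \<in> pow_span F u d \<Longrightarrow> x \<oplus> y \<in> pow_span F u d"
  unfolding pow_span_def
  by (auto simp: pow_comb_add[symmetric] Pi_iff intro!: imageI)

lemma pow_span_smult: "x \<in> pow_span F u d \<Longrightarrow> a \<in> F \<Longrightarrow> a \<otimes> x \<in> pow_span F u d"
  unfolding pow_span_def
  by (auto simp: pow_comb_smult[symmetric] Pi_iff intro!: imageI)

lemma pow_span_carrier: "pow_span F u d \<subseteq> carrier R"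
  by (auto simp: pow_span_def Pi_iff intro!: pow_comb_closed)

lemma card_pow_span:
  assumes "finite F"
  shows "finite (pow_span F u d)" "card (pow_span F u d) \<le> card F ^ d"
proof -
  \<comment> \<open>Only coefficients below \<open>d\<close> matter, so extensional functions
    suffice, and of these there are finitely many.\<close>
  have eq: "pow_span F u d = (\<lambda>c. pow_comb c u d) ` ({..<d} \<rightarrow>\<^sub>E F)"
  proof
    show "pow_span F u d \<subseteq> (\<lambda>c. pow_comb c u d) ` ({..<d} \<rightarrow>\<^sub>E F)"
    proof
      fix x assume "x \<in> pow_span F u d"
      then obtain c where c: "c \<in> {..<d} \<rightarrow> F" "x = pow_comb c u d" by (auto simp: pow_span_def)
      have "pow_comb (restrict c {..<d}) u d = pow_comb c u d"
        unfolding pow_comb_def using c F_carrier u by (intro finsum_cong') auto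
      then show "x \<in> (\<lambda>c. pow_comb c u d) ` ({..<d} \<rightarrow>\<^sub>E F)"
        using c by (intro image_eqI[where x="restrict c {..<d}"]) auto
    qed
  qed (auto simp: pow_span_def)
  show "finite (pow_span F u d)" unfolding eq using assms by (intro finite_imageI finite_PiE) auto
  have "card (pow_span F u d) \<le> card ({..<d} \<rightarrow>\<^sub>E F)"
    unfolding eq using assms by (intro card_image_le finite_PiE) auto
  then show "card (pow_span F u d) \<le> card F ^ d" by (simp add: card_PiE)
qed

text \<open>The last nonzero coefficient of the relation can be inverted in \<open>F\<close>, which
  expresses \<open>u [^] d\<close> through lower powers; multiplication by \<open>u\<close> then
  does not leave their span. This stands in for division with remainder by a minimal
  polynomial.\<close>

lemma pow_span_closed_if_relation:
  assumes e: "\<And>j. j < h \<Longrightarrow> e j \<in> F" and rel: "pow_comb e u h = \<zero>" and h: "0 < h"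
    and e0: "e 0 \<noteq> \<zero>"
  obtains d where "0 < d" "d < h" "\<one> \<in> pow_span F u d"
    "\<And>x. x \<in> pow_span F u d \<Longrightarrow> u \<otimes> x \<in> pow_span F u d"
proof -
  define d where "d = Max {j. j < h \<and> e j \<noteq> \<zero>}"
  have fin: "finite {j. j < h \<and> e j \<noteq> \<zero>}" by simp
  have ne: "{j. j < h \<and> e j \<noteq> \<zero>} \<noteq> {}" using h e0 by blast
  have d: "d < h" "e d \<noteq> \<zero>" using Max_in[OF fin ne] by (auto simp: d_def)
  have top: "e j = \<zero>" if "d < j" "j < h" for j
    using that Max_ge[OF fin, of j] unfolding d_def by (metis (mono_tags, lifting) leD mem_Collect_eq)
  have "pow_comb e u h = pow_comb e u (Suc d)"
    unfolding pow_comb_def using d top e F_carrier u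
    by (intro add.finprod_mono_neutral_cong_right) auto
  then have rel': "e d \<otimes> u [^] d \<oplus> pow_comb e u d = \<zero>"
    using rel pow_comb_Suc[of d e] d e by simp
  have edu: "e d \<in> Units R" and edF: "e d \<in> F"
    using d e F_carrier by (auto simp: field_Units)
  have iF: "inv (e d) \<in> F"
    using subfield_m_inv(1)[OF F, of "e d"] edF d by simp
  have cc: "pow_comb e u d \<in> carrier R" using e d by simp
  have "e d \<otimes> u [^] d = \<ominus> pow_comb e u d"
    using rel' cc F_carrier[OF edF] u by (simp add: minus_equality)
  then have "u [^] d = inv (e d) \<otimes> (\<ominus> pow_comb e u d)"
    using edu u F_carrier[OF edF] by (metis m_assoc Units_l_inv l_one nat_pow_closed Units_inv_closed)
  also have "\<dots> = (\<ominus> (inv (e d))) \<otimes> pow_comb e u d"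
    using cc F_carrier[OF iF] by (simp add: l_minus r_minus)
  also have "\<dots> \<in> pow_span F u d"
    using e d iF by (intro pow_span_smult) (auto simp: pow_span_def)
  finally have ud: "u [^] d \<in> pow_span F u d" .
  \<comment> \<open>For \<open>d = 0\<close> the span contains only zero, yet \<open>u [^] d\<close>
    is one.\<close>
  have d0: "0 < d"
  proof (rule ccontr)
    assume "\<not> 0 < d"
    then show False using ud by (simp add: pow_span_def pow_comb_def)
  qed
  have "pow_comb (\<lambda>j. if j = 0 then \<one> else \<zero>) u d = \<one>"
    unfolding pow_comb_def using d0 u
      add.finprod_singleton[of 0 "{..<d}" "\<lambda>_. \<one>"]
    by (subst add.finprod_cong'[where g = "\<lambda>j. if 0 = j then \<one> else \<zero>" and B="{..<d}"]) auto
  then have one: "\<one> \<in> pow_span F u d"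
    unfolding pow_span_def by (intro image_eqI[where x="\<lambda>j. if j = 0 then \<one> else \<zero>"]) auto
  have "u \<otimes> x \<in> pow_span F u d" if x: "x \<in> pow_span F u d" for x
  proof -
    obtain c where c: "\<And>j. j < d \<Longrightarrow> c j \<in> F" "x = pow_comb c u d"
      using x by (auto simp: pow_span_def)
    let ?c = "case_nat \<zero> c"
    have cF: "?c j \<in> F" if "j \<le> d" for j using that c by (auto split: nat.split)
    have "u \<otimes> x = ?c d \<otimes> u [^] d \<oplus> pow_comb ?c u d"
      using pow_comb_shift[of d c] pow_comb_Suc[of d ?c] c cF by simp
    moreover have "pow_comb ?c u d \<in> pow_span F u d"
      using cF by (auto simp: pow_span_def)
    ultimately show ?thesis using cF[of d] ud by (simp add: pow_span_add pow_span_smult)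
  qed
  then show ?thesis using that d0 d one by blast
qed

text \<open>The monic polynomials of degree \<open>d\<close> with constant term \<open>k\<close>, evaluated at \<open>u\<close>.\<close>

definition monic_value :: "nat \<Rightarrow> 'a \<Rightarrow> 'a \<Rightarrow> bool" where
  "monic_value d k x \<longleftrightarrow> (\<exists>c. (\<forall>j. c j \<in> F) \<and> (\<forall>j>d. c j = \<zero>) \<and> c d = \<one> \<and> c 0 = k \<and>
     x = pow_comb c u (Suc d))"

lemma monic_value_one: "monic_value 0 \<one> \<one>"
  unfolding monic_value_def
  by (rule exI[where x="\<lambda>j. if j = 0 then \<one> else \<zero>"]) (auto simp: pow_comb_def lessThan_Suc)

text \<open>A factor X + e shifts the coefficients and adds \<open>e\<close> times the old ones. The
  constant term is multiplied by \<open>e\<close>, and it is the constant term that will tell two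
  products apart.\<close>

lemma monic_value_mult:
  assumes x: "monic_value d k x" and e: "e \<in> F"
  shows "monic_value (Suc d) (e \<otimes> k) ((u \<oplus> e) \<otimes> x)"
proof -
  obtain c where c: "\<And>j. c j \<in> F" "\<And>j. j > d \<Longrightarrow> c j = \<zero>" "c d = \<one>" "c 0 = k"
    "x = pow_comb c u (Suc d)" using x by (auto simp: monic_value_def)
  have cF: "case_nat \<zero> c j \<in> F" for j using c by (auto split: nat.split)
  let ?c = "\<lambda>j. case_nat \<zero> c j \<oplus> e \<otimes> c j"
  have x': "x = pow_comb c u (Suc (Suc d))"
    using pow_comb_Suc[of "Suc d" c] c u by simp
  have "(u \<oplus> e) \<otimes> x = u \<otimes> pow_comb c u (Suc d) \<oplus> e \<otimes> pow_comb c u (Suc (Suc d))"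
    using c u e F_carrier x' by (simp add: l_distr)
  also have "\<dots> = pow_comb ?c u (Suc (Suc d))"
    using c cF e pow_comb_shift[of "Suc d" c] by (simp add: pow_comb_add pow_comb_smult)
  finally show ?thesis
    unfolding monic_value_def using c e cF F_carrier
    by (intro exI[where x="?c"]) (auto split: nat.split)
qed

lemma monic_value_pow_mult:
  assumes x: "monic_value d k x" and e: "e \<in> F"
  shows "monic_value (d + m) (e [^] m \<otimes> k) ((u \<oplus> e) [^] m \<otimes> x)"
proof -
  have kx: "k \<in> carrier R" "x \<in> carrier R"
    using x F_carrier by (auto simp: monic_value_def)
  show ?thesis
  proof (induction m)
    case 0
    then show ?case using x kx by simp
  next
    case (Suc m)
    show ?case using monic_value_mult[OF Suc e] e F_carrier[OF e] u kx by (simp add: m_ac)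
  qed
qed

lemma monic_value_finprod:
  assumes x: "monic_value d k x" and A: "finite A" and e: "\<And>i. i \<in> A \<Longrightarrow> e i \<in> F"
  shows "monic_value (d + (\<Sum>i\<in>A. m i)) ((\<Otimes>i\<in>A. e i [^] (m i :: nat)) \<otimes> k)
    ((\<Otimes>i\<in>A. (u \<oplus> e i) [^] m i) \<otimes> x)"
proof -
  have kx: "k \<in> carrier R" "x \<in> carrier R"
    using x F_carrier by (auto simp: monic_value_def)
  show ?thesis using A e
  proof (induction A rule: finite_induct)
    case empty
    then show ?case using x kx by simp
  next
    case (insert i A)
    have IH: "monic_value (d + (\<Sum>i\<in>A. m i)) ((\<Otimes>i\<in>A. e i [^] m i) \<otimes> k)
      ((\<Otimes>i\<in>A. (u \<oplus> e i) [^] m i) \<otimes> x)" using insert.IH insert.prems by simp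
    have c: "\<And>j. j \<in> insert i A \<Longrightarrow> e j \<in> carrier R" using insert.prems F_carrier by simp
    have 1: "(\<Otimes>i\<in>insert i A. e i [^] m i) = e i [^] m i \<otimes> (\<Otimes>i\<in>A. e i [^] m i)"
      using insert.hyps c by (intro finprod_insert) auto
    have 2: "(\<Otimes>i\<in>insert i A. (u \<oplus> e i) [^] m i) = (u \<oplus> e i) [^] m i \<otimes> (\<Otimes>i\<in>A. (u \<oplus> e i) [^] m i)"
      using insert.hyps c u by (intro finprod_insert) auto
    have 3: "(\<Otimes>i\<in>A. e i [^] m i) \<in> carrier R" "(\<Otimes>i\<in>A. (u \<oplus> e i) [^] m i) \<in> carrier R"
      "e i \<in> carrier R"
      using c u by (auto intro!: finprod_closed)
    have 4: "d + (\<Sum>i\<in>insert i A. m i) = d + (\<Sum>i\<in>A. m i) + m i"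
      using insert by simp
    have ei: "e i \<in> F" using insert.prems by simp
    show ?case
      unfolding 1 2 4 m_assoc[OF nat_pow_closed[OF 3(3)] 3(1) kx(1)]
        m_assoc[OF nat_pow_closed[OF a_closed[OF u 3(3)]] 3(2) kx(2)]
      by (rule monic_value_pow_mult[OF IH ei])
  qed
qed

text \<open>The difference of the two polynomials has degree less than \<open>d\<close> and a
  nonzero constant term. If it vanished at \<open>u\<close>, the span of fewer than \<open>d\<close>
  powers of \<open>u\<close> would be stable under \<open>u\<close> and hence under
  \<open>u \<ominus> a\<close>. It would contain all powers of this generator and so the whole
  field, which is too large.\<close>

lemma monic_values_distinct:
  assumes x: "monic_value d \<zero> x" and y: "monic_value d k y" and k: "k \<noteq> \<zero>"
    and card: "card F ^ d \<le> card (carrier R)" "finite (carrier R)"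
    and theta: "a \<in> F" "carrier R \<subseteq> insert \<zero> {(u \<ominus> a) [^] i | i::nat. True}"
  shows "x \<noteq> y"
proof
  assume "x = y"
  obtain c where c: "\<And>j. c j \<in> F" "c d = \<one>" "c 0 = \<zero>"
    "x = pow_comb c u (Suc d)" using x by (auto simp: monic_value_def)
  obtain c' where c': "\<And>j. c' j \<in> F" "c' d = \<one>" "c' 0 = k"
    "y = pow_comb c' u (Suc d)" using y by (auto simp: monic_value_def)
  have d: "0 < d" using c by (metis gr0I one_not_zero)
  let ?e = "\<lambda>j. c' j \<oplus> (\<ominus> \<one>) \<otimes> c j"
  have cc: "pow_comb c u d \<in> carrier R" "pow_comb c' u d \<in> carrier R" using c c' by auto
  have "u [^] d \<oplus> pow_comb c u d = u [^] d \<oplus> pow_comb c' u d"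
    using \<open>x = y\<close> c c' u by (simp add: pow_comb_Suc)
  then have "pow_comb c u d = pow_comb c' u d" using cc u by simp
  then have rel: "pow_comb ?e u d = \<zero>"
    using c c' cc by (simp add: pow_comb_add pow_comb_smult l_minus r_neg)
  have e0: "?e 0 \<noteq> \<zero>" using c c' k F_carrier[of k] by auto
  have eF: "?e j \<in> F" for j using c c' by simp
  obtain D where D: "0 < D" "D < d" "\<one> \<in> pow_span F u D"
    "\<And>x. x \<in> pow_span F u D \<Longrightarrow> u \<otimes> x \<in> pow_span F u D"
    by (rule pow_span_closed_if_relation[OF eF rel d e0]) (rule that)
  have finF: "finite F" by (rule finite_subset[OF subsetI card(2)]) (rule F_carrier)
  have closed: "(u \<ominus> a) \<otimes> x \<in> pow_span F u D" if "x \<in> pow_span F u D" for x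
  proof -
    have xc: "x \<in> carrier R" using subsetD[OF pow_span_carrier that] .
    have "(u \<ominus> a) \<otimes> x = u \<otimes> x \<oplus> (\<ominus> a) \<otimes> x"
      using xc u F_carrier[OF theta(1)] by (simp add: a_minus_def l_distr)
    then show ?thesis using that D theta(1) by (simp add: pow_span_add pow_span_smult)
  qed
  have pows: "(u \<ominus> a) [^] i \<in> pow_span F u D" for i :: nat
  proof (induction i)
    case (Suc i)
    then show ?case using closed[OF Suc] u F_carrier[OF theta(1)] by (simp add: m_comm)
  qed (use D in simp)
  have "\<zero> = \<zero> \<otimes> \<one>" by simp
  then have "\<zero> \<in> pow_span F u D" using pow_span_smult[OF D(3), of \<zero>] by simp
  then have "carrier R \<subseteq> pow_span F u D" using theta(2) pows by auto
  then have "card (carrier R) \<le> card F ^ D"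
    using card_pow_span[OF finF, of D] card_mono order_trans by blast
  moreover have "card F \<ge> 2"
  proof -
    have "card {\<zero>, \<one>} \<le> card F" using finF by (intro card_mono) auto
    then show ?thesis by simp
  qed
  then have "card F ^ D < card F ^ d" using D(2) by (intro power_strict_increasing) auto
  ultimately show False using card(1) by simp
qed

end

section \<open>The Bose--Chowla construction\<close>

lemma (in field) subfield_frobenius_fixed:
  assumes p: "Factorial_Ring.prime (p::nat)" and char: "[p] \<cdot> \<one> = \<zero>"
  shows "subfield {x \<in> carrier R. x [^] (p ^ m) = x} R"
proof (rule subfieldI')
  let ?Q = "p ^ m"
  let ?S = "{x \<in> carrier R. x [^] ?Q = x}"
  have Q0: "?Q \<noteq> 0" using p by auto
  show "subring ?S R"
  proof (rule subringI)
    fix x assume x: "x \<in> ?S"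
    \<comment> \<open>Additivity yields the power of the negative for \<open>p = 2\<close> and for
      odd \<open>p\<close> alike.\<close>
    have "x [^] ?Q \<oplus> (\<ominus> x) [^] ?Q = (x \<oplus> \<ominus> x) [^] ?Q"
      using x by (intro frobenius_pow_add[OF p char, symmetric]) auto
    also have "\<dots> = \<zero>" using x Q0 by (simp add: r_neg nat_pow_zero)
    finally have "(\<ominus> x) [^] ?Q \<oplus> x = \<zero>" using x by (simp add: a_comm)
    then show "\<ominus> x \<in> ?S" using x minus_equality[of "(\<ominus> x) [^] ?Q" x] by simp
  next
    fix x y assume "x \<in> ?S" "y \<in> ?S"
    then show "x \<oplus> y \<in> ?S" using frobenius_pow_add[OF p char, of x y m] by simp
  qed (auto simp: nat_pow_distrib)
  fix x assume x: "x \<in> ?S - {\<zero>}"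
  then have u: "x \<in> Units R" by (simp add: field_Units)
  have "x \<otimes> (inv x) [^] ?Q = \<one>"
    using nat_pow_distrib[of x "inv x" ?Q, symmetric] x u by simp
  then have "(inv x) [^] ?Q = inv x"
    using u x by (intro comm_inv_char[symmetric]) auto
  then show "inv x \<in> ?S" using u by simp
qed

text \<open>Both fields are fixed fields inside one algebraic closure of the prime field: an element
  fixed by the power \<open>p ^ k\<close> is fixed by all its iterates, so the smaller field lies in
  the larger one. The element type is that of the closure from
  \<open>exists_closure\<close>.\<close>

lemma finite_field_extension_exists:
  assumes p: "Factorial_Ring.prime (p::nat)" and k: "0 < k" and h: "0 < h"
  obtains K :: "((int list \<times> nat) multiset \<Rightarrow> int) ring" and F where
    "field K" "finite (carrier K)" "subfield F K" "card F = p ^ k" "card (carrier K) = (p ^ k) ^ h"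
proof -
  interpret P: residues_prime p "residue_ring (int p)"
    using p by (simp add: residues_prime_def)
  have Pchar: "[p] \<cdot>\<^bsub>residue_ring (int p)\<^esub> \<one>\<^bsub>residue_ring (int p)\<^esub> = \<zero>\<^bsub>residue_ring (int p)\<^esub>"
  proof -
    have "[j] \<cdot>\<^bsub>residue_ring (int p)\<^esub> \<one>\<^bsub>residue_ring (int p)\<^esub> = int j mod int p" for j :: nat
      by (induction j) (auto simp: P.res_add_eq P.res_zero_eq P.res_one_eq mod_simps add.commute)
    then show ?thesis by (simp add: P.res_zero_eq)
  qed
  obtain L :: "((int list \<times> nat) multiset \<Rightarrow> int) ring"
    where L: "algebraic_closure L (P.indexed_const ` (carrier (residue_ring (int p))))"
      and hom: "P.indexed_const \<in> ring_hom (residue_ring (int p)) L"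
    using P.exists_closure by blast
  interpret L: algebraic_closure L "P.indexed_const ` (carrier (residue_ring (int p)))" by (rule L)
  interpret H: ring_hom_ring "residue_ring (int p)" L P.indexed_const
    using hom P.ring_axioms L.ring_axioms by (intro ring_hom_ringI2)
  have "P.indexed_const ([j] \<cdot>\<^bsub>residue_ring (int p)\<^esub> \<one>\<^bsub>residue_ring (int p)\<^esub>) = [j] \<cdot>\<^bsub>L\<^esub> \<one>\<^bsub>L\<^esub>" for j :: nat
    by (induction j) auto
  then have char: "[p] \<cdot>\<^bsub>L\<^esub> \<one>\<^bsub>L\<^esub> = \<zero>\<^bsub>L\<^esub>" using Pchar H.hom_zero by metis
  define S where "S m = {x \<in> carrier L. x [^]\<^bsub>L\<^esub> (p ^ m) = x}" for m :: nat
  have sub: "subfield (S m) L" for m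
    unfolding S_def by (rule L.subfield_frobenius_fixed[OF p char])
  have card: "card (S m) = p ^ m" if "m > 0" for m
    unfolding S_def by (rule L.card_frobenius_fixed[OF p char that])
  let ?K = "L\<lparr>carrier := S (k * h)\<rparr>"
  have K: "field ?K" using L.subfield_iff(2)[OF sub] .
  interpret K: field ?K by (rule K)
  have incl: "S k \<subseteq> S (k * h)"
  proof
    fix x assume x: "x \<in> S k"
    then have xc: "x \<in> carrier L" "x [^]\<^bsub>L\<^esub> (p ^ k) = x" by (auto simp: S_def)
    have "x [^]\<^bsub>L\<^esub> ((p ^ k) ^ i) = x" for i :: nat
    proof (induction i)
      case (Suc i)
      have "x [^]\<^bsub>L\<^esub> ((p ^ k) ^ Suc i) = (x [^]\<^bsub>L\<^esub> (p ^ k)) [^]\<^bsub>L\<^esub> ((p ^ k) ^ i)"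
        using xc(1) by (simp add: L.nat_pow_pow)
      then show ?case using xc Suc by simp
    qed (use xc in simp)
    then show "x \<in> S (k * h)" using xc by (simp add: S_def power_mult)
  qed
  have F: "subfield (S k) ?K"
    using L.subfield_iff(2)[OF sub[of k]] incl by (intro K.subfield_iff(1)) auto
  have cK: "card (carrier ?K) = (p ^ k) ^ h" using card[of "k * h"] k h by (simp add: power_mult)
  have p0: "p > 0" using p prime_gt_0_nat by blast
  have fin: "finite (carrier ?K)"
    using cK p0 by (metis card_ge_0_finite zero_less_power)
  show thesis by (rule that[OF K fin F card[OF k] cK])
qed

lemma (in domain) nat_pow_nonzero:
  assumes "x \<in> carrier R" "x \<noteq> \<zero>" shows "x [^] (n::nat) \<noteq> \<zero>"
  by (induction n) (use assms in \<open>auto simp: integral_iff\<close>)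

text \<open>The Sidon condition takes its products in the multiplicative group, whereas the argument
  for it needs the addition of the field.\<close>

lemma (in field) finprod_mult_of_eq:
  assumes "finite A" "\<And>i. i \<in> A \<Longrightarrow> f i \<in> carrier R - {\<zero>}"
  shows "finprod (Multiplicative_Group.mult_of R) f A = finprod R f A" "finprod R f A \<noteq> \<zero>"
proof -
  interpret G: comm_group "Multiplicative_Group.mult_of R"
    unfolding mult_of_is_Units by (rule units_comm_group)
  have "finprod (Multiplicative_Group.mult_of R) f A = finprod R f A \<and> finprod R f A \<noteq> \<zero>"
    using assms
  proof (induction A rule: finite_induct)
    case (insert i A)
    have c: "f i \<in> carrier R" "f i \<noteq> \<zero>" "\<And>j. j \<in> A \<Longrightarrow> f j \<in> carrier R - {\<zero>}"
      using insert.prems by auto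
    have 1: "finprod (Multiplicative_Group.mult_of R) f (insert i A) = f i \<otimes> finprod (Multiplicative_Group.mult_of R) f A"
      using insert.hyps c by (subst G.finprod_insert) auto
    have 2: "finprod R f (insert i A) = f i \<otimes> finprod R f A"
      using insert.hyps c by (subst finprod_insert) auto
    have 3: "finprod R f A \<in> carrier R" using c by (intro finprod_closed) auto
    show ?case using insert.IH c 3 unfolding 1 2 by (simp add: integral_iff)
  qed simp
  then show "finprod (Multiplicative_Group.mult_of R) f A = finprod R f A" "finprod R f A \<noteq> \<zero>" by auto
qed

text \<open>Here \<open>\<theta>\<close> (\<open>t\<close> in the proof) generates the multiplicative group of a degree \<open>h\<close>
  extension of \<open>F\<close>, and the Sidon set consists of the elements \<open>\<theta> + a\<close> with \<open>a \<in> F\<close>.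
  After cancelling common factors, an equality of two products of \<open>h\<close> such elements is an algebraic
  equation of degree less than \<open>h\<close> for \<open>u = \<theta> + a\<^sub>i\<close>, in which only one side has constant term zero.\<close>

theorem (in field) bose_chowla:
  assumes F: "subfield F R" and fin: "finite (carrier R)" and card: "card (carrier R) = card F ^ h"
    and h: "2 \<le> h" and a: "inj_on a {..<n}" "a ` {..<n} \<subseteq> F"
  obtains b where "sidon_set (Multiplicative_Group.mult_of R) h n b"
proof -
  interpret G: comm_group "Multiplicative_Group.mult_of R"
    unfolding mult_of_is_Units by (rule units_comm_group)
  have FC: "F \<subseteq> carrier R" using subfieldE(3)[OF F] .
  have finF: "finite F" using FC fin finite_subset by blast
  have F01: "\<zero> \<in> F" "\<one> \<in> F" using subringE[OF subfieldE(1)[OF F]] by auto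
  have cF: "card F \<ge> 2"
  proof -
    have "card {\<zero>, \<one>} \<le> card F" using finF F01 by (intro card_mono) auto
    then show ?thesis by simp
  qed
  obtain t where t: "t \<in> carrier (Multiplicative_Group.mult_of R)" "carrier (Multiplicative_Group.mult_of R) = {t [^] i | i::nat. i \<in> UNIV}"
    using finite_field_mult_group_has_gen[OF fin] by auto
  have tc: "t \<in> carrier R" using t(1) by simp
  \<comment> \<open>This is where \<open>2 \<le> h\<close> enters. It keeps every
    \<open>t \<oplus> a i\<close> different from zero, so that these elements lie in the
    multiplicative group.\<close>
  have tF: "t \<notin> F"
  proof
    assume tF: "t \<in> F"
    have "t [^] i \<in> F" for i :: nat
      by (induction i) (use F01 tF subringE(6)[OF subfieldE(1)[OF F]] in auto)
    then have "carrier R - {\<zero>} \<subseteq> F" using t(2) by auto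
    then have "carrier R \<subseteq> F" using F01 by auto
    then have "card F ^ h \<le> card F" using card finF card_mono by metis
    moreover have "card F ^ 1 < card F ^ h" using cF h by (intro power_strict_increasing) auto
    ultimately show False by simp
  qed
  define b where "b i = t \<oplus> a i" for i
  have aF: "a i \<in> F" "a i \<in> carrier R" if "i < n" for i using a that FC by auto
  have bc: "b i \<in> carrier R" if "i < n" for i using aF[OF that] tc by (simp add: b_def)
  have b0: "b i \<noteq> \<zero>" if "i < n" for i
  proof
    assume "b i = \<zero>"
    then have "t = \<ominus> a i" using aF[OF that] tc by (simp add: b_def minus_equality)
    then show False using tF aF[OF that] subringE(5)[OF subfieldE(1)[OF F]] by simp
  qed
  have key: "(\<Otimes>j\<in>{..<n}. b j [^] r j) \<noteq> (\<Otimes>j\<in>{..<n}. b j [^] s j)"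
    if r: "(\<Sum>j<n. r j) = h" and s: "(\<Sum>j<n. s j) = h" and i: "i < n" "s i < r i"
    for r s :: "nat \<Rightarrow> nat" and i
  proof -
    define A where "A = {..<n} - {i}"
    have A: "finite A" "{..<n} = insert i A" "i \<notin> A" using i by (auto simp: A_def)
    have An: "j < n" if "j \<in> A" for j using that by (simp add: A_def)
    interpret S: subfield_elem R F "b i"
      by (intro subfield_elem.intro subfield_elem_axioms.intro field_axioms F bc[OF i(1)])
    \<comment> \<open>Seen from \<open>u = b i\<close>, every other \<open>b j\<close> is
      \<open>u\<close> plus a nonzero element \<open>e j\<close> of \<open>F\<close>, so the product
      over \<open>A\<close> is a monic value whose constant term is a product of nonzero
      elements.\<close>
    define e where "e j = a j \<ominus> a i" for j
    have eF: "e j \<in> F" if "j \<in> A" for j using aF[OF An[OF that]] aF[OF i(1)] by (simp add: e_def)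
    have be: "b i \<oplus> e j = b j" if "j \<in> A" for j
      using aF(2)[OF An[OF that]] aF(2)[OF i(1)] tc
      by (simp add: b_def e_def a_minus_def a_assoc a_lcomm[of "a i"] r_neg)
    have e0: "e j \<noteq> \<zero>" if "j \<in> A" for j
    proof -
      have "a j \<noteq> a i" using that a(1) i by (auto simp: A_def inj_on_def)
      then show ?thesis using aF(2)[OF An[OF that]] aF(2)[OF i(1)] by (simp add: e_def r_right_minus_eq)
    qed
    define Pr where "Pr v = (\<Otimes>j\<in>A. b j [^] (v j :: nat))" for v
    have Prc: "Pr v \<in> carrier R" for v unfolding Pr_def using bc An by (intro finprod_closed) auto
    have split: "(\<Otimes>j\<in>{..<n}. b j [^] (v j :: nat)) = b i [^] v i \<otimes> Pr v" for v
      unfolding A(2) Pr_def using A bc An i by (intro finprod_insert) auto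
    have Pr: "S.monic_value (\<Sum>j\<in>A. v j) ((\<Otimes>j\<in>A. e j [^] v j) \<otimes> \<one>) (Pr v \<otimes> \<one>)" for v
    proof -
      have "(\<Otimes>j\<in>A. (b i \<oplus> e j) [^] v j) = Pr v"
        unfolding Pr_def using be bc An by (intro finprod_cong') auto
      then show ?thesis
        using S.monic_value_finprod[OF S.monic_value_one A(1), of e v] eF by simp
    qed
    have rs: "(\<Sum>j\<in>A. r j) + (r i - s i) = (\<Sum>j\<in>A. s j)"
      using r s i A unfolding A(2) by simp
    have le: "(\<Sum>j\<in>A. s j) \<le> h" using s A unfolding A(2) by simp
    let ?k = "(\<Otimes>j\<in>A. e j [^] r j) \<otimes> \<one>"
    have kc: "?k \<in> carrier R" using S.F_carrier[OF eF] by (auto intro!: finprod_closed)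
    \<comment> \<open>The surplus power of \<open>b i\<close> consists of factors with
      \<open>e = 0\<close>; there is at least one, so the constant term becomes zero.\<close>
    have "S.monic_value (\<Sum>j\<in>A. s j) (\<zero> [^] (r i - s i) \<otimes> ?k)
        ((b i \<oplus> \<zero>) [^] (r i - s i) \<otimes> (Pr r \<otimes> \<one>))"
      using S.monic_value_pow_mult[OF Pr[of r], of \<zero> "r i - s i"] rs by simp
    then have 1: "S.monic_value (\<Sum>j\<in>A. s j) \<zero> (b i [^] (r i - s i) \<otimes> Pr r)"
      using i kc bc[OF i(1)] Prc[of r] by (simp add: nat_pow_zero)
    have k0: "(\<Otimes>j\<in>A. e j [^] s j) \<noteq> \<zero>"
      using A(1) e0 S.F_carrier[OF eF] by (intro finprod_mult_of_eq(2)) (auto simp: nat_pow_nonzero)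
    have 2: "S.monic_value (\<Sum>j\<in>A. s j) (\<Otimes>j\<in>A. e j [^] s j) (Pr s)"
      using Pr[of s] Prc[of s] finprod_closed[of "\<lambda>j. e j [^] s j" A] S.F_carrier[OF eF] by simp
    have ne: "b i [^] (r i - s i) \<otimes> Pr r \<noteq> Pr s"
    proof (rule S.monic_values_distinct[OF 1 2 k0 _ fin aF(1)[OF i(1)]])
      show "card F ^ (\<Sum>j\<in>A. s j) \<le> card (carrier R)"
        unfolding card using cF le by (intro power_increasing) auto
      have "b i \<ominus> a i = t"
        using tc aF(2)[OF i(1)] by (simp add: b_def a_minus_def a_assoc r_neg)
      then show "carrier R \<subseteq> insert \<zero> {(b i \<ominus> a i) [^] j | j::nat. True}"
        using t(2) by auto
    qed
    have "b i [^] r i = b i [^] s i \<otimes> b i [^] (r i - s i)"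
      using i bc[OF i(1)] by (simp add: nat_pow_mult)
    then have "(\<Otimes>j\<in>{..<n}. b j [^] r j) = b i [^] s i \<otimes> (b i [^] (r i - s i) \<otimes> Pr r)"
      using bc[OF i(1)] Prc by (simp add: split m_assoc)
    moreover have "b i [^] s i \<noteq> \<zero>" using b0 bc i by (simp add: nat_pow_nonzero)
    ultimately show ?thesis
      using ne bc[OF i(1)] Prc m_lcancel[of "b i [^] s i" "b i [^] (r i - s i) \<otimes> Pr r" "Pr s"]
      by (simp add: split)
  qed
  have "sidon_set (Multiplicative_Group.mult_of R) h n b"
    unfolding sidon_set_def
  proof (intro conjI allI impI inj_onI)
    show "b i \<in> carrier (Multiplicative_Group.mult_of R)" if "i < n" for i using b0 bc that by simp
  next
    fix r s :: "nat \<Rightarrow> nat"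
    assume r: "r \<in> {r. (\<forall>i\<ge>n. r i = 0) \<and> (\<Sum>i<n. r i) = h}"
      and s: "s \<in> {r. (\<forall>i\<ge>n. r i = 0) \<and> (\<Sum>i<n. r i) = h}"
      and eq: "finprod (Multiplicative_Group.mult_of R) (\<lambda>i. b i [^]\<^bsub>Multiplicative_Group.mult_of R\<^esub> r i) {..<n} =
          finprod (Multiplicative_Group.mult_of R) (\<lambda>i. b i [^]\<^bsub>Multiplicative_Group.mult_of R\<^esub> s i) {..<n}"
    have fp: "finprod (Multiplicative_Group.mult_of R) (\<lambda>i. b i [^]\<^bsub>Multiplicative_Group.mult_of R\<^esub> v i) {..<n} = (\<Otimes>j\<in>{..<n}. b j [^] v j)"
      for v :: "nat \<Rightarrow> nat"
    proof -
      have "finprod (Multiplicative_Group.mult_of R) (\<lambda>i. b i [^] v i) {..<n} = (\<Otimes>j\<in>{..<n}. b j [^] v j)"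
        using b0 bc by (intro finprod_mult_of_eq(1)) (auto simp: nat_pow_nonzero)
      then show ?thesis by (simp add: Multiplicative_Group.nat_pow_mult_of)
    qed
    show "r = s"
    proof (rule ccontr)
      assume "r \<noteq> s"
      then obtain i where i: "r i \<noteq> s i" by blast
      have "i < n" using r s i by (metis (mono_tags, lifting) mem_Collect_eq not_le)
      then show False
        using key[of r s i] key[of s r i] i r s eq unfolding fp
        by (cases "r i < s i") auto
    qed
  qed
  then show thesis by (rule that)
qed

section \<open>Orders of groups with Sidon sets\<close>

text \<open>Transport of structure along a numbering of the carrier. The finite fields above have
  another element type, while \<open>min_sidon_group_order\<close> admits only groups of
  naturals.\<close>

lemma sidon_set_nat_group:
  assumes G: "comm_group G" and fin: "finite (carrier G)" and S: "sidon_set G h n b"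
  shows "\<exists>(H :: nat monoid) c. comm_group H \<and> finite (carrier H) \<and> card (carrier H) = card (carrier G) \<and>
    sidon_set H h n c"
proof -
  interpret G: comm_group G by (rule G)
  obtain f where f: "bij_betw f (carrier G) {0..<card (carrier G)}"
    using ex_bij_betw_finite_nat[OF fin] by blast
  define g where "g = inv_into (carrier G) f"
  have gf [simp]: "g (f x) = x" if "x \<in> carrier G" for x
    using that f by (simp add: g_def bij_betw_def)
  have inj: "inj_on f (carrier G)" using f by (simp add: bij_betw_def)
  define H where "H = \<lparr>carrier = f ` carrier G, monoid.mult = \<lambda>x y. f (g x \<otimes>\<^bsub>G\<^esub> g y), one = f \<one>\<^bsub>G\<^esub>\<rparr>"
  have H: "comm_group H"
  proof (rule comm_groupI)
    fix x assume "x \<in> carrier H"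
    then obtain y where y: "y \<in> carrier G" "x = f y" by (auto simp: H_def)
    show "\<exists>z\<in>carrier H. z \<otimes>\<^bsub>H\<^esub> x = \<one>\<^bsub>H\<^esub>"
      by (rule bexI[where x="f (inv\<^bsub>G\<^esub> y)"]) (use y in \<open>auto simp: H_def\<close>)
  qed (auto simp: H_def G.m_ac)
  interpret H: comm_group H by (rule H)
  have hom: "f \<in> hom G H" by (auto simp: hom_def H_def)
  interpret f: group_hom G H f using hom by unfold_locales
  have fp: "f (finprod G u A) = finprod H (\<lambda>i. f (u i)) A" if "finite A" "\<And>i. i \<in> A \<Longrightarrow> u i \<in> carrier G"
    for u :: "nat \<Rightarrow> 'a" and A
    using that
  proof (induction A rule: finite_induct)
    case (insert i A)
    have 1: "finprod G u (insert i A) = u i \<otimes>\<^bsub>G\<^esub> finprod G u A"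
      using insert.hyps insert.prems by (intro G.finprod_insert) auto
    have 2: "finprod H (\<lambda>i. f (u i)) (insert i A) = f (u i) \<otimes>\<^bsub>H\<^esub> finprod H (\<lambda>i. f (u i)) A"
      using insert.hyps insert.prems by (intro H.finprod_insert) auto
    have 3: "finprod G u A \<in> carrier G" using insert.prems by (intro G.finprod_closed) auto
    show ?case unfolding 1 2 using insert.IH insert.prems 3 by simp
  qed simp
  have bc: "b i \<in> carrier G" if "i < n" for i using S that by (simp add: sidon_set_def)
  have "sidon_set H h n (f \<circ> b)"
    unfolding sidon_set_def
  proof (intro conjI allI impI)
    show "(f \<circ> b) i \<in> carrier H" if "i < n" for i using bc[OF that] by simp
    have eq: "finprod H (\<lambda>i. (f \<circ> b) i [^]\<^bsub>H\<^esub> r i) {..<n} = f (finprod G (\<lambda>i. b i [^]\<^bsub>G\<^esub> r i) {..<n})"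
      for r :: "nat \<Rightarrow> nat"
    proof -
      have "f (finprod G (\<lambda>i. b i [^]\<^bsub>G\<^esub> r i) {..<n}) = finprod H (\<lambda>i. f (b i [^]\<^bsub>G\<^esub> r i)) {..<n}"
        using bc by (intro fp) auto
      also have "\<dots> = finprod H (\<lambda>i. (f \<circ> b) i [^]\<^bsub>H\<^esub> r i) {..<n}"
        using bc by (intro H.finprod_cong') (auto simp: f.hom_nat_pow)
      finally show ?thesis by simp
    qed
    have cl: "finprod G (\<lambda>i. b i [^]\<^bsub>G\<^esub> r i) {..<n} \<in> carrier G" for r :: "nat \<Rightarrow> nat"
      using bc by (intro G.finprod_closed) auto
    show "inj_on (\<lambda>r. finprod H (\<lambda>i. (f \<circ> b) i [^]\<^bsub>H\<^esub> r i) {..<n})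
        {r. (\<forall>i\<ge>n. r i = 0) \<and> (\<Sum>i<n. r i) = h}"
      unfolding eq
    proof (rule inj_onI)
      let ?P = "\<lambda>r. finprod G (\<lambda>i. b i [^]\<^bsub>G\<^esub> r i) {..<n}"
      fix r s :: "nat \<Rightarrow> nat"
      assume rs: "r \<in> {r. (\<forall>i\<ge>n. r i = 0) \<and> (\<Sum>i<n. r i) = h}"
        "s \<in> {r. (\<forall>i\<ge>n. r i = 0) \<and> (\<Sum>i<n. r i) = h}"
        and "f (?P r) = f (?P s)"
      then have "?P r = ?P s" using inj_onD[OF inj _ cl cl] by simp
      moreover have "inj_on ?P {r. (\<forall>i\<ge>n. r i = 0) \<and> (\<Sum>i<n. r i) = h}"
        using S by (simp add: sidon_set_def)
      ultimately show "r = s" using rs by (simp add: inj_onD)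
    qed
  qed
  moreover have carH: "carrier H = f ` carrier G"
    unfolding H_def by (rule partial_object.simps(1))
  have "finite (carrier H)" unfolding carH by (rule finite_imageI[OF fin])
  moreover have "card (carrier H) = card (carrier G)" unfolding carH by (rule card_image[OF inj])
  ultimately show ?thesis using H by metis
qed

lemma min_sidon_group_order_le:
  assumes "comm_group G" "finite (carrier G)" "sidon_set G h n b"
  shows "min_sidon_group_order h n \<le> card (carrier G)"
  unfolding min_sidon_group_order_def
  using sidon_set_nat_group[OF assms] by (intro Least_le) metis

lemma integer_mod_group_sidon:
  assumes N: "0 < N" and c: "\<And>i. i < n \<Longrightarrow> c i < N"
    and inj: "\<And>r s. (\<And>i. n \<le> i \<Longrightarrow> r i = 0) \<Longrightarrow> (\<Sum>i<n. r i) = h \<Longrightarrow>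
      (\<And>i. n \<le> i \<Longrightarrow> s i = 0) \<Longrightarrow> (\<Sum>i<n. s i) = h \<Longrightarrow>
      (\<Sum>i<n. r i * c i) mod N = (\<Sum>i<n. s i * c i) mod N \<Longrightarrow> r = s"
  shows "sidon_set (integer_mod_group N) h n (\<lambda>i. int (c i))"
proof -
  interpret G: comm_group "integer_mod_group N" by simp
  have car: "int x \<in> carrier (integer_mod_group N) \<longleftrightarrow> x < N" for x
    using N by (simp add: carrier_integer_mod_group)
  have fp: "finprod (integer_mod_group N) (\<lambda>i. int (c i) [^]\<^bsub>integer_mod_group N\<^esub> (r i :: nat)) A =
    int ((\<Sum>i\<in>A. r i * c i) mod N)" if "finite A" "A \<subseteq> {..<n}" for A and r :: "nat \<Rightarrow> nat"
    using that
  proof (induction A rule: finite_induct)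
    case (insert i A)
    have "finprod (integer_mod_group N) (\<lambda>i. int (c i) [^]\<^bsub>integer_mod_group N\<^esub> (r i :: nat)) (insert i A)
      = (int (c i) [^]\<^bsub>integer_mod_group N\<^esub> r i) \<otimes>\<^bsub>integer_mod_group N\<^esub>
        finprod (integer_mod_group N) (\<lambda>i. int (c i) [^]\<^bsub>integer_mod_group N\<^esub> (r i :: nat)) A"
      using insert.hyps insert.prems c car by (intro G.finprod_insert) (auto simp: carrier_integer_mod_group)
    then show ?case using insert by (simp add: zmod_int mod_simps)
  qed simp
  show ?thesis
    unfolding sidon_set_def
  proof (intro conjI allI impI inj_onI)
    show "int (c i) \<in> carrier (integer_mod_group N)" if "i < n" for i using c[OF that] car by simp
  next
    fix r s :: "nat \<Rightarrow> nat"
    assume r: "r \<in> {r. (\<forall>i\<ge>n. r i = 0) \<and> (\<Sum>i<n. r i) = h}"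
      and s: "s \<in> {r. (\<forall>i\<ge>n. r i = 0) \<and> (\<Sum>i<n. r i) = h}"
      and eq: "finprod (integer_mod_group N) (\<lambda>i. int (c i) [^]\<^bsub>integer_mod_group N\<^esub> r i) {..<n} =
          finprod (integer_mod_group N) (\<lambda>i. int (c i) [^]\<^bsub>integer_mod_group N\<^esub> s i) {..<n}"
    have "(\<Sum>i<n. r i * c i) mod N = (\<Sum>i<n. s i * c i) mod N"
      using eq unfolding fp[OF finite_lessThan subset_refl] of_nat_eq_iff .
    then show "r = s" using r s by (intro inj) auto
  qed
qed

lemma min_sidon_group_order_le_mod:
  assumes "0 < N" "\<And>i. i < n \<Longrightarrow> c i < N"
    and "\<And>r s. (\<And>i. n \<le> i \<Longrightarrow> r i = 0) \<Longrightarrow> (\<Sum>i<n. r i) = h \<Longrightarrow>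
      (\<And>i. n \<le> i \<Longrightarrow> s i = 0) \<Longrightarrow> (\<Sum>i<n. s i) = h \<Longrightarrow>
      (\<Sum>i<n. r i * c i) mod N = (\<Sum>i<n. s i * c i) mod N \<Longrightarrow> r = s"
  shows "sidon_set (integer_mod_group N) h n (\<lambda>i. int (c i))" "min_sidon_group_order h n \<le> N"
proof -
  show S: "sidon_set (integer_mod_group N) h n (\<lambda>i. int (c i))"
    by (rule integer_mod_group_sidon[OF assms])
  have "finite (carrier (integer_mod_group N))" "card (carrier (integer_mod_group N)) = N"
    using assms(1) by (simp_all add: carrier_integer_mod_group)
  then show "min_sidon_group_order h n \<le> N"
    using min_sidon_group_order_le[OF abelian_integer_mod_group _ S] by simp
qed

lemma sidon_set_order_0: "sidon_set (integer_mod_group 1) 0 n (\<lambda>i. int 0)"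
proof (rule min_sidon_group_order_le_mod)
  fix r s :: "nat \<Rightarrow> nat"
  assume "\<And>i. n \<le> i \<Longrightarrow> r i = 0" "(\<Sum>i<n. r i) = 0" "\<And>i. n \<le> i \<Longrightarrow> s i = 0" "(\<Sum>i<n. s i) = 0"
  then have "r i = 0" "s i = 0" for i by (cases "i < n"; simp)+
  then show "r = s" by (simp add: fun_eq_iff)
qed simp_all

lemma sidon_set_order_1: "0 < n \<Longrightarrow> sidon_set (integer_mod_group n) 1 n (\<lambda>i. int i)"
proof (rule min_sidon_group_order_le_mod)
  fix r s :: "nat \<Rightarrow> nat"
  assume r: "\<And>i. n \<le> i \<Longrightarrow> r i = 0" "(\<Sum>i<n. r i) = 1"
    and s: "\<And>i. n \<le> i \<Longrightarrow> s i = 0" "(\<Sum>i<n. s i) = 1"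
    and eq: "(\<Sum>i<n. r i * i) mod n = (\<Sum>i<n. s i * i) mod n"
  have unit: "\<exists>i<n. v = (\<lambda>j. if j = i then 1 else 0)"
    if v: "\<And>i. n \<le> i \<Longrightarrow> v i = 0" "(\<Sum>i<n. v i) = 1" for v :: "nat \<Rightarrow> nat"
  proof -
    obtain i where i: "i < n" "v i = 1" "\<forall>j<n. j \<noteq> i \<longrightarrow> v j = 0"
      using v(2) sum_eq_Suc0_iff[of "{..<n}" v] by auto
    then show ?thesis using v(1) by (intro exI[of _ i]) (auto simp: fun_eq_iff, metis le_less_linear)
  qed
  obtain i j where ij: "i < n" "r = (\<lambda>k. if k = i then 1 else 0)" "j < n" "s = (\<lambda>k. if k = j then 1 else 0)"
    using unit[OF r] unit[OF s] by blast
  have "(\<Sum>k<n. (if k = l then 1 else 0) * k) = l" if "l < n" for l :: nat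
  proof -
    have "(\<Sum>k<n. (if k = l then 1 else 0) * k) = (\<Sum>k<n. if k = l then k else 0)"
      by (intro sum.cong) auto
    then show ?thesis using that by simp
  qed
  then show "r = s" using eq ij by simp
qed auto

text \<open>The ten sums of two elements of {0, 1, 3, 9} are 0, 1, 2, 3, 4, 6, 9, 10, 12 and 18.
  They are distinct, only 18 exceeds 12, and 18 - 13 = 5 is not among them.\<close>

lemma perfect_difference_set_13:
  fixes a b c d a' b' c' d' :: nat
  assumes sum: "a + b + c + d = 2" "a' + b' + c' + d' = 2"
    and eq: "(b + 3 * c + 9 * d) mod 13 = (b' + 3 * c' + 9 * d') mod 13"
  shows "a = a' \<and> b = b' \<and> c = c' \<and> d = d'"
proof -
  define v where "v = b + 3 * c + 9 * d"
  define v' where "v' = b' + 3 * c' + 9 * d'"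
  have no_wrap: False
    if "x + y + z \<le> 2" "x' + y' + z' \<le> 2" "x + 3 * y + 9 * z = x' + 3 * y' + 9 * z' + 13"
    for x y z x' y' z' :: nat
  proof -
    have "z = 2" "x = 0" "y = 0" "z' = 0" using that by linarith+
    moreover have "y' \<le> 1 \<or> 2 \<le> y'" by linarith
    ultimately show False using that by linarith
  qed
  have digits: "y = y' \<and> z = z' \<and> x = x'"
    if "x + y + z \<le> 2" "x' + y' + z' \<le> 2" "x + 3 * y + 9 * z = x' + 3 * y' + 9 * z'"
    for x y z x' y' z' :: nat
  proof -
    have "z = z'" using that by linarith
    moreover from this have "y = y'" using that by linarith
    ultimately show ?thesis using that by linarith
  qed
  have "v \<le> 18" "v' \<le> 18" using sum unfolding v_def v'_def by linarith+
  moreover have "v mod 13 = v' mod 13" using eq by (simp add: v_def v'_def)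
  ultimately have "v = v' \<or> v = v' + 13 \<or> v' = v + 13"
  proof -
    assume *: "v \<le> 18" "v' \<le> 18" "v mod 13 = v' mod 13"
    then have "v div 13 = 0 \<or> v div 13 = 1" "v' div 13 = 0 \<or> v' div 13 = 1"
      by (auto simp: less_2_cases_iff[symmetric] div_less_iff_less_mult)
    then show ?thesis
      using div_mult_mod_eq[of v 13] div_mult_mod_eq[of v' 13] *(3) by (elim disjE) linarith+
  qed
  moreover have "v \<noteq> v' + 13" "v' \<noteq> v + 13"
    using no_wrap[of b c d b' c' d'] no_wrap[of b' c' d' b c d] sum by (auto simp: v_def v'_def)
  ultimately have "v = v'" by blast
  then have "c = c' \<and> d = d' \<and> b = b'"
    using sum unfolding v_def v'_def by (intro digits) linarith+
  then show ?thesis using sum by simp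
qed

text \<open>For \<open>n = 4\<close> and \<open>t = 3\<close> the Sidon density is 216 / (24 g) with
  g the group order, and it has to exceed 2/3. This allows g = 13 but no larger order; the
  Bose--Chowla group for \<open>q = 4\<close> has 15 elements.\<close>

lemma min_sidon_group_order_2_4: "min_sidon_group_order 2 4 \<le> 13"
proof (rule min_sidon_group_order_le_mod(2)[where c="\<lambda>i. [0, 1, 3, 9] ! i"])
  fix r s :: "nat \<Rightarrow> nat"
  assume r: "\<And>i. 4 \<le> i \<Longrightarrow> r i = 0" "(\<Sum>i<4. r i) = 2"
    and s: "\<And>i. 4 \<le> i \<Longrightarrow> s i = 0" "(\<Sum>i<4. s i) = 2"
    and eq: "(\<Sum>i<4. r i * [0, 1, 3, 9] ! i) mod 13 = (\<Sum>i<4. s i * [0, 1, 3, 9] ! i) mod (13::nat)"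
  have set4: "{..<4::nat} = {0, 1, 2, 3}" by auto
  have 1: "r 0 + r 1 + r 2 + r 3 = 2" "s 0 + s 1 + s 2 + s 3 = 2"
    "(r 1 + 3 * r 2 + 9 * r 3) mod 13 = (s 1 + 3 * s 2 + 9 * s 3) mod 13"
    using r(2) s(2) eq by (simp_all add: set4 add.assoc mult.commute)
  have "r 0 = s 0 \<and> r 1 = s 1 \<and> r 2 = s 2 \<and> r 3 = s 3"
    using 1 by (rule perfect_difference_set_13)
  show "r = s"
  proof
    fix i :: nat
    consider "i = 0" | "i = 1" | "i = 2" | "i = 3" | "4 \<le> i" by linarith
    then show "r i = s i" using \<open>r 0 = s 0 \<and> _\<close> r(1) s(1) by cases auto
  qed
next
  fix i :: nat assume "i < 4"
  then consider "i = 0" | "i = 1" | "i = 2" | "i = 3" by linarith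
  then show "[0, 1, 3, 9] ! i < (13::nat)" by cases auto
qed simp

lemma bose_chowla_sidon_set:
  assumes q: "primepow q" and nq: "n \<le> q" and h: "2 \<le> h"
  obtains G :: "((int list \<times> nat) multiset \<Rightarrow> int) monoid" and b where
    "comm_group G" "finite (carrier G)" "card (carrier G) = q ^ h - 1" "sidon_set G h n b"
proof -
  obtain p k where p: "Factorial_Ring.prime p" and k: "0 < k" and q: "q = p ^ k"
    using q by (auto simp: primepow_def)
  obtain K :: "((int list \<times> nat) multiset \<Rightarrow> int) ring" and F where
    K: "field K" "finite (carrier K)" "subfield F K" "card F = p ^ k" "card (carrier K) = (p ^ k) ^ h"
    using finite_field_extension_exists[OF p k, of h] h by auto
  interpret K: field K by (rule K)
  have "finite F" using K(2) subfieldE(3)[OF K(3)] finite_subset by blast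
  then obtain a where a: "bij_betw a {0..<card F} F" using ex_bij_betw_nat_finite by blast
  have "inj_on a {..<n}" "a ` {..<n} \<subseteq> F"
  proof -
    have sub: "{..<n} \<subseteq> {0..<card F}" using nq q K(4) by auto
    then show "inj_on a {..<n}" using a inj_on_subset by (auto simp: bij_betw_def)
    show "a ` {..<n} \<subseteq> F" using a sub by (auto simp: bij_betw_def)
  qed
  then obtain b where b: "sidon_set (Multiplicative_Group.mult_of K) h n b"
    using K.bose_chowla[OF K(3) K(2)] K h by metis
  have "comm_group (Multiplicative_Group.mult_of K)"
    unfolding K.mult_of_is_Units by (rule K.units_comm_group)
  moreover have "finite (carrier (Multiplicative_Group.mult_of K))" using K(2) by simp
  moreover have "card (carrier (Multiplicative_Group.mult_of K)) = q ^ h - 1"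
    using K(2,5) q by simp
  ultimately show thesis using b that by blast
qed

section \<open>Bounds for the least group order\<close>

lemma next_primepow:
  shows "n \<le> next_primepow n" "primepow (next_primepow n)"
proof -
  have "primepow ((2::nat) ^ Suc n)" unfolding primepow_def by (intro exI[of _ 2] exI[of _ "Suc n"]) auto
  moreover have "n \<le> 2 ^ Suc n" using less_exp[of "Suc n"] by linarith
  ultimately have ex: "\<exists>q. n \<le> q \<and> primepow q" by blast
  show "n \<le> next_primepow n" "primepow (next_primepow n)"
    unfolding next_primepow_def using LeastI_ex[OF ex] by blast+
qed

lemma next_primepow_le: "n \<le> q \<Longrightarrow> primepow q \<Longrightarrow> next_primepow n \<le> q"
  unfolding next_primepow_def by (intro Least_le) auto

lemma next_primepow_ge_2: "2 \<le> next_primepow n"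
  using next_primepow(2)[of n] primepow_gt_Suc_0[of "next_primepow n"] by simp

lemma min_sidon_group_order_less_primepow:
  assumes "2 \<le> h"
  shows "min_sidon_group_order h n < next_primepow n ^ h"
proof -
  obtain G :: "((int list \<times> nat) multiset \<Rightarrow> int) monoid" and b where
    G: "comm_group G" "finite (carrier G)" "card (carrier G) = next_primepow n ^ h - 1" "sidon_set G h n b"
    using bose_chowla_sidon_set[OF next_primepow(2) next_primepow(1) assms] by blast
  have "next_primepow n ^ h > 0" using next_primepow_ge_2[of n] by simp
  then show ?thesis using min_sidon_group_order_le[OF G(1,2,4)] G(3) by linarith
qed

text \<open>Makes the minimum in \<open>min_sidon_group_order\<close> meaningful. Bose--Chowla
  starts with order 2, so cyclic groups serve for the orders 0 and 1.\<close>

lemma sidon_set_nat_exists: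
  assumes "0 < n"
  shows "\<exists>(G :: nat monoid) b. comm_group G \<and> finite (carrier G) \<and> sidon_set G h n b"
proof -
  consider "h = 0" | "h = 1" | "2 \<le> h" by linarith
  then show ?thesis
  proof cases
    case 1
    have "finite (carrier (integer_mod_group 1))" by (simp add: carrier_integer_mod_group)
    then show ?thesis
      using 1 sidon_set_nat_group[OF abelian_integer_mod_group _ sidon_set_order_0[of n]] by metis
  next
    case 2
    have "finite (carrier (integer_mod_group n))" using assms by (simp add: carrier_integer_mod_group)
    then show ?thesis
      using 2 sidon_set_nat_group[OF abelian_integer_mod_group _ sidon_set_order_1[OF assms]] by metis
  next
    case 3
    show ?thesis
      by (rule bose_chowla_sidon_set[OF next_primepow(2) next_primepow(1)[of n] 3])
        (metis sidon_set_nat_group)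
  qed
qed

lemma min_sidon_group_order_attained:
  assumes "0 < n"
  obtains G :: "nat monoid" and b where "comm_group G" "finite (carrier G)"
    "card (carrier G) = min_sidon_group_order h n" "sidon_set G h n b"
proof -
  have "\<exists>m. \<exists>(G :: nat monoid) b. comm_group G \<and> finite (carrier G) \<and> card (carrier G) = m \<and> sidon_set G h n b"
    using sidon_set_nat_exists[OF assms, of h] by blast
  from LeastI_ex[OF this] show thesis
    unfolding min_sidon_group_order_def[symmetric] using that by blast
qed

lemma min_sidon_group_order_pos:
  assumes "0 < n" shows "0 < min_sidon_group_order h n"
proof -
  obtain G :: "nat monoid" and b where G: "comm_group G" "finite (carrier G)"
    "card (carrier G) = min_sidon_group_order h n" "sidon_set G h n b"
    using min_sidon_group_order_attained[OF assms] by blast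
  interpret comm_group G by (rule G)
  have "carrier G \<noteq> {}" by auto
  then show ?thesis using G by (metis card_gt_0_iff)
qed

lemma min_sidon_group_order_le_primepow:
  assumes "0 < n"
  shows "min_sidon_group_order h n \<le> next_primepow n ^ h"
proof -
  consider "h = 0" | "h = 1" | "2 \<le> h" by linarith
  then show ?thesis
  proof cases
    case 1
    have "min_sidon_group_order 0 n \<le> 1"
      using min_sidon_group_order_le[OF abelian_integer_mod_group _ sidon_set_order_0[of n]]
      by (simp add: carrier_integer_mod_group)
    then show ?thesis using 1 by simp
  next
    case 2
    have "min_sidon_group_order 1 n \<le> n"
      using min_sidon_group_order_le[OF abelian_integer_mod_group _ sidon_set_order_1[OF assms]] assms
      by (simp add: carrier_integer_mod_group)
    then show ?thesis using 2 next_primepow(1)[of n] by simp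
  next
    case 3
    then show ?thesis using min_sidon_group_order_less_primepow[OF 3, of n] by simp
  qed
qed

text \<open>The first \<open>n - 1\<close> multiplicities may be chosen freely up to
  \<open>h div n\<close>, and the last one absorbs the nonnegative remainder. The count is crude but
  has the right order of growth in \<open>h\<close>.\<close>

lemma card_ge_if_sidon_set:
  assumes G: "comm_group G" and fin: "finite (carrier G)" and S: "sidon_set G h n b" and n: "0 < n"
  shows "(h div n + 1) ^ (n - 1) \<le> card (carrier G)"
proof -
  interpret comm_group G by (rule G)
  let ?X = "{r. (\<forall>i\<ge>n. r i = 0) \<and> (\<Sum>i<n. r i) = h}"
  let ?E = "{..<n-1} \<rightarrow>\<^sub>E {..h div n}"
  let ?f = "\<lambda>e i. if i < n - 1 then e i else if i = n - 1 then h - (\<Sum>i<n-1. e i) else (0::nat)"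
  have nS: "{..<n} = insert (n - 1) {..<n - 1}" using n by auto
  have "?f e \<in> ?X" if e: "e \<in> ?E" for e
  proof -
    have "(\<Sum>i<n-1. e i) \<le> (\<Sum>i<n-1. h div n)" using e by (intro sum_mono) (auto dest: PiE_mem)
    also have "\<dots> \<le> n * (h div n)" by simp
    also have "\<dots> \<le> h" by simp
    finally have le: "(\<Sum>i<n-1. e i) \<le> h" .
    have "(\<Sum>i<n. ?f e i) = ?f e (n - 1) + (\<Sum>i<n-1. ?f e i)" unfolding nS by simp
    also have "(\<Sum>i<n-1. ?f e i) = (\<Sum>i<n-1. e i)" by (intro sum.cong) auto
    finally have "(\<Sum>i<n. ?f e i) = h" using le by simp
    then show ?thesis by auto
  qed
  moreover have "inj_on ?f ?E"
  proof (rule inj_onI)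
    fix e e' assume e: "e \<in> ?E" "e' \<in> ?E" and eq: "?f e = ?f e'"
    show "e = e'"
    proof (rule PiE_ext[OF e])
      fix i assume "i \<in> {..<n-1}"
      then show "e i = e' i" using fun_cong[OF eq, of i] by simp
    qed
  qed
  moreover have "inj_on (\<lambda>r. finprod G (\<lambda>i. b i [^]\<^bsub>G\<^esub> r i) {..<n}) ?X"
    and bc: "\<And>i. i < n \<Longrightarrow> b i \<in> carrier G"
    using S by (auto simp: sidon_set_def)
  ultimately have "inj_on ((\<lambda>r. finprod G (\<lambda>i. b i [^]\<^bsub>G\<^esub> r i) {..<n}) \<circ> ?f) ?E"
    by (intro comp_inj_on) (auto intro: inj_on_subset)
  then have "card ?E \<le> card (carrier G)"
    using bc fin by (intro card_inj_on_le) (auto intro!: finprod_closed)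
  then show ?thesis by (simp add: card_PiE)
qed

section \<open>Volumes of fundamental cells\<close>

text \<open>If \<open>L + Y\<close> covers \<open>U\<close> and the translates \<open>L + U\<close> are disjoint, then cutting \<open>U\<close> into countably
  many pieces and moving each of them into \<open>Y\<close> by an element of \<open>L\<close> loses no volume.\<close>

lemma measure_le_of_translates:
  fixes U Y L :: "'a::euclidean_space set"
  assumes L: "countable L" "\<And>l m. l \<in> L \<Longrightarrow> m \<in> L \<Longrightarrow> l - m \<in> L"
    and U: "U \<in> lmeasurable" and Y: "Y \<in> lmeasurable"
    and cover: "\<And>x. x \<in> U \<Longrightarrow> \<exists>l\<in>L. x - l \<in> Y"
    and inj: "\<And>x y. x \<in> U \<Longrightarrow> y \<in> U \<Longrightarrow> x - y \<in> L \<Longrightarrow> x = y"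
  shows "measure lebesgue U \<le> measure lebesgue Y"
proof (cases "L = {}")
  case True
  then have "U = {}" using cover by auto
  then show ?thesis by simp
next
  case False
  define e where "e = from_nat_into L"
  have eL: "e n \<in> L" for n using False by (simp add: e_def from_nat_into)
  have e_surj: "\<exists>n. e n = l" if "l \<in> L" for l
    using that L(1) unfolding e_def by (metis from_nat_into_surj)
  define A where "A n = U \<inter> (+) (e n) ` Y" for n
  define D where "D = disjointed A"
  have Am: "A n \<in> lmeasurable" for n
    unfolding A_def by (intro fmeasurable.Int U measurable_translation Y)
  have Dm: "D n \<in> lmeasurable" for n
    unfolding D_def disjointed_def using Am
    by (intro fmeasurable.Diff fmeasurable.finite_UN) auto
  have DA: "D n \<subseteq> A n" for n unfolding D_def by (rule disjointed_subset)
  have Ddisj: "disjoint_family D" unfolding D_def by (rule disjoint_family_disjointed)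
  have UA: "(\<Union>n. A n) = U"
  proof
    show "U \<subseteq> (\<Union>n. A n)"
    proof
      fix x assume x: "x \<in> U"
      then obtain l where l: "l \<in> L" "x - l \<in> Y" using cover by blast
      obtain n where n: "e n = l" using e_surj l(1) by blast
      have "x = e n + (x - l)" using n by simp
      then have "x \<in> A n" unfolding A_def using x l(2) by blast
      then show "x \<in> (\<Union>n. A n)" by blast
    qed
  qed (auto simp: A_def)
  have UD: "(\<Union>n. D n) = U" unfolding D_def UN_disjointed_eq by (rule UA)
  define T where "T n = (\<lambda>x. x - e n) ` D n" for n
  have Tm: "T n \<in> lmeasurable" for n unfolding T_def by (rule measurable_translation_subtract[OF Dm])
  have T_eq: "emeasure lebesgue (T n) = emeasure lebesgue (D n)" for n
    using measure_translation_subtract[of "e n" "D n"] Tm[of n] Dm[of n]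
    by (simp add: T_def emeasure_eq_measure2)
  have Tdisj: "disjoint_family T"
    unfolding disjoint_family_on_def
  proof (intro ballI impI)
    fix m n :: nat assume mn: "m \<noteq> n"
    show "T m \<inter> T n = {}"
    proof (rule ccontr)
      assume "T m \<inter> T n \<noteq> {}"
      then obtain x y where xy: "x \<in> D m" "y \<in> D n" "x - e m = y - e n" by (auto simp: T_def)
      then have "x - y = e m - e n" by (simp add: algebra_simps)
      then have "x - y \<in> L" using L(2)[OF eL eL] by simp
      moreover have "x \<in> U" "y \<in> U" using xy DA UA by blast+
      ultimately have "x = y" using inj by blast
      then show False using xy Ddisj mn by (auto simp: disjoint_family_on_def)
    qed
  qed
  have "x - e n \<in> Y" if "x \<in> D n" for x n
    using subsetD[OF DA that] by (auto simp: A_def)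
  then have TY: "(\<Union>n. T n) \<subseteq> Y" unfolding T_def by auto
  have "emeasure lebesgue U = (\<Sum>n. emeasure lebesgue (D n))"
    unfolding UD[symmetric] using Dm Ddisj by (intro suminf_emeasure[symmetric]) auto
  also have "\<dots> = (\<Sum>n. emeasure lebesgue (T n))" by (simp add: T_eq)
  also have "\<dots> = emeasure lebesgue (\<Union>n. T n)"
    using Tm Tdisj by (intro suminf_emeasure) auto
  also have "\<dots> \<le> emeasure lebesgue Y" using TY Y by (intro emeasure_mono) auto
  finally show ?thesis using U Y by (simp add: emeasure_eq_measure2)
qed

section \<open>Lattices with a basis as linear images of the integer vectors\<close>

definition comb :: "('n \<Rightarrow> real ^ 'n) \<Rightarrow> real ^ 'n \<Rightarrow> real ^ 'n" where
  "comb b x = (\<Sum>i\<in>UNIV. x $ i *\<^sub>R b i)"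

definition int_lattice :: "('n \<Rightarrow> real ^ 'n) \<Rightarrow> (real ^ 'n) set" where
  "int_lattice b = range (\<lambda>z :: 'n \<Rightarrow> int. \<Sum>i\<in>UNIV. of_int (z i) *\<^sub>R b i)"

definition unit_cube :: "(real ^ 'n) set" where
  "unit_cube = {x. \<forall>i. 0 \<le> x $ i \<and> x $ i < 1}"

lemma linear_comb: "linear (comb b)"
  unfolding comb_def
  by (intro linearI) (simp_all add: scaleR_add_left sum.distrib scaleR_sum_right)

lemma comb_axis [simp]: "comb b (axis i 1) = b i"
  by (simp add: comb_def axis_def if_distrib[of "\<lambda>c. c *\<^sub>R _"] cong: if_cong)

lemma comb_int: "(\<Sum>i\<in>UNIV. of_int (z i) *\<^sub>R b i) = comb b (\<chi> i. of_int (z i))"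
  by (simp add: comb_def)

lemma fundamental_cell_eq: "fundamental_cell b = comb b ` unit_cube"
proof
  show "fundamental_cell b \<subseteq> comb b ` unit_cube"
  proof
    fix x assume "x \<in> fundamental_cell b"
    then obtain c where c: "x = (\<Sum>i\<in>UNIV. c i *\<^sub>R b i)" "\<forall>i. 0 \<le> c i \<and> c i < 1"
      by (auto simp: fundamental_cell_def)
    then show "x \<in> comb b ` unit_cube"
      by (intro image_eqI[where x="\<chi> i. c i"]) (auto simp: comb_def unit_cube_def)
  qed
qed (auto simp: fundamental_cell_def comb_def unit_cube_def)

lemma comb_inverse:
  assumes "inj (comb b)"
  obtains g where "linear g" "\<And>x. g (comb b x) = x" "\<And>x. comb b (g x) = x"
proof -
  obtain g where g: "linear g" "g \<circ> comb b = id"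
    using linear_injective_left_inverse[OF linear_comb assms] by blast
  moreover have "comb b \<circ> g = id"
    using linear_inverse_left[OF linear_comb g(1)] g(2) by simp
  ultimately show thesis using that by (metis comp_apply id_apply)
qed

lemma fundamental_cell_measurable:
  assumes "inj (comb b)"
  shows "fundamental_cell b \<in> lmeasurable"
proof (rule bounded_set_imp_lmeasurable)
  have "(unit_cube :: (real ^ 'a) set) \<subseteq> cbox 0 1" by (auto simp: unit_cube_def mem_box_cart less_imp_le)
  then have "bounded (unit_cube :: (real ^ 'a) set)" using bounded_cbox bounded_subset by blast
  then show "bounded (fundamental_cell b)"
    unfolding fundamental_cell_eq using linear_comb
    by (intro bounded_linear_image) (auto simp: linear_conv_bounded_linear)
  obtain g where g: "linear g" "\<And>x. g (comb b x) = x" "\<And>x. comb b (g x) = x"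
    using comb_inverse[OF assms] by blast
  have cont: "continuous_on UNIV g" using g(1) by (simp add: linear_continuous_on linear_conv_bounded_linear)
  \<comment> \<open>In the coordinates \<open>g\<close> the half-open cell is a finite intersection
    of closed and open half-spaces, hence Borel.\<close>
  have eq: "fundamental_cell b = (\<Inter>i. {x. 0 \<le> g x $ i} \<inter> {x. g x $ i < 1})"
  proof
    show "fundamental_cell b \<subseteq> (\<Inter>i. {x. 0 \<le> g x $ i} \<inter> {x. g x $ i < 1})"
      unfolding fundamental_cell_eq by (auto simp: unit_cube_def g(2))
    show "(\<Inter>i. {x. 0 \<le> g x $ i} \<inter> {x. g x $ i < 1}) \<subseteq> fundamental_cell b"
    proof
      fix x assume "x \<in> (\<Inter>i. {x. 0 \<le> g x $ i} \<inter> {x. g x $ i < 1})"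
      then show "x \<in> fundamental_cell b"
        unfolding fundamental_cell_eq
        by (intro image_eqI[where x="g x"]) (auto simp: unit_cube_def g(3))
    qed
  qed
  have c: "continuous_on UNIV (\<lambda>x. g x $ i)" for i
    using cont by (intro continuous_intros)
  have "closed {x. 0 \<le> g x $ i}" "open {x. g x $ i < 1}" for i
    by (rule closed_Collect_le[OF continuous_on_const c], rule open_Collect_less[OF c continuous_on_const])
  then have "fundamental_cell b \<in> sets borel"
    unfolding eq by (intro sets.finite_INT sets.Int) auto
  then show "fundamental_cell b \<in> sets lebesgue" by simp
qed

text \<open>Being a basis becomes invertibility of one linear map, the form used from here on. As
  independence speaks of the set \<open>range b\<close>, repetitions have to be excluded by
  \<open>inj b\<close>.\<close>

lemma inj_comb_iff: "inj b \<and> independent (range b) \<longleftrightarrow> inj (comb b)"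
proof
    assume b: "inj b \<and> independent (range b)"
    have sub: "range b \<subseteq> range (comb b)" by (metis comb_axis image_subsetI rangeI)
    have "card (range b) = DIM(real ^ 'a)" using b by (simp add: card_image)
    then have "span (range b) = UNIV"
      using b independent_card_le card_ge_dim_independent[of "range b" UNIV] by auto
    moreover have "span (range b) \<subseteq> range (comb b)"
      using sub by (intro span_minimal) (auto intro: linear_subspace_image linear_comb)
    ultimately have "surj (comb b)" by blast
    then show "inj (comb b)" using linear_surjective_imp_injective linear_comb by blast
  next
    assume inj: "inj (comb b)"
    have "inj b"
    proof (rule injI)
      fix i j assume "b i = b j"
      then have "comb b (axis i 1) = comb b (axis j 1)" by simp
      then have "axis i (1::real) = axis j 1" using inj by (simp add: inj_def)
      then show "i = j" by (simp add: axis_eq_axis)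
    qed
    moreover have "range b = comb b ` Basis"
      unfolding Basis_vec_def by (auto simp: image_iff)
    then have "independent (range b)"
      using linear_independent_injective_image[OF linear_comb independent_Basis, of b] inj
      by (metis inj_on_subset subset_UNIV)
    ultimately show "inj b \<and> independent (range b)" by blast
qed

lemma lattice_basis_iff: "lattice_basis b L \<longleftrightarrow> inj (comb b) \<and> L = int_lattice b"
  unfolding lattice_basis_def int_lattice_def inj_comb_iff[symmetric] by blast

lemma int_lattice_countable: "countable (int_lattice (b :: 'n::finite \<Rightarrow> real ^ 'n))"
proof -
  have "int_lattice b \<subseteq> comb b ` ((\<lambda>z. \<chi> i. of_int (z i)) ` (\<Pi>\<^sub>E i\<in>UNIV. (UNIV :: int set)))"
    by (auto simp: int_lattice_def comb_int)
  moreover have "countable (\<Pi>\<^sub>E i\<in>(UNIV::'n set). (UNIV :: int set))"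
    by (intro countable_PiE) auto
  ultimately show ?thesis by (meson countable_image countable_subset)
qed

lemma int_lattice_diff: "x \<in> int_lattice b \<Longrightarrow> y \<in> int_lattice b \<Longrightarrow> x - y \<in> int_lattice b"
proof -
  assume "x \<in> int_lattice b" "y \<in> int_lattice b"
  then obtain z w where "x = (\<Sum>i\<in>UNIV. of_int (z i) *\<^sub>R b i)" "y = (\<Sum>i\<in>UNIV. of_int (w i) *\<^sub>R b i)"
    by (auto simp: int_lattice_def)
  then have "x - y = (\<Sum>i\<in>UNIV. of_int (z i - w i) *\<^sub>R b i)"
    by (simp add: scaleR_left_diff_distrib sum_subtractf)
  then show ?thesis unfolding int_lattice_def by (intro image_eqI[where x="\<lambda>i. z i - w i"]) auto
qed

lemma int_lattice_zero: "0 \<in> int_lattice b"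
  unfolding int_lattice_def by (intro image_eqI[where x="\<lambda>_. 0"]) auto

lemma fundamental_cell_cover:
  assumes "inj (comb b)"
  shows "\<exists>l\<in>int_lattice b. x - l \<in> fundamental_cell b"
proof -
  have "surj (comb b)" using assms linear_injective_imp_surjective linear_comb by blast
  then obtain y where y: "x = comb b y" by (metis surjD)
  let ?l = "comb b (\<chi> i. of_int \<lfloor>y $ i\<rfloor>)"
  have "x - ?l = comb b (\<chi> i. frac (y $ i))"
    unfolding y linear_diff[OF linear_comb, symmetric]
    by (rule arg_cong[where f="comb b"]) (simp add: vec_eq_iff frac_def)
  then have "x - ?l \<in> fundamental_cell b"
    unfolding fundamental_cell_eq by (auto simp: unit_cube_def frac_lt_1)
  moreover have "?l \<in> int_lattice b" by (auto simp: int_lattice_def comb_int)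
  ultimately show ?thesis by blast
qed

lemma fundamental_cell_inj:
  assumes inj: "inj (comb b)" and x: "x \<in> fundamental_cell b" and y: "y \<in> fundamental_cell b"
    and d: "x - y \<in> int_lattice b"
  shows "x = y"
proof -
  obtain u v where uv: "x = comb b u" "y = comb b v" "u \<in> unit_cube" "v \<in> unit_cube"
    using x y by (auto simp: fundamental_cell_eq)
  obtain z :: "_ \<Rightarrow> int" where z: "x - y = comb b (\<chi> i. of_int (z i))"
    using d by (auto simp: int_lattice_def comb_int)
  have "comb b (u - v) = comb b (\<chi> i. of_int (z i))"
    using z uv by (simp add: linear_diff[OF linear_comb])
  then have eq: "u - v = (\<chi> i. of_int (z i))" using inj by (simp add: inj_def)
  have "u $ i = v $ i" for i
  proof -
    have "u $ i - v $ i = of_int (z i)" using eq by (metis vec_lambda_beta vector_minus_component)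
    moreover have "\<bar>u $ i - v $ i\<bar> < 1"
      using uv by (auto simp: unit_cube_def abs_less_iff) (smt (verit))+
    ultimately have "z i = 0" by linarith
    then show ?thesis using \<open>u $ i - v $ i = of_int (z i)\<close> by simp
  qed
  then have "u = v" by (simp add: vec_eq_iff)
  then show ?thesis using uv by simp
qed

text \<open>A cell both covers and packs. It is therefore compared with packing sets here and with
  covering sets in the next lemma; the later bounds on determinants all come from such
  comparisons.\<close>

lemma measure_packing_le_cell:
  assumes inj: "inj (comb b)" and U: "U \<in> lmeasurable"
    and disj: "\<And>x y. x \<in> U \<Longrightarrow> y \<in> U \<Longrightarrow> x - y \<in> int_lattice b \<Longrightarrow> x = y"
  shows "measure lebesgue U \<le> measure lebesgue (fundamental_cell b)"
  by (rule measure_le_of_translates[OF int_lattice_countable int_lattice_diff U fundamental_cell_measurable[OF inj]])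
    (use fundamental_cell_cover[OF inj] disj in auto)

lemma cell_le_measure_covering:
  assumes inj: "inj (comb b)" and Y: "Y \<in> lmeasurable"
    and cover: "\<And>x. \<exists>l\<in>int_lattice b. x - l \<in> Y"
  shows "measure lebesgue (fundamental_cell b) \<le> measure lebesgue Y"
  by (rule measure_le_of_translates[OF int_lattice_countable int_lattice_diff fundamental_cell_measurable[OF inj] Y])
    (use cover fundamental_cell_inj[OF inj] in auto)

text \<open>For two bases of a lattice each cell covers and the other packs, so the volumes bound
  each other and the description in \<open>lattice_det\<close> is unique.\<close>

lemma lattice_det_eq:
  assumes b: "lattice_basis b L"
  shows "lattice_det L = measure lebesgue (fundamental_cell b)"
proof -
  have le: "measure lebesgue (fundamental_cell c) \<le> measure lebesgue (fundamental_cell b)"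
    if "lattice_basis b L" "lattice_basis c L" for b c
  proof (rule cell_le_measure_covering)
    show "inj (comb c)" using that by (simp add: lattice_basis_iff)
    show "fundamental_cell b \<in> lmeasurable"
      using that by (intro fundamental_cell_measurable) (simp add: lattice_basis_iff)
    have "int_lattice c = int_lattice b" "inj (comb b)" using that by (auto simp: lattice_basis_iff)
    then show "\<exists>l\<in>int_lattice c. x - l \<in> fundamental_cell b" for x
      using fundamental_cell_cover by metis
  qed
  show ?thesis
    unfolding lattice_det_def using b le by (intro the_equality) (auto intro: antisym)
qed

section \<open>The l1 norm and separated lattices\<close>

lemma l1_norm_add: "l1_norm (x + y) \<le> l1_norm x + l1_norm y"
  unfolding l1_norm_def sum.distrib[symmetric] by (intro sum_mono) auto

lemma l1_norm_scaleR: "l1_norm (c *\<^sub>R x) = \<bar>c\<bar> * l1_norm x"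
  by (simp add: l1_norm_def abs_mult sum_distrib_left)

lemma l1_norm_nonneg [simp]: "0 \<le> l1_norm x"
  by (simp add: l1_norm_def sum_nonneg)

lemma l1_norm_zero [simp]: "l1_norm 0 = 0"
  by (simp add: l1_norm_def)

lemma l1_norm_sum: "finite A \<Longrightarrow> l1_norm (\<Sum>i\<in>A. f i) \<le> (\<Sum>i\<in>A. l1_norm (f i))"
proof (induction A rule: finite_induct)
  case (insert i A)
  then show ?case using l1_norm_add[of "f i" "\<Sum>i\<in>A. f i"] by simp
qed simp

lemma norm_le_l1: "norm x \<le> l1_norm x"
  unfolding l1_norm_def by (rule norm_le_l1_cart)

lemma l1_norm_le_norm: "l1_norm (x :: real ^ 'n) \<le> real CARD('n) * norm x"
proof -
  have "l1_norm x \<le> (\<Sum>i\<in>(UNIV::'n set). norm x)"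
    unfolding l1_norm_def by (intro sum_mono component_le_norm_cart)
  then show ?thesis by simp
qed

text \<open>Lattices are scaled to packing radius 1 from here on, hence the 2; the division by the
  dimension comes from comparing the norms.\<close>

lemma uniform_discrete_if_l1_separated:
  fixes L :: "(real ^ 'n) set"
  assumes diff: "\<And>x y. x \<in> L \<Longrightarrow> y \<in> L \<Longrightarrow> x - y \<in> L"
    and sep: "\<And>x. x \<in> L \<Longrightarrow> x \<noteq> 0 \<Longrightarrow> 2 \<le> l1_norm x"
  shows "uniform_discrete L"
proof (rule uniformI2)
  show "0 < 2 / real CARD('n)" by simp
  fix x y assume xy: "x \<in> L" "y \<in> L" "x \<noteq> y"
  have "2 \<le> l1_norm (x - y)" using sep[OF diff[OF xy(1,2)]] xy by simp
  also have "\<dots> \<le> real CARD('n) * dist x y" by (simp add: l1_norm_le_norm dist_norm)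
  finally show "2 / real CARD('n) \<le> dist x y" by (simp add: field_simps)
qed

lemma finite_l1_bounded_if_l1_separated:
  assumes "\<And>x y. x \<in> L \<Longrightarrow> y \<in> L \<Longrightarrow> x - y \<in> L"
    and "\<And>x. x \<in> L \<Longrightarrow> x \<noteq> 0 \<Longrightarrow> 2 \<le> l1_norm x"
  shows "finite {x \<in> L. l1_norm x \<le> R}"
proof -
  have "uniform_discrete {x \<in> L. l1_norm x \<le> R}"
    using uniform_discrete_if_l1_separated[OF assms] by (rule uniform_discrete_subset) auto
  moreover have "bounded {x \<in> L. l1_norm x \<le> R}"
    unfolding bounded_iff using norm_le_l1 by (intro exI[of _ R]) (auto intro: order_trans)
  ultimately show ?thesis using uniform_discrete_finite_iff by blast
qed

section \<open>Reduced lattice bases\<close>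

lemma l1_norm_comb_le:
  assumes "\<And>i. \<bar>x $ i\<bar> \<le> 1"
  shows "l1_norm (comb v x) \<le> (\<Sum>j\<in>UNIV. l1_norm (v j))"
proof -
  have "l1_norm (comb v x) \<le> (\<Sum>j\<in>UNIV. l1_norm (x $ j *\<^sub>R v j))"
    unfolding comb_def by (rule l1_norm_sum) simp
  also have "\<dots> \<le> (\<Sum>j\<in>UNIV. l1_norm (v j))"
    unfolding l1_norm_scaleR using assms by (intro sum_mono) (simp add: mult_left_le_one_le)
  finally show ?thesis .
qed

text \<open>Coordinates with respect to \<open>v\<close> are treated one at a time. Among the
  lattice points in a box, one with least positive \<open>j\<close>-th coordinate generates all
  \<open>j\<close>-th coordinates that occur. The box makes the candidates finite in number and
  bounds the norm of the basis vectors.\<close>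

lemma lattice_basis_of_independent:
  fixes L :: "(real ^ 'n) set" and v :: "'n \<Rightarrow> real ^ 'n"
  assumes L0: "0 \<in> L" and diff: "\<And>x y. x \<in> L \<Longrightarrow> y \<in> L \<Longrightarrow> x - y \<in> L"
    and fin: "\<And>R. finite {x \<in> L. l1_norm x \<le> R}"
    and v: "\<And>i. v i \<in> L" "inj (comb v)"
  obtains b where "lattice_basis b L" "\<And>i. l1_norm (b i) \<le> (\<Sum>j\<in>UNIV. l1_norm (v j))"
proof -
  define M where "M = (\<Sum>j\<in>UNIV. l1_norm (v j))"
  obtain g where g: "linear g" "\<And>x. g (comb v x) = x" "\<And>x. comb v (g x) = x"
    using comb_inverse[OF v(2)] by blast
  have neg: "- x \<in> L" if "x \<in> L" for x using diff[OF L0 that] by simp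
  have add: "x + y \<in> L" if "x \<in> L" "y \<in> L" for x y using diff[OF that(1) neg[OF that(2)]] by simp
  have nmul: "real k *\<^sub>R x \<in> L" if "x \<in> L" for k x
    by (induction k) (use L0 that add in \<open>auto simp: scaleR_add_left\<close>)
  have imul: "of_int k *\<^sub>R x \<in> L" if "x \<in> L" for k x
  proof (cases "0 \<le> k")
    case True
    then show ?thesis using nmul[OF that, of "nat k"] by simp
  next
    case False
    then show ?thesis using neg[OF nmul[OF that, of "nat (- k)"]] by simp
  qed
  have sumL: "(\<Sum>i\<in>A. of_int (z i) *\<^sub>R f i) \<in> L" if "finite A" "\<And>i. i \<in> A \<Longrightarrow> f i \<in> L"
    for A and z :: "'n \<Rightarrow> int" and f
    using that by (induction A rule: finite_induct) (use L0 add imul in auto)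
  \<comment> \<open>Invariant: the vectors chosen for \<open>I\<close> generate all lattice points
    whose \<open>g\<close>-coordinates vanish outside \<open>I\<close>.\<close>
  have "\<exists>b. (\<forall>i\<in>I. b i \<in> L \<and> l1_norm (b i) \<le> M) \<and>
      (\<forall>x\<in>L. (\<forall>i. i \<notin> I \<longrightarrow> g x $ i = 0) \<longrightarrow> (\<exists>z::'n \<Rightarrow> int. x = (\<Sum>i\<in>I. of_int (z i) *\<^sub>R b i)))"
    if "finite I" for I :: "'n set"
    using that
  proof (induction I rule: finite_induct)
    case empty
    have "x = 0" if "\<forall>i. g x $ i = 0" for x
    proof -
      have "g x = 0" using that by (simp add: vec_eq_iff)
      then have "comb v (g x) = 0" using linear_0[OF linear_comb] by simp
      then show ?thesis by (simp add: g(3))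
    qed
    then show ?case by auto
  next
    case (insert j I)
    obtain b where b: "\<And>i. i \<in> I \<Longrightarrow> b i \<in> L" "\<And>i. i \<in> I \<Longrightarrow> l1_norm (b i) \<le> M"
      "\<And>x. x \<in> L \<Longrightarrow> (\<And>i. i \<notin> I \<Longrightarrow> g x $ i = 0) \<Longrightarrow> \<exists>z::'n \<Rightarrow> int. x = (\<Sum>i\<in>I. of_int (z i) *\<^sub>R b i)"
      using insert.IH by blast
    \<comment> \<open>Coordinates in \<open>I\<close> can be reduced to [0, 1) by subtracting
      multiples of the \<open>v i\<close>. The value 1 is allowed in coordinate \<open>j\<close> so
      that \<open>v j\<close> itself is a candidate.\<close>
    define S where "S = {x \<in> L. (\<forall>i. i \<notin> insert j I \<longrightarrow> g x $ i = 0) \<and>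
      (\<forall>i\<in>I. 0 \<le> g x $ i \<and> g x $ i < 1) \<and> 0 < g x $ j \<and> g x $ j \<le> 1}"
    have SM: "l1_norm x \<le> M" if "x \<in> S" for x
    proof -
      have "\<bar>g x $ i\<bar> \<le> 1" for i
        using that unfolding S_def by (cases "i \<in> I"; cases "i = j") auto
      then show ?thesis using l1_norm_comb_le[of "g x" v] unfolding g(3) M_def by blast
    qed
    then have "S \<subseteq> {x \<in> L. l1_norm x \<le> M}" by (auto simp: S_def)
    then have finS: "finite S" using fin finite_subset by blast
    have gv: "g (v i) = axis i 1" for i using g(2)[of "axis i 1"] by simp
    have "v j \<in> S" using v(1) insert.hyps by (auto simp: S_def gv axis_def)
    then have "S \<noteq> {}" by blast
    then obtain x0 where x0: "x0 \<in> S" "\<And>x. x \<in> S \<Longrightarrow> g x0 $ j \<le> g x $ j"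
      using ex_is_arg_min_if_finite[OF finS, of "\<lambda>x. g x $ j"]
      by (auto simp: is_arg_min_linorder)
    have x0L: "x0 \<in> L" and x0j: "0 < g x0 $ j" using x0(1) by (auto simp: S_def)
    let ?b = "b(j := x0)"
    have "\<exists>z::'n \<Rightarrow> int. x = (\<Sum>i\<in>insert j I. of_int (z i) *\<^sub>R ?b i)"
      if x: "x \<in> L" "\<And>i. i \<notin> insert j I \<Longrightarrow> g x $ i = 0" for x
    proof -
      define q where "q = \<lfloor>g x $ j / g x0 $ j\<rfloor>"
      define y where "y = x - of_int q *\<^sub>R x0"
      have yL: "y \<in> L" unfolding y_def by (intro diff x imul x0L)
      have gy: "g y $ i = g x $ i - of_int q * g x0 $ i" for i
        by (simp add: y_def linear_diff[OF g(1)] linear_scale[OF g(1)])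
      have qb: "of_int q * g x0 $ j \<le> g x $ j" "g x $ j < (of_int q + 1) * g x0 $ j"
        using x0j floor_divide_lower[OF x0j, of "g x $ j"] floor_divide_upper[OF x0j, of "g x $ j"]
        unfolding q_def by auto
      have yj: "0 \<le> g y $ j" "g y $ j < g x0 $ j" using qb by (auto simp: gy algebra_simps)
      \<comment> \<open>Moves \<open>y\<close> into the box without changing coordinate
        \<open>j\<close>. If that coordinate were not zero, \<open>w\<close> would be a candidate
        that beats \<open>x0\<close>.\<close>
      define w where "w = y - (\<Sum>i\<in>I. of_int \<lfloor>g y $ i\<rfloor> *\<^sub>R v i)"
      have wL: "w \<in> L" unfolding w_def using v(1) insert.hyps by (intro diff yL sumL)
      have gw: "g w $ i = g y $ i - (if i \<in> I then of_int \<lfloor>g y $ i\<rfloor> else 0)" for i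
      proof -
        have "g (\<Sum>i\<in>I. of_int \<lfloor>g y $ i\<rfloor> *\<^sub>R v i) $ i = (\<Sum>k\<in>I. of_int \<lfloor>g y $ k\<rfloor> * (axis k 1 $ i))"
          by (simp add: linear_sum[OF g(1)] linear_scale[OF g(1)] gv)
        also have "\<dots> = (\<Sum>k\<in>I. if k = i then of_int \<lfloor>g y $ i\<rfloor> else 0)"
          by (intro sum.cong) (auto simp: axis_def)
        also have "\<dots> = (if i \<in> I then of_int \<lfloor>g y $ i\<rfloor> else 0)"
          using insert.hyps by simp
        finally show ?thesis by (simp add: w_def linear_diff[OF g(1)])
      qed
      have x00: "g x0 $ i = 0" if "i \<notin> insert j I" for i using x0(1) that by (auto simp: S_def)
      have "g x0 $ j \<le> 1" using x0(1) by (simp add: S_def)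
      have "g y $ j = 0"
      proof (rule ccontr)
        assume "g y $ j \<noteq> 0"
        have wj: "g w $ j = g y $ j" using insert.hyps by (simp add: gw)
        have "g w $ i = 0" if "i \<notin> insert j I" for i
          using that x(2)[OF that] x00[OF that] by (simp add: gw gy)
        moreover have "0 \<le> g w $ i \<and> g w $ i < 1" if "i \<in> I" for i
          using that unfolding gw by simp linarith
        moreover have "0 < g w $ j" "g w $ j \<le> 1"
          using yj \<open>g y $ j \<noteq> 0\<close> \<open>g x0 $ j \<le> 1\<close> unfolding wj by linarith+
        ultimately have "w \<in> S" using wL by (simp add: S_def)
        then have "g x0 $ j \<le> g w $ j" by (rule x0(2))
        then show False using yj insert.hyps by (simp add: gw)
      qed
      then have "g y $ i = 0" if "i \<notin> I" for i
        using that x(2)[of i] x00[of i] by (cases "i = j") (auto simp: gy)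
      then obtain z :: "'n \<Rightarrow> int" where z: "y = (\<Sum>i\<in>I. of_int (z i) *\<^sub>R b i)"
        using b(3)[OF yL] by blast
      have "(\<Sum>i\<in>insert j I. of_int ((z(j := q)) i) *\<^sub>R ?b i) =
          of_int q *\<^sub>R x0 + (\<Sum>i\<in>I. of_int ((z(j := q)) i) *\<^sub>R ?b i)"
        using insert.hyps by simp
      also have "(\<Sum>i\<in>I. of_int ((z(j := q)) i) *\<^sub>R ?b i) = (\<Sum>i\<in>I. of_int (z i) *\<^sub>R b i)"
        using insert.hyps by (intro sum.cong) auto
      also have "(\<Sum>i\<in>I. of_int (z i) *\<^sub>R b i) = y" using z by simp
      also have "of_int q *\<^sub>R x0 + y = x" by (simp add: y_def)
      finally show ?thesis by metis
    qed
    moreover have "\<forall>i\<in>insert j I. ?b i \<in> L \<and> l1_norm (?b i) \<le> M"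
      using b x0L SM[OF x0(1)] by auto
    ultimately show ?case by blast
  qed
  from this[OF finite_class.finite_UNIV] obtain b where b: "\<And>i. b i \<in> L" "\<And>i. l1_norm (b i) \<le> M"
    "\<And>x. x \<in> L \<Longrightarrow> \<exists>z::'n \<Rightarrow> int. x = (\<Sum>i\<in>UNIV. of_int (z i) *\<^sub>R b i)"
    by auto
  have L: "L = int_lattice b"
    unfolding int_lattice_def using b(1,3) sumL[OF finite_class.finite_UNIV, of b] by blast
  have "v i \<in> range (comb b)" for i
  proof -
    obtain z :: "'n \<Rightarrow> int" where "v i = (\<Sum>i\<in>UNIV. of_int (z i) *\<^sub>R b i)" using b(3)[OF v(1)] by blast
    then show ?thesis unfolding comb_int by blast
  qed
  moreover have "subspace (range (comb b))"
    by (intro linear_subspace_image linear_comb) simp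
  ultimately have "comb v x \<in> range (comb b)" for x
    unfolding comb_def[of v] by (intro subspace_sum subspace_scale) auto
  then have "surj (comb b)" using g(3) by (metis UNIV_eq_I)
  then have "inj (comb b)" using linear_surjective_imp_injective linear_comb by blast
  then have "lattice_basis b L" using L by (simp add: lattice_basis_iff)
  then show thesis using b(2) that unfolding M_def by blast
qed

text \<open>Suppose that the short vectors of the lattice lie in a hyperplane with normal vector \<open>u\<close>, and
  let \<open>u\<^sub>j\<close> be the largest component of \<open>u\<close>. A box that is long in the direction \<open>j\<close> and has width \<open>1 / n\<close>
  in all other directions then packs, so that its volume bounds the length of the box.\<close>

lemma short_independent_vectors:
  fixes b :: "'n::finite \<Rightarrow> real ^ 'n"
  defines "n \<equiv> CARD('n)"
  assumes inj: "inj (comb b)" and sep: "\<And>x. x \<in> int_lattice b \<Longrightarrow> x \<noteq> 0 \<Longrightarrow> 2 \<le> l1_norm x"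
    and D: "measure lebesgue (fundamental_cell b) \<le> D"
  obtains v :: "'n \<Rightarrow> real ^ 'n" where "\<And>i. v i \<in> int_lattice b" "inj (comb v)"
    "\<And>i. l1_norm (v i) \<le> (D + 1) * real n ^ (n - 1) + 1"
proof -
  \<comment> \<open>With one side \<open>S\<close> and \<open>n - 1\<close> sides
    \<open>1 / n\<close>, the box has volume \<open>D + 1\<close>, more than the cell.\<close>
  define S where "S = (D + 1) * real n ^ (n - 1)"
  have n0: "0 < n" by (simp add: n_def)
  have D0: "0 \<le> D" using D measure_nonneg order_trans by blast
  have S0: "0 < S" using D0 n0 by (simp add: S_def)
  define T where "T = {x \<in> int_lattice b. l1_norm x \<le> S + 1}"
  have "span T = UNIV"
  proof (rule ccontr)
    assume "span T \<noteq> UNIV"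
    then have "dim T < DIM(real ^ 'n)"
      using dim_eq_full[of T] dim_subset_UNIV[of T] by linarith
    then obtain u where u: "u \<noteq> 0" "\<And>y. y \<in> span T \<Longrightarrow> orthogonal u y"
      using orthogonal_to_subspace_exists by blast
    have "Max (range (\<lambda>i. \<bar>u $ i\<bar>)) \<in> range (\<lambda>i. \<bar>u $ i\<bar>)" by (intro Max_in) auto
    then obtain j where "\<bar>u $ j\<bar> = Max (range (\<lambda>i. \<bar>u $ i\<bar>))" by (metis imageE)
    then have j: "\<bar>u $ i\<bar> \<le> \<bar>u $ j\<bar>" for i by (simp add: Max_ge)
    have uj: "0 < \<bar>u $ j\<bar>"
    proof (rule ccontr)
      assume "\<not> 0 < \<bar>u $ j\<bar>"
      then have "u $ i = 0" for i using j[of i] by simp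
      then show False using u(1) by (simp add: vec_eq_iff)
    qed
    define c :: "real ^ 'n" where "c = (\<chi> i. if i = j then S else 1 / real n)"
    let ?X = "cbox 0 c"
    have c0: "0 \<le> c $ i" for i using S0 by (simp add: c_def)
    have cardj: "card (UNIV - {j}) = n - 1" by (simp add: n_def card_Diff_singleton)
    have "measure lebesgue ?X = (\<Prod>i\<in>UNIV. c $ i)"
    proof -
      have "0 \<in> ?X" using c0 by (simp add: mem_box_cart)
      then have "?X \<noteq> {}" by blast
      then show ?thesis by (simp add: content_cbox_cart)
    qed
    also have "\<dots> = c $ j * (\<Prod>i\<in>UNIV - {j}. c $ i)" by (rule prod.remove) auto
    also have "(\<Prod>i\<in>UNIV - {j}. c $ i) = (\<Prod>i\<in>UNIV - {j}. 1 / real n)"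
      by (intro prod.cong) (auto simp: c_def)
    also have "c $ j * \<dots> = D + 1"
      using n0 cardj by (simp add: c_def S_def power_divide)
    finally have "measure lebesgue ?X = D + 1" .
    moreover have "measure lebesgue ?X \<le> measure lebesgue (fundamental_cell b)"
    proof (rule measure_packing_le_cell[OF inj])
      fix x y assume x: "x \<in> ?X" and y: "y \<in> ?X" and d: "x - y \<in> int_lattice b"
      let ?d = "x - y"
      have di: "\<bar>?d $ i\<bar> \<le> c $ i" for i
      proof -
        have "0 \<le> x $ i" "x $ i \<le> c $ i" "0 \<le> y $ i" "y $ i \<le> c $ i"
          using x y by (auto simp: mem_box_cart)
        then show ?thesis by simp
      qed
      have rest: "(\<Sum>i\<in>UNIV - {j}. \<bar>?d $ i\<bar>) \<le> 1 - 1 / real n"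
      proof -
        have "(\<Sum>i\<in>UNIV - {j}. \<bar>?d $ i\<bar>) \<le> (\<Sum>i\<in>UNIV - {j}. 1 / real n)"
        proof (rule sum_mono)
          fix i assume "i \<in> UNIV - {j}"
          then show "\<bar>?d $ i\<bar> \<le> 1 / real n" using di[of i] by (simp add: c_def)
        qed
        also have "\<dots> = 1 - 1 / real n" using n0 cardj by (simp add: field_simps of_nat_diff)
        finally show ?thesis .
      qed
      have n1: "0 < 1 / real n" using n0 by simp
      have l1: "l1_norm ?d = \<bar>?d $ j\<bar> + (\<Sum>i\<in>UNIV - {j}. \<bar>?d $ i\<bar>)"
        unfolding l1_norm_def by (rule sum.remove) auto
      have "\<bar>?d $ j\<bar> \<le> S" using di[of j] by (simp add: c_def)
      then have "l1_norm ?d \<le> S + 1" using rest l1 n1 by linarith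
      then have "?d \<in> T" using d by (simp add: T_def)
      then have "u \<bullet> ?d = 0" using u(2) by (simp add: orthogonal_def span_base)
      \<comment> \<open>By orthogonality and the maximality of the component \<open>u $ j\<close>,
        the long component of \<open>?d\<close> is at most the sum of the others. That sum is at
        most \<open>1 - 1 / n\<close>, so the l1 norm stays below 2.\<close>
      then have "u $ j * ?d $ j + (\<Sum>i\<in>UNIV - {j}. u $ i * ?d $ i) = 0"
        unfolding inner_vec_def by (subst (asm) sum.remove[of _ j]) auto
      then have "\<bar>u $ j\<bar> * \<bar>?d $ j\<bar> = \<bar>\<Sum>i\<in>UNIV - {j}. u $ i * ?d $ i\<bar>"
        unfolding abs_mult[symmetric] by linarith
      also have "\<dots> \<le> (\<Sum>i\<in>UNIV - {j}. \<bar>u $ i * ?d $ i\<bar>)" by (rule sum_abs)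
      also have "\<dots> \<le> (\<Sum>i\<in>UNIV - {j}. \<bar>u $ j\<bar> * \<bar>?d $ i\<bar>)"
        unfolding abs_mult using j by (intro sum_mono mult_right_mono) auto
      also have "\<dots> = \<bar>u $ j\<bar> * (\<Sum>i\<in>UNIV - {j}. \<bar>?d $ i\<bar>)" by (simp add: sum_distrib_left)
      finally have "\<bar>?d $ j\<bar> \<le> (\<Sum>i\<in>UNIV - {j}. \<bar>?d $ i\<bar>)" using uj by simp
      then have "l1_norm ?d < 2" using rest l1 n1 by linarith
      then show "x = y" using sep[OF d] by fastforce
    qed simp
    ultimately show False using D by simp
  qed
  obtain B where B: "B \<subseteq> T" "independent B" "T \<subseteq> span B"
    using maximal_independent_subset by blast
  have "span B = UNIV" using B(3) \<open>span T = UNIV\<close> span_mono[OF B(3)] by (simp add: span_span top.extremum_uniqueI)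
  then have "card B = CARD('n)" using B(2) dim_span_eq_card_independent[OF B(2)] by simp
  moreover have "finite B" using B(2) independent_bound by blast
  ultimately obtain v :: "'n \<Rightarrow> real ^ 'n" where v: "bij_betw v UNIV B"
    using finite_same_card_bij[of "UNIV :: 'n set" B] by auto
  have "inj v" "range v = B" using v by (auto simp: bij_betw_def)
  then have "inj (comb v)" using B(2) inj_comb_iff by blast
  moreover have "v i \<in> T" for i using v B(1) by (auto simp: bij_betw_def)
  ultimately show thesis using that unfolding T_def S_def by blast
qed

text \<open>The bound depends only on the dimension and on \<open>D\<close>, so it is uniform along
  a sequence of lattices with bounded determinants.\<close>

lemma reduced_basis:
  fixes b :: "'n::finite \<Rightarrow> real ^ 'n"
  defines "n \<equiv> CARD('n)"
  assumes inj: "inj (comb b)" and sep: "\<And>x. x \<in> int_lattice b \<Longrightarrow> x \<noteq> 0 \<Longrightarrow> 2 \<le> l1_norm x"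
    and D: "measure lebesgue (fundamental_cell b) \<le> D"
  obtains c where "inj (comb c)" "int_lattice c = int_lattice b"
    "measure lebesgue (fundamental_cell c) = measure lebesgue (fundamental_cell b)"
    "\<And>i. l1_norm (c i) \<le> real n * ((D + 1) * real n ^ (n - 1) + 1)"
proof -
  obtain v where v: "\<And>i. v i \<in> int_lattice b" "inj (comb v)"
    "\<And>i. l1_norm (v i) \<le> (D + 1) * real n ^ (n - 1) + 1"
    using short_independent_vectors[OF inj sep D] unfolding n_def by blast
  obtain c where c: "lattice_basis c (int_lattice b)" "\<And>i. l1_norm (c i) \<le> (\<Sum>j\<in>UNIV. l1_norm (v j))"
    using lattice_basis_of_independent[OF int_lattice_zero int_lattice_diff
        finite_l1_bounded_if_l1_separated[OF int_lattice_diff sep] v(1,2)] by blast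
  have "l1_norm (c i) \<le> real n * ((D + 1) * real n ^ (n - 1) + 1)" for i
  proof -
    have "(\<Sum>j\<in>UNIV. l1_norm (v j)) \<le> (\<Sum>j\<in>(UNIV :: 'n set). (D + 1) * real n ^ (n - 1) + 1)"
      by (intro sum_mono v(3))
    then show ?thesis using c(2)[of i] by (simp add: n_def)
  qed
  moreover have "measure lebesgue (fundamental_cell c) = measure lebesgue (fundamental_cell b)"
    using lattice_det_eq[OF c(1)] lattice_det_eq[of b "int_lattice b"] inj by (simp add: lattice_basis_iff)
  ultimately show thesis using c(1) that by (auto simp: lattice_basis_iff)
qed

section \<open>Limits of lattices\<close>

lemma tendsto_comb:
  assumes "\<And>i. (\<lambda>k. c k i) \<longlonglongrightarrow> b i"
  shows "(\<lambda>k. comb (c k) x) \<longlonglongrightarrow> comb b x"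
  unfolding comb_def by (intro tendsto_intros assms)

lemma tendsto_l1_norm:
  assumes "(f \<longlongrightarrow> x) F"
  shows "((\<lambda>k. l1_norm (f k)) \<longlongrightarrow> l1_norm x) F"
  unfolding l1_norm_def by (intro tendsto_intros assms)

text \<open>The hypothesis ranges over coefficient vectors and not over lattice points, because for
  a limit of bases it must still be shown that nonzero coefficients give nonzero points.\<close>

lemma int_lattice_separated:
  fixes b :: "'n::finite \<Rightarrow> real ^ 'n"
  assumes sep: "\<And>z :: 'n \<Rightarrow> int. z \<noteq> (\<lambda>_. 0) \<Longrightarrow> 2 \<le> l1_norm (comb b (\<chi> i. of_int (z i)))"
    and x: "x \<in> int_lattice b" "x \<noteq> 0"
  shows "2 \<le> l1_norm x"
proof -
  obtain z :: "'n \<Rightarrow> int" where z: "x = comb b (\<chi> i. of_int (z i))"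
    using x(1) by (auto simp: int_lattice_def comb_int)
  moreover have "z \<noteq> (\<lambda>_. 0)"
  proof
    assume "z = (\<lambda>_. 0)"
    then have "x = comb b 0" using z by (simp add: zero_vec_def)
    then show False using x(2) by (simp add: linear_0[OF linear_comb])
  qed
  ultimately show ?thesis using sep by simp
qed

text \<open>If \<open>comb b w = 0\<close>, then rounding the multiples of \<open>w\<close> gives infinitely many integer vectors
  with bounded images, while images of distinct integer vectors have distance at least \<open>2\<close>.\<close>

lemma inj_comb_if_separated:
  fixes b :: "'n::finite \<Rightarrow> real ^ 'n"
  assumes sep: "\<And>z :: 'n \<Rightarrow> int. z \<noteq> (\<lambda>_. 0) \<Longrightarrow> 2 \<le> l1_norm (comb b (\<chi> i. of_int (z i)))"
  shows "inj (comb b)"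
proof (rule ccontr)
  assume "\<not> inj (comb b)"
  then obtain w where w: "comb b w = 0" "w \<noteq> 0"
    using linear_injective_0[OF linear_comb, of b] by blast
  obtain j where j: "w $ j \<noteq> 0" using w(2) by (auto simp: vec_eq_iff)
  define M where "M = (\<Sum>i\<in>UNIV. l1_norm (b i))"
  define z where "z m i = \<lfloor>real m * w $ i\<rfloor>" for m :: nat and i
  let ?p = "\<lambda>z :: 'n \<Rightarrow> int. comb b (\<chi> i. of_int (z i))"
  have inj: "inj ?p"
  proof (rule injI)
    fix z w :: "'n \<Rightarrow> int" assume eq: "?p z = ?p w"
    have "?p (\<lambda>i. z i - w i) = ?p z - ?p w"
      unfolding linear_diff[OF linear_comb, symmetric]
      by (rule arg_cong[where f="comb b"]) (simp add: vec_eq_iff)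
    then have "l1_norm (?p (\<lambda>i. z i - w i)) = 0" using eq by simp
    then have "(\<lambda>i. z i - w i) = (\<lambda>_. 0)" using sep by fastforce
    then show "z = w" by (simp add: fun_eq_iff)
  qed
  have "?p (z m) \<in> {x \<in> int_lattice b. l1_norm x \<le> M}" for m
  proof -
    have "?p (z m) = comb b ((\<chi> i. of_int (z m i)) - real m *\<^sub>R w)"
      by (simp add: linear_diff[OF linear_comb] linear_scale[OF linear_comb] w(1))
    moreover have "\<bar>((\<chi> i. of_int (z m i)) - real m *\<^sub>R w) $ i\<bar> \<le> 1" for i
      by (simp add: z_def) linarith
    ultimately have "l1_norm (?p (z m)) \<le> M"
      using l1_norm_comb_le[of "(\<chi> i. of_int (z m i)) - real m *\<^sub>R w" b] by (simp add: M_def)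
    then show ?thesis by (auto simp: int_lattice_def comb_int)
  qed
  then have "range (?p \<circ> z) \<subseteq> {x \<in> int_lattice b. l1_norm x \<le> M}" by auto
  then have "finite (range (?p \<circ> z))"
    using finite_l1_bounded_if_l1_separated[OF int_lattice_diff int_lattice_separated[OF sep]] finite_subset by blast
  then have "finite (?p ` range z)" by (simp add: image_comp)
  then have "finite (range z)" using inj finite_imageD inj_on_subset by blast
  then have "finite ((\<lambda>f. \<bar>f j\<bar>) ` range z)" by blast
  then obtain K where K: "\<And>m. \<bar>z m j\<bar> \<le> K"
    using bdd_above_finite[of "(\<lambda>f. \<bar>f j\<bar>) ` range z"] by (auto simp: bdd_above_def)
  obtain m :: nat where m: "(of_int K + 1) / \<bar>w $ j\<bar> < real m" using reals_Archimedean2 by blast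
  then have "of_int K + 1 < \<bar>real m * w $ j\<bar>" using j by (simp add: field_simps abs_mult)
  moreover have "\<bar>real m * w $ j\<bar> \<le> \<bar>of_int (z m j)\<bar> + 1" unfolding z_def by linarith
  moreover have "\<bar>of_int (z m j)\<bar> \<le> (of_int K :: real)" using K[of m] by (metis of_int_abs of_int_le_iff)
  ultimately show False by linarith
qed

lemma comb_scaleR: "comb (\<lambda>i. c *\<^sub>R b i) x = c *\<^sub>R comb b x"
  by (simp add: comb_def scaleR_sum_right mult.commute)

lemma inj_comb_scaleR:
  assumes "inj (comb b)" "c \<noteq> 0" shows "inj (comb (\<lambda>i. c *\<^sub>R b i))"
  using assms by (auto simp: inj_def comb_scaleR)

lemma fundamental_cell_scaleR: "fundamental_cell (\<lambda>i. c *\<^sub>R b i) = (*\<^sub>R) c ` fundamental_cell b"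
  unfolding fundamental_cell_eq by (simp add: comb_scaleR image_image)

lemma fundamental_cell_scaleR_measure:
  fixes b :: "'n::finite \<Rightarrow> real ^ 'n"
  shows "measure lebesgue (fundamental_cell (\<lambda>i. c *\<^sub>R b i)) =
    \<bar>c\<bar> ^ CARD('n) * measure lebesgue (fundamental_cell b)"
  unfolding fundamental_cell_scaleR using measure_lebesgue_affine[of c 0 "fundamental_cell b"] by simp

text \<open>A slightly shrunken limit cell packs with respect to the lattices close to the limit lattice.\<close>

lemma cell_measure_limit:
  fixes c :: "nat \<Rightarrow> 'n::finite \<Rightarrow> real ^ 'n"
  assumes lim: "\<And>i. (\<lambda>k. c k i) \<longlonglongrightarrow> b i" and inj: "inj (comb b)" and injc: "\<And>k. inj (comb (c k))"
    and D: "\<And>k. measure lebesgue (fundamental_cell (c k)) \<le> D k" "D \<longlonglongrightarrow> d"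
  shows "measure lebesgue (fundamental_cell b) \<le> d"
proof -
  let ?V = "measure lebesgue (fundamental_cell b)"
  let ?n = "CARD('n)"
  obtain g where g: "linear g" "\<And>x. g (comb b x) = x" "\<And>x. comb b (g x) = x"
    using comb_inverse[OF inj] by blast
  have main: "(1 - e) ^ ?n * ?V \<le> d" if e: "0 < e" "e < 1" for e
  proof -
    \<comment> \<open>A coordinate of the perturbation is a sum of n terms, each at most
      \<open>a\<close> times the largest coefficient, so altogether it is at most
      \<open>e / 2\<close> times that coefficient.\<close>
    define a where "a = e / (2 * real ?n)"
    have a0: "0 < a" using e by (simp add: a_def)
    have na: "real ?n * a = e / 2" by (simp add: a_def)
    have "(\<lambda>k. g (c k i - b i) $ j) \<longlonglongrightarrow> g (b i - b i) $ j" for i j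
    proof -
      have "isCont g x" for x
        using g(1) linear_continuous_at linear_conv_bounded_linear by blast
      then show ?thesis by (intro tendsto_vec_nth isCont_tendsto_compose[of _ g] tendsto_intros lim)
    qed
    then have lim0: "(\<lambda>k. g (c k i - b i) $ j) \<longlonglongrightarrow> 0" for i j using linear_0[OF g(1)] by simp
    have "\<forall>\<^sub>F k in sequentially. \<bar>g (c k i - b i) $ j\<bar> < a" for i j
      by (rule order_tendstoD(2)[OF tendsto_rabs_zero[OF lim0] a0])
    then have "\<forall>\<^sub>F k in sequentially. \<forall>i. \<forall>j. \<bar>g (c k i - b i) $ j\<bar> < a"
      by (intro eventually_all_finite)
    moreover have "(1 - e) ^ ?n * ?V \<le> D k" if k: "\<forall>i. \<forall>j. \<bar>g (c k i - b i) $ j\<bar> < a" for k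
    proof -
      let ?X = "fundamental_cell (\<lambda>i. (1 - e) *\<^sub>R b i)"
      have X: "?X \<in> lmeasurable"
        using e by (intro fundamental_cell_measurable inj_comb_scaleR inj) simp
      have "measure lebesgue ?X \<le> measure lebesgue (fundamental_cell (c k))"
      proof (rule measure_packing_le_cell[OF injc X])
        fix x y assume x: "x \<in> ?X" and y: "y \<in> ?X" and d: "x - y \<in> int_lattice (c k)"
        obtain p q where pq: "x = (1 - e) *\<^sub>R comb b p" "y = (1 - e) *\<^sub>R comb b q"
          "p \<in> unit_cube" "q \<in> unit_cube"
          using x y by (auto simp: fundamental_cell_eq comb_scaleR)
        obtain z :: "'n \<Rightarrow> int" where z: "x - y = (\<Sum>i\<in>UNIV. of_int (z i) *\<^sub>R c k i)"
          using d by (auto simp: int_lattice_def)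
        have "x - y = comb b ((1 - e) *\<^sub>R (p - q))"
          by (simp add: pq linear_diff[OF linear_comb] linear_scale[OF linear_comb] scaleR_diff_right)
        then have gd: "g (x - y) = (1 - e) *\<^sub>R (p - q)" by (simp add: g(2))
        have "x - y = comb b (\<chi> i. of_int (z i)) + (\<Sum>i\<in>UNIV. of_int (z i) *\<^sub>R (c k i - b i))"
          unfolding z comb_def sum.distrib[symmetric] by (intro sum.cong) (auto simp: scaleR_diff_right)
        then have gd': "g (x - y) = (\<chi> i. of_int (z i)) + (\<Sum>i\<in>UNIV. of_int (z i) *\<^sub>R g (c k i - b i))"
          by (simp add: linear_add[OF g(1)] linear_sum[OF g(1)] linear_scale[OF g(1)] g(2))
        then have comp: "(1 - e) * (p $ j - q $ j) = of_int (z j) + (\<Sum>i\<in>UNIV. of_int (z i) * g (c k i - b i) $ j)" for j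
        proof -
          have "(1 - e) * (p $ j - q $ j) = g (x - y) $ j" unfolding gd by simp
          also have "\<dots> = of_int (z j) + (\<Sum>i\<in>UNIV. of_int (z i) * g (c k i - b i) $ j)"
            unfolding gd' by simp
          finally show ?thesis .
        qed
        \<comment> \<open>The coordinate with the largest coefficient is compared: the shrunken cell
          contributes at most \<open>1 - e\<close> and the perturbation at most
          \<open>?m * (e / 2)\<close>. This forces \<open>?m < 1\<close>, so all coefficients
          vanish.\<close>
        have "Max (range (\<lambda>i. \<bar>z i\<bar>)) \<in> range (\<lambda>i. \<bar>z i\<bar>)" by (intro Max_in) auto
        then obtain j where "\<bar>z j\<bar> = Max (range (\<lambda>i. \<bar>z i\<bar>))" by (metis imageE)
        then have j: "\<bar>z i\<bar> \<le> \<bar>z j\<bar>" for i by (simp add: Max_ge)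
        let ?m = "real_of_int \<bar>z j\<bar>"
        have "\<bar>\<Sum>i\<in>UNIV. of_int (z i) * g (c k i - b i) $ j\<bar> \<le> (\<Sum>i\<in>(UNIV :: 'n set). ?m * a)"
        proof (rule order_trans[OF sum_abs sum_mono])
          fix i
          have "\<bar>real_of_int (z i)\<bar> \<le> ?m" using j[of i] by (metis of_int_abs of_int_le_iff)
          then show "\<bar>of_int (z i) * g (c k i - b i) $ j\<bar> \<le> ?m * a"
            unfolding abs_mult using k[rule_format, of i j] by (intro mult_mono) auto
        qed
        also have "\<dots> = ?m * (e / 2)" using na by (simp add: algebra_simps)
        finally have S: "\<bar>\<Sum>i\<in>UNIV. of_int (z i) * g (c k i - b i) $ j\<bar> \<le> ?m * (e / 2)" .
        have "0 \<le> p $ j" "p $ j < 1" "0 \<le> q $ j" "q $ j < 1" using pq(3,4) by (auto simp: unit_cube_def)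
        then have "\<bar>(1 - e) * (p $ j - q $ j)\<bar> \<le> (1 - e) * 1"
          unfolding abs_mult using e by (intro mult_mono) auto
        moreover have "\<bar>v\<bar> \<le> r + t" if "\<bar>u\<bar> \<le> r * 1" "u = v + w" "\<bar>w\<bar> \<le> t" for u v w r t :: real
          using that by linarith
        ultimately have "\<bar>real_of_int (z j)\<bar> \<le> (1 - e) + ?m * (e / 2)" using comp[of j] S by blast
        then have "?m \<le> (1 - e) + ?m * (e / 2)" by simp
        then have le: "?m * (1 - e / 2) \<le> 1 - e" by (simp add: algebra_simps)
        have "\<bar>z j\<bar> < 1"
        proof (rule ccontr)
          assume "\<not> \<bar>z j\<bar> < 1"
          then have "1 \<le> ?m" by linarith
          then have "1 * (1 - e / 2) \<le> ?m * (1 - e / 2)" using e by (intro mult_right_mono) auto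
          then have "1 * (1 - e / 2) \<le> 1 - e" using le by (rule order_trans)
          then show False using e by simp
        qed
        then have "z i = 0" for i using j[of i] by simp
        then show "x = y" using z by simp
      qed
      then show ?thesis using fundamental_cell_scaleR_measure[of "1 - e" b] D(1)[of k] e by simp
    qed
    ultimately have "\<forall>\<^sub>F k in sequentially. (1 - e) ^ ?n * ?V \<le> D k"
      by (rule eventually_mono)
    then show ?thesis using D(2) by (intro tendsto_lowerbound[of D d sequentially]) auto
  qed
  \<comment> \<open>Here \<open>e\<close> is \<open>1 / (m + 2)\<close>; the shift keeps it strictly
    below 1.\<close>
  have "(\<lambda>m. (1 - 1 / real (m + 2)) ^ ?n * ?V) \<longlonglongrightarrow> (1 - 0) ^ ?n * ?V"
    by (intro tendsto_intros LIMSEQ_ignore_initial_segment[OF lim_1_over_n, of 2])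
  moreover have "(1 - 1 / real (m + 2)) ^ ?n * ?V \<le> d" for m
    by (rule main) auto
  ultimately show ?thesis by (intro LIMSEQ_le_const2[of _ ?V]) auto
qed

text \<open>A form of Mahler's compactness theorem.\<close>

lemma lattice_limit:
  fixes c :: "nat \<Rightarrow> 'n::finite \<Rightarrow> real ^ 'n"
  assumes inj: "\<And>k. inj (comb (c k))"
    and sep: "\<And>k x. x \<in> int_lattice (c k) \<Longrightarrow> x \<noteq> 0 \<Longrightarrow> 2 \<le> l1_norm x"
    and D: "\<And>k. measure lebesgue (fundamental_cell (c k)) \<le> D k" "D \<longlonglongrightarrow> d"
  obtains b :: "'n \<Rightarrow> real ^ 'n" where "inj (comb b)" "\<And>x. x \<in> int_lattice b \<Longrightarrow> x \<noteq> 0 \<Longrightarrow> 2 \<le> l1_norm x"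
    "measure lebesgue (fundamental_cell b) \<le> d"
proof -
  let ?n = "CARD('n)"
  obtain K where K: "\<And>k. D k \<le> K"
    using convergent_imp_Bseq[OF convergentI[OF D(2)]] by (metis Bseq_def abs_le_D1 real_norm_def)
  define R where "R = real ?n * ((K + 1) * real ?n ^ (?n - 1) + 1)"
  have "\<exists>c'. inj (comb c') \<and> int_lattice c' = int_lattice (c k) \<and>
    measure lebesgue (fundamental_cell c') = measure lebesgue (fundamental_cell (c k)) \<and>
    (\<forall>i. l1_norm (c' i) \<le> R)" for k
    using reduced_basis[OF inj[of k] sep[where k=k] order_trans[OF D(1)[of k] K[of k]]]
    unfolding R_def by metis
  then obtain c' where c': "\<And>k. inj (comb (c' k))" "\<And>k. int_lattice (c' k) = int_lattice (c k)"
    "\<And>k. measure lebesgue (fundamental_cell (c' k)) = measure lebesgue (fundamental_cell (c k))"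
    "\<And>k i. l1_norm (c' k i) \<le> R" by metis
  \<comment> \<open>Collecting a basis in one matrix gives a single convergent subsequence for all
    basis vectors.\<close>
  define B :: "nat \<Rightarrow> real ^ 'n ^ 'n" where "B k = (\<chi> i. c' k i)" for k
  have "norm (B k) \<le> real ?n * R" for k
  proof -
    have "norm (B k) \<le> (\<Sum>i\<in>UNIV. norm (B k $ i))" by (simp add: norm_vec_def L2_set_le_sum)
    also have "\<dots> \<le> (\<Sum>i\<in>(UNIV :: 'n set). R)"
      by (intro sum_mono order_trans[OF norm_le_l1]) (simp add: B_def c'(4))
    finally show ?thesis by simp
  qed
  then have "bounded (range B)" by (auto simp: bounded_iff)
  then obtain l r where r: "strict_mono r" "(B \<circ> r) \<longlonglongrightarrow> l"
    using bounded_imp_convergent_subsequence by blast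
  define b where "b i = l $ i" for i
  have lim: "(\<lambda>k. c' (r k) i) \<longlonglongrightarrow> b i" for i
    using tendsto_vec_nth[OF r(2), of i] by (simp add: B_def b_def)
  have sepb: "2 \<le> l1_norm (comb b (\<chi> i. of_int (z i)))" if z: "z \<noteq> (\<lambda>_. 0)" for z :: "'n \<Rightarrow> int"
  proof -
    let ?z = "(\<chi> i. of_int (z i)) :: real ^ 'n"
    have "?z \<noteq> 0" using z by (auto simp: vec_eq_iff fun_eq_iff)
    then have "comb (c' k) ?z \<noteq> 0" for k
      using c'(1)[of k] linear_injective_0[OF linear_comb] by blast
    moreover have "comb (c' k) ?z \<in> int_lattice (c k)" for k
      unfolding c'(2)[symmetric] by (auto simp: int_lattice_def comb_int)
    ultimately have "2 \<le> l1_norm (comb (c' (r k)) ?z)" for k using sep by blast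
    then show ?thesis
      by (intro LIMSEQ_le_const[OF tendsto_l1_norm[OF tendsto_comb[of "\<lambda>k. c' (r k)" b, OF lim]]]) auto
  qed
  have injb: "inj (comb b)" by (rule inj_comb_if_separated[OF sepb])
  have vol: "measure lebesgue (fundamental_cell b) \<le> d"
    by (rule cell_measure_limit[OF lim injb c'(1), of "\<lambda>k. D (r k)"])
      (use c'(3) D(1) LIMSEQ_subseq_LIMSEQ[OF D(2) r(1)] in \<open>auto simp: comp_def\<close>)
  show thesis by (rule that[OF injb _ vol]) (rule int_lattice_separated[OF sepb])
qed

section \<open>The lattice of a Sidon set\<close>

lemma comb_axis_id: "comb (\<lambda>i. axis i 1) x = x"
  by (simp add: comb_def vec_eq_iff axis_def if_distrib[of "\<lambda>c. _ * c"] cong: if_cong)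

lemma small_cube:
  fixes c :: real
  assumes "0 < c"
  shows "(*\<^sub>R) c ` (unit_cube :: (real ^ 'n) set) \<in> lmeasurable"
    "measure lebesgue ((*\<^sub>R) c ` (unit_cube :: (real ^ 'n) set)) = c ^ CARD('n)"
proof -
  let ?e = "\<lambda>i :: 'n. axis i (1::real)"
  have inj: "inj (comb ?e)" by (simp add: inj_def comb_axis_id)
  have cell: "fundamental_cell ?e = unit_cube" by (simp add: fundamental_cell_eq comb_axis_id)
  let ?C = "cbox 0 1 :: (real ^ 'n) set"
  have "box 0 1 \<subseteq> (unit_cube :: (real ^ 'n) set)" "unit_cube \<subseteq> ?C"
    by (auto simp: unit_cube_def mem_box_cart less_imp_le)
  then have "?C - unit_cube \<union> (unit_cube - ?C) \<subseteq> cbox 0 1 - box 0 1" by blast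
  then have neg: "negligible (?C - unit_cube \<union> (unit_cube - ?C))"
    using negligible_frontier_interval negligible_subset by blast
  have m: "measure lebesgue (unit_cube :: (real ^ 'n) set) = 1"
    using measure_negligible_symdiff[OF lmeasurable_cbox neg]
    by (auto simp: content_cbox_if_cart interval_eq_empty_cart)
  show "(*\<^sub>R) c ` (unit_cube :: (real ^ 'n) set) \<in> lmeasurable"
    using fundamental_cell_measurable[OF inj_comb_scaleR[OF inj, of c]] assms
    unfolding fundamental_cell_scaleR cell by simp
  show "measure lebesgue ((*\<^sub>R) c ` (unit_cube :: (real ^ 'n) set)) = c ^ CARD('n)"
    using fundamental_cell_scaleR_measure[of c ?e] assms
    unfolding fundamental_cell_scaleR cell m by simp
qed

text \<open>A cube of side \<open>1 / n\<close> has l1 diameter at most 1, so distinct points of it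
  are never congruent modulo the lattice.\<close>

lemma cell_measure_pos:
  fixes b :: "'n::finite \<Rightarrow> real ^ 'n"
  assumes inj: "inj (comb b)" and sep: "\<And>x. x \<in> int_lattice b \<Longrightarrow> x \<noteq> 0 \<Longrightarrow> 2 \<le> l1_norm x"
  shows "0 < measure lebesgue (fundamental_cell b)"
proof -
  let ?c = "1 / real CARD('n)"
  let ?X = "(*\<^sub>R) ?c ` (unit_cube :: (real ^ 'n) set)"
  have "measure lebesgue ?X \<le> measure lebesgue (fundamental_cell b)"
  proof (rule measure_packing_le_cell[OF inj small_cube(1)])
    fix x y assume x: "x \<in> ?X" and y: "y \<in> ?X" and d: "x - y \<in> int_lattice b"
    obtain p q where pq: "x = ?c *\<^sub>R p" "y = ?c *\<^sub>R q" "p \<in> unit_cube" "q \<in> unit_cube"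
      using x y by blast
    have "l1_norm (p - q) \<le> (\<Sum>i\<in>(UNIV :: 'n set). 1)"
      unfolding l1_norm_def
    proof (rule sum_mono)
      fix i
      have "0 \<le> p $ i" "p $ i < 1" "0 \<le> q $ i" "q $ i < 1" using pq(3,4) by (auto simp: unit_cube_def)
      then show "\<bar>(p - q) $ i\<bar> \<le> 1" by simp
    qed
    then have "?c * l1_norm (p - q) \<le> 1" by (simp add: field_simps)
    moreover have "x - y = ?c *\<^sub>R (p - q)" by (simp add: pq scaleR_diff_right)
    ultimately have "l1_norm (x - y) \<le> 1" by (simp add: l1_norm_scaleR)
    then show "x = y" using sep[OF d] by fastforce
  qed simp
  moreover have "0 < measure lebesgue ?X" by (subst small_cube(2)) simp_all
  ultimately show ?thesis by linarith
qed

context comm_group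
begin

definition int_prod :: "('n \<Rightarrow> 'a) \<Rightarrow> ('n \<Rightarrow> int) \<Rightarrow> 'a" where
  "int_prod c z = (\<Otimes>i\<in>UNIV. c i [^] z i)"

context
  fixes c :: "'n::finite \<Rightarrow> 'a"
  assumes c [simp]: "\<And>i. c i \<in> carrier G"
begin

lemma int_prod_closed [simp]: "int_prod c z \<in> carrier G"
  unfolding int_prod_def by (intro finprod_closed) auto

lemma int_prod_add: "int_prod c (\<lambda>i. z i + w i) = int_prod c z \<otimes> int_prod c w"
proof -
  have "int_prod c z \<otimes> int_prod c w = (\<Otimes>i\<in>UNIV. c i [^] z i \<otimes> c i [^] w i)"
    unfolding int_prod_def by (intro finprod_multf[symmetric]) auto
  also have "\<dots> = int_prod c (\<lambda>i. z i + w i)"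
    unfolding int_prod_def by (intro finprod_cong') (auto simp: int_pow_mult)
  finally show ?thesis by simp
qed

lemma int_prod_zero: "int_prod c (\<lambda>_. 0) = \<one>"
  by (simp add: int_prod_def)

lemma int_prod_diff:
  assumes "int_prod c z = int_prod c w"
  shows "int_prod c (\<lambda>i. z i - w i) = \<one>"
proof -
  have "int_prod c (\<lambda>i. z i - w i) \<otimes> int_prod c w = int_prod c w"
    using int_prod_add[of "\<lambda>i. z i - w i" w] assms by simp
  then show ?thesis using int_prod_closed r_cancel_one by metis
qed

text \<open>A nonzero coordinate sum would be at least \<open>2 t\<close> in absolute value. So in a
  shorter vector the positive and the negative part have equal sums, each at most
  \<open>t - 1\<close>, and equal products. After padding to order \<open>t - 1\<close> the Sidon
  property identifies the parts, and the vector is zero.\<close>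

lemma sidon_set_int_prod_separated:
  assumes S: "sidon_set G (t - 1) CARD('n) b" and s: "bij_betw s UNIV {..<CARD('n)}"
    and cb: "\<And>i. c i = b (s i)" and t: "1 \<le> t"
    and z: "int_prod c z = \<one>" "2 * int t dvd (\<Sum>i\<in>UNIV. z i)" "z \<noteq> (\<lambda>_. 0)"
  shows "2 * int t \<le> (\<Sum>i\<in>UNIV. \<bar>z i\<bar>)"
proof (rule ccontr)
  let ?n = "CARD('n)"
  assume "\<not> 2 * int t \<le> (\<Sum>i\<in>UNIV. \<bar>z i\<bar>)"
  then have small: "(\<Sum>i\<in>UNIV. \<bar>z i\<bar>) < 2 * int t" by simp
  have sum0: "(\<Sum>i\<in>UNIV. z i) = 0"
  proof (rule ccontr)
    assume "(\<Sum>i\<in>UNIV. z i) \<noteq> 0"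
    then have "2 * int t \<le> \<bar>\<Sum>i\<in>UNIV. z i\<bar>"
      using dvd_imp_le_int[OF _ z(2)] by simp
    also have "\<dots> \<le> (\<Sum>i\<in>UNIV. \<bar>z i\<bar>)" by (rule sum_abs)
    finally show False using small by simp
  qed
  define p where "p i = nat (z i)" for i
  define m where "m i = nat (- z i)" for i
  have zpm: "int (p i) = z i + int (m i)" for i by (simp add: p_def m_def)
  have abs: "\<bar>z i\<bar> = int (p i) + int (m i)" for i by (simp add: p_def m_def)
  have "(\<Sum>i\<in>UNIV. int (p i)) = (\<Sum>i\<in>UNIV. int (m i))"
    unfolding zpm sum.distrib sum0 by simp
  then have pm: "(\<Sum>i\<in>UNIV. p i) = (\<Sum>i\<in>UNIV. m i)"
    by (metis of_nat_sum of_nat_eq_iff)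
  have "int (\<Sum>i\<in>UNIV. p i) + int (\<Sum>i\<in>UNIV. m i) < 2 * int t"
    using small unfolding abs sum.distrib of_nat_sum .
  then have pt: "(\<Sum>i\<in>UNIV. p i) \<le> t - 1" using pm by linarith
  \<comment> \<open>The parts may contain fewer than \<open>t - 1\<close> summands; \<open>k\<close>
    further copies of one and the same element are added to both.\<close>
  define k where "k = t - 1 - (\<Sum>i\<in>UNIV. p i)"
  define i0 where "i0 = inv_into UNIV s 0"
  have s_inj: "inj s" and s_range: "range s = {..<?n}" using s by (auto simp: bij_betw_def)
  define e where "e i = (if i = i0 then k else 0)" for i
  have esum: "(\<Sum>i\<in>UNIV. e i) = k" by (simp add: e_def)
  define r where "r v j = (if j < ?n then v (inv_into UNIV s j) + e (inv_into UNIV s j) else 0)"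
    for v :: "'n \<Rightarrow> nat" and j
  have rs: "r v (s i) = v i + e i" for v i
  proof -
    have "s i < ?n" using s_range by blast
    then show ?thesis by (simp add: r_def inv_into_f_f[OF s_inj])
  qed
  have r_in: "r v \<in> {r. (\<forall>i\<ge>?n. r i = 0) \<and> (\<Sum>i<?n. r i) = t - 1}"
    if "(\<Sum>i\<in>UNIV. v i) = (\<Sum>i\<in>UNIV. p i)" for v
  proof -
    have "(\<Sum>j<?n. r v j) = (\<Sum>i\<in>UNIV. r v (s i))"
      using sum.reindex_bij_betw[OF s, of "r v"] by simp
    also have "\<dots> = t - 1" using that esum pt by (simp add: rs sum.distrib k_def)
    finally show ?thesis by (auto simp: r_def)
  qed
  have bc: "\<And>j. j < ?n \<Longrightarrow> b j \<in> carrier G" using S by (simp add: sidon_set_def)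
  have fp: "finprod G (\<lambda>j. b j [^] r v j) {..<?n} =
    int_prod c (\<lambda>i. int (v i)) \<otimes> int_prod c (\<lambda>i. int (e i))" for v
  proof -
    have "finprod G (\<lambda>j. b j [^] r v j) (s ` UNIV) = finprod G (\<lambda>i. b (s i) [^] r v (s i)) UNIV"
      using s_inj s_range bc by (intro finprod_reindex) auto
    also have "\<dots> = int_prod c (\<lambda>i. int (v i) + int (e i))"
      unfolding int_prod_def cb[symmetric] rs
      by (intro finprod_cong') (auto simp: int_pow_int[symmetric] simp del: int_pow_int)
    finally show ?thesis unfolding s_range int_prod_add .
  qed
  have "int_prod c (\<lambda>i. int (p i)) = int_prod c (\<lambda>i. int (m i))"
    unfolding zpm int_prod_add z(1) by simp
  then have "finprod G (\<lambda>j. b j [^] r p j) {..<?n} = finprod G (\<lambda>j. b j [^] r m j) {..<?n}"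
    unfolding fp by simp
  moreover have "inj_on (\<lambda>r. finprod G (\<lambda>j. b j [^] r j) {..<?n})
      {r. (\<forall>i\<ge>?n. r i = 0) \<and> (\<Sum>i<?n. r i) = t - 1}"
    using S by (simp add: sidon_set_def)
  ultimately have "r p = r m" using r_in[of p] r_in[of m] pm by (auto simp: inj_on_def)
  then have "p i = m i" for i using rs[of p i] rs[of m i] by simp
  then have "z i = 0" for i using zpm[of i] by simp
  then show False using z(3) by auto
qed

end

end

text \<open>The lattice is \<open>1 / t\<close> times the kernel of the homomorphism from \<open>\<int>\<^sup>n\<close> to \<open>\<int>\<^sub>2\<^sub>t \<times> G\<close> that maps the
  \<open>i\<close>-th unit vector to \<open>(1, b\<^sub>i)\<close>. The first component forces a short vector of the kernel to have
  coordinate sum zero, so that it is a difference of two vectors whose \<open>b\<close>-sums agree.\<close>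

lemma sidon_lattice:
  fixes G :: "('a, 'c) monoid_scheme" (structure)
  assumes G: "comm_group G" and fin: "finite (carrier G)" and S: "sidon_set G (t - 1) CARD('n) b"
    and t: "1 \<le> t"
  obtains c :: "'n::finite \<Rightarrow> real ^ 'n" where "inj (comb c)"
    "\<And>x. x \<in> int_lattice c \<Longrightarrow> x \<noteq> 0 \<Longrightarrow> 2 \<le> l1_norm x"
    "measure lebesgue (fundamental_cell c) \<le> 2 * real (card (carrier G)) / real t ^ (CARD('n) - 1)"
proof -
  interpret comm_group G by (rule G)
  let ?n = "CARD('n)"
  obtain s :: "'n \<Rightarrow> nat" where s: "bij_betw s UNIV {..<?n}"
    using ex_bij_betw_finite_nat[of "UNIV :: 'n set"] by (auto simp: atLeast0LessThan)
  define \<beta> where "\<beta> i = b (s i)" for i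
  have \<beta>: "\<beta> i \<in> carrier G" for i
  proof -
    have "s i < ?n" using s by (auto simp: bij_betw_def)
    then show ?thesis using S by (simp add: \<beta>_def sidon_set_def)
  qed
  define \<Lambda> where "\<Lambda> = {z :: 'n \<Rightarrow> int. int_prod \<beta> z = \<one> \<and> 2 * int t dvd (\<Sum>i\<in>UNIV. z i)}"
  define p where "p z = (1 / real t) *\<^sub>R ((\<chi> i. of_int (z i)) :: real ^ 'n)" for z :: "'n \<Rightarrow> int"
  have t0: "real t > 0" using t by simp
  have p_diff: "p (\<lambda>i. z i - w i) = p z - p w" for z w
    by (simp add: p_def vec_eq_iff diff_divide_distrib)
  have \<Lambda>0: "(\<lambda>_. 0) \<in> \<Lambda>" by (simp add: \<Lambda>_def int_prod_zero[OF \<beta>])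
  have \<Lambda>_diff: "(\<lambda>i. z i - w i) \<in> \<Lambda>" if "z \<in> \<Lambda>" "w \<in> \<Lambda>" for z w
    using that int_prod_diff[of \<beta> z w, OF \<beta>] by (simp add: \<Lambda>_def sum_subtractf)
  let ?L = "p ` \<Lambda>"
  have L0: "0 \<in> ?L" using \<Lambda>0 by (intro image_eqI[where x="\<lambda>_. 0"]) (auto simp: p_def vec_eq_iff)
  have L_diff: "x - y \<in> ?L" if xy: "x \<in> ?L" "y \<in> ?L" for x y
  proof -
    obtain z w where "z \<in> \<Lambda>" "x = p z" "w \<in> \<Lambda>" "y = p w" using xy by blast
    then show ?thesis using imageI[OF \<Lambda>_diff, of z w p] by (simp add: p_diff)
  qed
  have sep: "2 \<le> l1_norm x" if x: "x \<in> ?L" "x \<noteq> 0" for x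
  proof -
    obtain z where z: "z \<in> \<Lambda>" "x = p z" using x(1) by blast
    have "z \<noteq> (\<lambda>_. 0)" using x(2) z(2) by (auto simp: p_def vec_eq_iff)
    then have "2 * int t \<le> (\<Sum>i\<in>UNIV. \<bar>z i\<bar>)"
      using sidon_set_int_prod_separated[OF \<beta> S s \<beta>_def t] z(1) by (simp add: \<Lambda>_def)
    then have "2 * real t \<le> (\<Sum>i\<in>UNIV. \<bar>of_int (z i)\<bar>)"
      by (metis (mono_tags, lifting) of_int_abs of_int_le_iff of_int_mult of_int_numeral of_int_of_nat_eq of_int_sum sum.cong)
    then show ?thesis using t0 by (simp add: z(2) p_def l1_norm_scaleR, simp add: l1_norm_def field_simps)
  qed
  define g where "g = card (carrier G)"
  have g0: "g > 0" unfolding g_def using fin by (metis card_gt_0_iff empty_iff one_closed)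
  \<comment> \<open>\<open>N\<close> annihilates both components of the homomorphism, so
    \<open>N\<close> times each unit vector lies in the kernel. This supplies the independent
    lattice vectors from which a basis is made.\<close>
  define N where "N = 2 * t * g"
  define v where "v i = p (\<lambda>j. if j = i then int N else 0)" for i
  have vL: "v i \<in> ?L" for i
  proof -
    have "\<beta> j [^] (int N) = \<one>" for j
    proof -
      have "\<beta> j [^] N = (\<beta> j [^] g) [^] (2 * t)" using \<beta> by (simp add: nat_pow_pow N_def mult.commute)
      also have "\<dots> = \<one>" using pow_order_eq_1[OF \<beta>] by (simp add: g_def order_def)
      finally show ?thesis by (simp add: int_pow_int)
    qed
    then have "int_prod \<beta> (\<lambda>j. if j = i then int N else 0) = \<one>"
      unfolding int_prod_def by (intro finprod_one_eqI) auto
    then have "(\<lambda>j. if j = i then int N else 0) \<in> \<Lambda>" by (simp add: \<Lambda>_def N_def)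
    then show ?thesis unfolding v_def by blast
  qed
  have v_eq: "v i = (2 * real g) *\<^sub>R axis i 1" for i
    using t0 by (simp add: v_def p_def vec_eq_iff axis_def N_def)
  have v_inj: "inj (comb v)"
    unfolding v_eq using g0 by (intro inj_comb_scaleR) (auto simp: inj_def comb_axis_id)
  obtain c where c: "lattice_basis c ?L"
  proof (rule lattice_basis_of_independent[of ?L v])
    show "0 \<in> ?L" by (rule L0)
    show "x - y \<in> ?L" if "x \<in> ?L" "y \<in> ?L" for x y by (rule L_diff[OF that])
    show "v i \<in> ?L" for i by (rule vL)
    show "inj (comb v)" by (rule v_inj)
    fix c assume "lattice_basis c ?L"
    then show thesis by (rule that)
  next
    show "finite {x \<in> ?L. l1_norm x \<le> r}" for r
      using L_diff sep by (rule finite_l1_bounded_if_l1_separated)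
  qed
  then have inj: "inj (comb c)" and L: "int_lattice c = ?L" by (auto simp: lattice_basis_iff)
  \<comment> \<open>Two integer vectors with the same value of \<open>\<Phi>\<close> differ by an
    element of \<open>\<Lambda>\<close>. One representative for each value, of which there are at
    most \<open>2 t |G|\<close>, thus suffices: the cubes of side \<open>1 / t\<close> at these
    points cover the space modulo the lattice.\<close>
  define \<Phi> where "\<Phi> z = ((\<Sum>i\<in>UNIV. z i) mod (2 * int t), int_prod \<beta> z)" for z
  have "range \<Phi> \<subseteq> {0..<2 * int t} \<times> carrier G"
    using t int_prod_closed[OF \<beta>] by (auto simp: \<Phi>_def)
  then have \<Phi>: "finite (range \<Phi>)" "card (range \<Phi>) \<le> 2 * t * g"
    using fin card_mono[of "{0..<2 * int t} \<times> carrier G" "range \<Phi>"]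
    by (auto intro: finite_subset simp: card_cartesian_product g_def nat_mult_distrib)
  define R where "R = inv_into UNIV \<Phi> ` range \<Phi>"
  have R: "finite R" "card R \<le> 2 * t * g"
    using \<Phi> card_image_le[OF \<Phi>(1), of "inv_into UNIV \<Phi>"] by (auto simp: R_def)
  let ?Q = "(*\<^sub>R) (1 / real t) ` (unit_cube :: (real ^ 'n) set)"
  let ?Y = "\<Union>z\<in>R. (+) (p z) ` ?Q"
  have Q: "?Q \<in> lmeasurable" "measure lebesgue ?Q = (1 / real t) ^ ?n"
    using small_cube[of "1 / real t"] t0 by auto
  have Y: "?Y \<in> lmeasurable" using R(1) Q(1) by (intro fmeasurable.finite_UN measurable_translation)
  have "measure lebesgue (fundamental_cell c) \<le> measure lebesgue ?Y"
  proof (rule cell_le_measure_covering[OF inj Y])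
    fix x :: "real ^ 'n"
    define z where "z i = \<lfloor>real t * x $ i\<rfloor>" for i
    define z' where "z' = inv_into UNIV \<Phi> (\<Phi> z)"
    have eq: "\<Phi> z' = \<Phi> z" unfolding z'_def using f_inv_into_f[of "\<Phi> z" \<Phi> UNIV] by simp
    then have "int_prod \<beta> (\<lambda>i. z i - z' i) = \<one>"
      by (intro int_prod_diff[OF \<beta>]) (simp add: \<Phi>_def)
    moreover have "2 * int t dvd (\<Sum>i\<in>UNIV. z i - z' i)"
      using eq[symmetric] by (simp add: \<Phi>_def sum_subtractf mod_eq_dvd_iff)
    ultimately have "(\<lambda>i. z i - z' i) \<in> \<Lambda>" by (simp add: \<Lambda>_def)
    then have l: "p z - p z' \<in> int_lattice c" unfolding L p_diff[symmetric] by (rule imageI)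
    let ?f = "\<chi> i. frac (real t * x $ i)"
    have "x = p z + (1 / real t) *\<^sub>R ?f"
      using t0 by (simp add: vec_eq_iff p_def z_def frac_def field_simps)
    then have "x - (p z - p z') = p z' + (1 / real t) *\<^sub>R ?f" by (simp add: algebra_simps)
    moreover have "?f \<in> unit_cube" by (simp add: unit_cube_def frac_lt_1)
    moreover have "z' \<in> R" by (auto simp: R_def z'_def)
    ultimately have "x - (p z - p z') \<in> ?Y" by blast
    then show "\<exists>l\<in>int_lattice c. x - l \<in> ?Y" using l by blast
  qed
  also have "\<dots> \<le> (\<Sum>z\<in>R. measure lebesgue ((+) (p z) ` ?Q))"
    using R(1) measurable_translation[OF Q(1)] by (intro measure_UNION_le) auto
  also have "\<dots> = real (card R) * (1 / real t) ^ ?n" by (simp add: measure_translation Q(2))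
  also have "\<dots> \<le> real (2 * t * g) * (1 / real t) ^ ?n"
    using R(2) by (intro mult_right_mono) (auto simp flip: of_nat_mult)
  also have "\<dots> = 2 * real g / real t ^ (?n - 1)"
  proof -
    have "real t ^ ?n = real t * real t ^ (?n - 1)" by (metis One_nat_def Suc_pred power_Suc zero_less_card_finite)
    then show ?thesis using t0 by (simp add: power_one_over field_simps)
  qed
  finally have "measure lebesgue (fundamental_cell c) \<le> 2 * real g / real t ^ (?n - 1)" .
  then show thesis using that[OF inj] sep unfolding L g_def by blast
qed

section \<open>Densities\<close>

text \<open>The counting bound gives a group order of at least \<open>(t / n) ^ (n - 1)\<close>,
  against which the powers of \<open>t\<close> cancel.\<close>

lemma sidon_density_bounded:
  assumes n: "0 < n" and t: "1 \<le> t"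
  shows "sidon_density n t \<le> (2 * real n) ^ (n - 1) / fact n"
proof -
  let ?g = "min_sidon_group_order (t - 1) n"
  obtain G :: "nat monoid" and b where G: "comm_group G" "finite (carrier G)"
    "card (carrier G) = ?g" "sidon_set G (t - 1) n b"
    using min_sidon_group_order_attained[OF n] by blast
  have "real ((((t - 1) div n + 1)) ^ (n - 1)) \<le> real ?g"
    using card_ge_if_sidon_set[OF G(1,2,4) n] G(3) by (metis of_nat_le_iff)
  moreover have "(real t / real n) ^ (n - 1) \<le> real (((t - 1) div n + 1) ^ (n - 1))"
  proof -
    have "t - 1 < n * ((t - 1) div n + 1)"
      using n by (metis add.commute dividend_less_times_div mult.commute mult_Suc_right plus_1_eq_Suc)
    then have "t \<le> n * ((t - 1) div n + 1)" by linarith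
    then have "real t \<le> real n * real ((t - 1) div n + 1)" by (metis of_nat_le_iff of_nat_mult)
    then have "real t / real n \<le> real ((t - 1) div n + 1)" using n by (simp add: field_simps)
    then have "(real t / real n) ^ (n - 1) \<le> real ((t - 1) div n + 1) ^ (n - 1)"
      by (intro power_mono) auto
    then show ?thesis by simp
  qed
  ultimately have le: "(real t / real n) ^ (n - 1) \<le> real ?g" by linarith
  have pos: "0 < (real t / real n) ^ (n - 1)" using n t by simp
  have "sidon_density n t = (2 * real t) ^ (n - 1) / fact n / real ?g"
    by (simp add: sidon_density_def)
  also have "\<dots> \<le> (2 * real t) ^ (n - 1) / fact n / (real t / real n) ^ (n - 1)"
    using le pos by (intro divide_left_mono mult_pos_pos) auto
  also have "\<dots> = (2 * real n) ^ (n - 1) / fact n"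
    using n t by (simp add: field_simps power_mult_distrib power_divide)
  finally show ?thesis .
qed

lemma sidon_density_pos:
  assumes "0 < n" "1 \<le> t" shows "0 < sidon_density n t"
  using min_sidon_group_order_pos[OF assms(1), of "t - 1"] assms by (simp add: sidon_density_def)

lemma bdd_above_sidon_density: "0 < n \<Longrightarrow> bdd_above (sidon_density n ` {1..})"
  using sidon_density_bounded by (intro bdd_aboveI[where M="(2 * real n) ^ (n - 1) / fact n"]) auto

section \<open>Comparison with the prime power density\<close>

lemma primepow_density_pos: "1 \<le> t \<Longrightarrow> 0 < primepow_density n t"
  using next_primepow_ge_2[of n] by (simp add: primepow_density_def)

lemma primepow_density_le_sidon_density:
  assumes n: "0 < n" and t: "1 \<le> t"
  shows "primepow_density n t \<le> sidon_density n t"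
proof -
  have "real (min_sidon_group_order (t - 1) n) \<le> real (next_primepow n) ^ (t - 1)"
    using min_sidon_group_order_le_primepow[OF n, of "t - 1"] by (metis of_nat_le_iff of_nat_power)
  then show ?thesis
    unfolding primepow_density_def sidon_density_def
    using min_sidon_group_order_pos[OF n, of "t - 1"] next_primepow_ge_2[of n]
    by (intro divide_left_mono mult_left_mono mult_pos_pos) auto
qed

lemma primepow_density_less_sidon_density:
  assumes n: "0 < n" and t: "3 \<le> t"
  shows "primepow_density n t < sidon_density n t"
proof -
  have "2 \<le> t - 1" using t by linarith
  then have "real (min_sidon_group_order (t - 1) n) < real (next_primepow n ^ (t - 1))"
    using min_sidon_group_order_less_primepow[of "t - 1" n] by (simp only: of_nat_less_iff)
  then have "real (min_sidon_group_order (t - 1) n) < real (next_primepow n) ^ (t - 1)" by simp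
  then show ?thesis
    unfolding primepow_density_def sidon_density_def
    using min_sidon_group_order_pos[OF n, of "t - 1"] next_primepow_ge_2[of n] t
    by (intro divide_strict_left_mono mult_strict_left_mono mult_pos_pos) auto
qed

text \<open>From some index on the values fall below \<open>f 1\<close>, so a maximum over a finite
  initial segment is global.\<close>

lemma attains_max_if_tendsto_0:
  fixes f :: "nat \<Rightarrow> real"
  assumes "f \<longlonglongrightarrow> 0" and pos: "0 < f 1"
  shows "\<exists>t\<ge>1. \<forall>s\<ge>1. f s \<le> f t"
proof -
  obtain N where N: "\<And>s. N \<le> s \<Longrightarrow> f s < f 1"
    using order_tendstoD(2)[OF assms] by (auto simp: eventually_sequentially)
  let ?A = "{1..N + 1}"
  have "Max (f ` ?A) \<in> f ` ?A" by (intro Max_in) auto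
  then obtain t where t: "t \<in> ?A" "f t = Max (f ` ?A)" by (metis imageE)
  have le: "f s \<le> f t" if "s \<in> ?A" for s unfolding t(2) using that by (intro Max_ge) auto
  have "f s \<le> f t" if "1 \<le> s" for s
  proof (cases "s \<le> N + 1")
    case False
    then have "f s < f 1" using N by simp
    then show ?thesis using le[of 1] by simp
  qed (use le that in simp)
  then show ?thesis using t(1) by auto
qed

lemma primepow_density_attains_max: "\<exists>t\<ge>1. \<forall>s\<ge>1. primepow_density n s \<le> primepow_density n t"
proof (rule attains_max_if_tendsto_0)
  let ?q = "real (next_primepow n)"
  have q: "2 \<le> ?q" using next_primepow_ge_2[of n] by simp
  \<comment> \<open>Every prime power is at least 2, so a power of \<open>t\<close> divided by
    \<open>2 ^ t\<close>, written with \<open>exp\<close>, dominates the density up to a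
    constant.\<close>
  have "(\<lambda>t. (real t * ln 2) ^ (n - 1) / exp (real t * ln 2)) \<longlonglongrightarrow> 0"
    by (intro filterlim_compose[OF tendsto_power_div_exp_0] filterlim_at_top_mult_tendsto_pos[OF tendsto_const]
        filterlim_real_sequentially) auto
  then have "(\<lambda>t. (2 * 2 ^ (n - 1) / ln 2 ^ (n - 1)) * ((real t * ln 2) ^ (n - 1) / exp (real t * ln 2))) \<longlonglongrightarrow> 0"
    by (rule tendsto_mult_right_zero)
  then show "primepow_density n \<longlonglongrightarrow> 0"
  proof (rule tendsto_sandwich[rotated 3])
    show "\<forall>\<^sub>F t in sequentially. primepow_density n t \<le>
        (2 * 2 ^ (n - 1) / ln 2 ^ (n - 1)) * ((real t * ln 2) ^ (n - 1) / exp (real t * ln 2))"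
      using eventually_ge_at_top[of 1]
    proof eventually_elim
      fix t :: nat assume t: "1 \<le> t"
      have e: "exp (real t * ln 2) = 2 * 2 ^ (t - 1)"
        using t by (simp add: exp_of_nat_mult flip: power_Suc)
      have "(2::real) ^ (t - 1) \<le> ?q ^ (t - 1)" using q by (intro power_mono) auto
      also have "\<dots> \<le> fact n * ?q ^ (t - 1)" using q by simp
      finally have "primepow_density n t \<le> (2 * real t) ^ (n - 1) / 2 ^ (t - 1)"
        unfolding primepow_density_def using q by (intro divide_left_mono mult_pos_pos) auto
      also have "\<dots> = (2 * 2 ^ (n - 1) / ln 2 ^ (n - 1)) * ((real t * ln 2) ^ (n - 1) / exp (real t * ln 2))"
        unfolding e by (simp add: power_mult_distrib)
      finally show "primepow_density n t \<le>
        (2 * 2 ^ (n - 1) / ln 2 ^ (n - 1)) * ((real t * ln 2) ^ (n - 1) / exp (real t * ln 2))" .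
    qed
    show "\<forall>\<^sub>F t in sequentially. 0 \<le> primepow_density n t"
      by (simp add: primepow_density_def)
  qed simp
  show "0 < primepow_density n 1" by (rule primepow_density_pos) simp
qed

lemma exists_power_of_2_between:
  fixes n :: nat
  assumes "2 \<le> n"
  shows "\<exists>k. n \<le> 2 ^ Suc k \<and> 2 ^ Suc k \<le> 2 * (n - 1)"
proof -
  have ex: "\<exists>k. n \<le> 2 ^ k" using less_exp[of n] less_imp_le by blast
  define k where "k = (LEAST k. n \<le> 2 ^ k)"
  have k: "n \<le> 2 ^ k" unfolding k_def using LeastI_ex[OF ex] .
  have "k \<noteq> 0" using k assms by (intro notI) simp
  then obtain j where j: "k = Suc j" using not0_implies_Suc by blast
  have "\<not> n \<le> 2 ^ j" using not_less_Least[of j "\<lambda>k. n \<le> 2 ^ k"] j by (simp add: k_def)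
  then show ?thesis using k j by (intro exI[of _ j]) auto
qed

text \<open>Powers of two already give this bound of Bertrand type.\<close>

lemma next_primepow_le_double: "2 \<le> n \<Longrightarrow> next_primepow n \<le> 2 * (n - 1)"
proof -
  assume "2 \<le> n"
  then obtain k where k: "n \<le> 2 ^ Suc k" "2 ^ Suc k \<le> 2 * (n - 1)"
    using exists_power_of_2_between by blast
  have "primepow ((2::nat) ^ Suc k)" unfolding primepow_def by (intro exI[of _ 2] exI[of _ "Suc k"]) auto
  then show ?thesis using next_primepow_le[OF k(1)] k(2) by linarith
qed

text \<open>The condition under which \<open>t = 3\<close> beats \<open>t = 2\<close>, the ratio of
  these densities being \<open>(3 / 2) ^ (n - 1) / q\<close>. At \<open>n = 5\<close> it reads 80 <
  81, and at \<open>n = 4\<close> it fails with 32 > 27. The doubling bound for \<open>q\<close>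
  suffices only from \<open>n = 8\<close> on (at \<open>n = 7\<close> it would give 768 > 729),
  hence the separate cases.\<close>

lemma next_primepow_power_bound:
  assumes "5 \<le> n"
  shows "next_primepow n * 2 ^ (n - 1) < 3 ^ (n - 1)"
proof -
  have p57: "primepow (5::nat)" "primepow (7::nat)"
    unfolding primepow_def by (intro exI[of _ 5] exI[of _ 1], simp) (intro exI[of _ 7] exI[of _ 1], simp)
  consider "n = 5" | "n = 6" | "n = 7" | "8 \<le> n" using assms by linarith
  then show ?thesis
  proof cases
    case 1
    then show ?thesis using next_primepow_le[of 5 5] p57 by simp
  next
    case 2
    then show ?thesis using next_primepow_le[of 6 7] p57 by simp
  next
    case 3
    then show ?thesis using next_primepow_le[of 7 7] p57 by simp
  next
    case 4
    have "2 * m * 2 ^ m < (3::nat) ^ m" if "7 \<le> m" for m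
      using that
    proof (induction m rule: dec_induct)
      case (step m)
      have "2 * Suc m * 2 ^ Suc m \<le> 3 * (2 * m * 2 ^ m)"
        using step.hyps by (simp add: algebra_simps)
      also have "\<dots> < 3 * 3 ^ m" using step.IH by simp
      finally show ?case by simp
    qed simp
    from this[of "n - 1"] have "2 * (n - 1) * 2 ^ (n - 1) < 3 ^ (n - 1)" using 4 by simp
    moreover have "next_primepow n * 2 ^ (n - 1) \<le> 2 * (n - 1) * 2 ^ (n - 1)"
      using next_primepow_le_double[of n] 4 by (intro mult_right_mono) auto
    ultimately show ?thesis by linarith
  qed
qed

text \<open>With \<open>m = n - 1\<close> and the prime power \<open>q\<close>, the first two ratios
  of consecutive values are \<open>2 ^ m / q\<close>, at least 1, and
  \<open>(3 / 2) ^ m / q\<close>, greater than 1. So the maximizing order \<open>t - 1\<close> is at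
  least 2, where Bose--Chowla gives a strict inequality.\<close>

lemma primepow_density_max_ge_3:
  assumes n: "5 \<le> n" and t: "1 \<le> t" "\<And>s. 1 \<le> s \<Longrightarrow> primepow_density n s \<le> primepow_density n t"
  shows "3 \<le> t"
proof (rule ccontr)
  assume "\<not> 3 \<le> t"
  then have t12: "t = 1 \<or> t = 2" using t(1) by linarith
  let ?q = "real (next_primepow n)"
  define m where "m = n - 1"
  have q: "2 \<le> ?q" using next_primepow_ge_2[of n] by simp
  have "real (next_primepow n * 2 ^ m) < real (3 ^ m)"
    using next_primepow_power_bound[OF n] unfolding m_def by (simp only: of_nat_less_iff)
  then have b: "?q * 2 ^ m < 3 ^ m" by simp
  have f1: "primepow_density n 1 = 2 ^ m / fact n" by (simp add: primepow_density_def m_def)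
  have f2: "primepow_density n 2 = 4 ^ m / (fact n * ?q)" by (simp add: primepow_density_def m_def)
  have f3: "primepow_density n 3 = 6 ^ m / (fact n * ?q ^ 2)"
    by (simp add: primepow_density_def m_def power2_eq_square numeral_3_eq_3)
  have six: "(6::real) ^ m = 3 ^ m * 2 ^ m" by (simp flip: power_mult_distrib)
  have four: "(4::real) ^ m = 2 ^ m * 2 ^ m" by (simp flip: power_mult_distrib)
  have "primepow_density n 2 < primepow_density n 3"
  proof -
    have "4 ^ m * ?q < (6::real) ^ m"
      unfolding four six using mult_strict_right_mono[OF b, of "2 ^ m"] by (simp add: mult.assoc mult.commute mult.left_commute)
    then show ?thesis unfolding f2 f3 using q by (simp add: field_simps power2_eq_square)
  qed
  moreover have "primepow_density n 1 \<le> primepow_density n 2"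
  proof -
    have "?q \<le> 2 ^ m"
    proof -
      have "next_primepow n \<le> 2 * m" using next_primepow_le_double[of n] n by (simp add: m_def)
      also have "2 * m \<le> 2 ^ m"
      proof -
        have "m \<ge> 2" using n by (simp add: m_def)
        then show ?thesis
        proof (induction m rule: dec_induct)
          case (step k)
          have "2 \<le> 2 * k" using step.hyps by simp
          then show ?case using step.IH by simp
        qed simp
      qed
      finally show ?thesis by (metis of_nat_le_iff of_nat_numeral of_nat_power)
    qed
    then have "2 ^ m * ?q \<le> 4 ^ m" unfolding four by simp
    then show ?thesis unfolding f1 f2 using q by (simp add: field_simps)
  qed
  ultimately show False using t12 t(2)[of 3] by auto
qed

text \<open>The maximum on the left is 2/3, attained at \<open>t = 2\<close> because
  \<open>t ^ 3 \<le> 2 * 4 ^ (t - 1)\<close> is an equality there. The group of order 13 makes the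
  right side at least 216/312 = 9/13.\<close>

lemma primepow_density_4_less:
  assumes "1 \<le> t"
  shows "primepow_density 4 t < sidon_density 4 3"
proof -
  have "primepow (4::nat)" unfolding primepow_def by (intro exI[of _ 2] exI[of _ 2]) simp
  then have "next_primepow 4 = 4" using next_primepow_le[of 4 4] next_primepow(1)[of 4] by simp
  then have "primepow_density 4 t = (2 * real t) ^ 3 / (24 * 4 ^ (t - 1))"
    by (simp add: primepow_density_def fact_numeral)
  moreover have "t ^ 3 \<le> 2 * 4 ^ (t - 1)"
  proof -
    consider "t = 1" | "t = 2" | "3 \<le> t" using assms by linarith
    then show ?thesis
    proof cases
      case 3
      then show ?thesis
      proof (induction t rule: dec_induct)
        case (step k)
        have "Suc k ^ 3 \<le> 4 * k ^ 3"
        proof -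
          have "3 * k \<le> k * k" using step.hyps by simp
          then have 1: "3 * k * k \<le> k * k * k" by simp
          have "3 * k \<le> 3 * k * k" using step.hyps by simp
          moreover have "1 \<le> k * k * k" using step.hyps by simp
          ultimately have "k * k * k + 3 * k * k + 3 * k + 1 \<le> 4 * (k * k * k)" using 1 by linarith
          then show ?thesis by (simp add: power3_eq_cube algebra_simps)
        qed
        also have "\<dots> \<le> 4 * (2 * 4 ^ (k - 1))" using step.IH by simp
        also have "\<dots> = 2 * 4 ^ (Suc k - 1)" using step.hyps by (cases k) auto
        finally show ?case .
      qed simp
    qed simp_all
  qed
  then have "real (t ^ 3) \<le> real (2 * 4 ^ (t - 1))" by (simp only: of_nat_le_iff)
  then have "(2 * real t) ^ 3 / (24 * 4 ^ (t - 1)) \<le> 2 / 3"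
    by (simp add: field_simps power_mult_distrib)
  moreover have "2 / 3 < sidon_density 4 3"
  proof -
    have g: "real (min_sidon_group_order 2 4) \<le> 13" "0 < real (min_sidon_group_order 2 4)"
      using min_sidon_group_order_2_4 min_sidon_group_order_pos[of 4 2] by simp_all
    have "216 / (24 * 13 :: real) \<le> 216 / (24 * real (min_sidon_group_order 2 4))"
      using g by (intro divide_left_mono) auto
    then show ?thesis by (simp add: sidon_density_def fact_numeral)
  qed
  ultimately show ?thesis by linarith
qed

lemma lattice_packing_with_density_Sup:
  fixes n :: nat
  assumes n: "n = CARD('n::finite)"
  shows "\<exists>(L :: (real ^ 'n) set) r. cross_polytope_packing L r \<and>
    packing_density L r = (SUP t\<in>{1..}. sidon_density n t)"
proof -
  define d where "d = (SUP t\<in>{1..}. sidon_density n t)"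
  have n0: "0 < n" using n by simp
  have bdd: "bdd_above (sidon_density n ` {1..})" using n0 by (rule bdd_above_sidon_density)
  have le_d: "sidon_density n t \<le> d" if "1 \<le> t" for t
    unfolding d_def using that bdd by (intro cSUP_upper) auto
  have d0: "0 < d" using sidon_density_pos[OF n0, of 1] le_d[of 1] by simp
  have "\<exists>t\<ge>1. d - 1 / real (Suc k) < sidon_density n t" for k
  proof -
    have ne: "{1::nat..} \<noteq> {}" by simp
    have "d - 1 / real (Suc k) < d" by simp
    then have "\<exists>t\<in>{1..}. d - 1 / real (Suc k) < sidon_density n t"
      unfolding d_def by (rule iffD1[OF less_cSUP_iff[OF ne bdd]])
    then show ?thesis by auto
  qed
  then obtain T where T: "\<And>k. 1 \<le> T k" "\<And>k. d - 1 / real (Suc k) < sidon_density n (T k)" by metis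
  have lim: "(\<lambda>k. sidon_density n (T k)) \<longlonglongrightarrow> d"
  proof (rule tendsto_sandwich)
    show "(\<lambda>k. d - 1 / real (Suc k)) \<longlonglongrightarrow> d"
      using tendsto_diff[OF tendsto_const[of d] LIMSEQ_Suc[OF lim_1_over_n]] by simp
    show "\<forall>\<^sub>F k in sequentially. d - 1 / real (Suc k) \<le> sidon_density n (T k)"
      by (intro always_eventually allI less_imp_le T(2))
    show "\<forall>\<^sub>F k in sequentially. sidon_density n (T k) \<le> d"
      by (intro always_eventually allI le_d T(1))
  qed (rule tendsto_const)
  \<comment> \<open>At radius 1 the density is \<open>2 ^ n\<close> divided by \<open>fact n\<close>
    times the cell volume, so this bound on the volume says that the density is at least that of the
    Sidon set.\<close>
  have "\<exists>c :: 'n \<Rightarrow> real ^ 'n. inj (comb c) \<and> (\<forall>x. x \<in> int_lattice c \<longrightarrow> x \<noteq> 0 \<longrightarrow> 2 \<le> l1_norm x) \<and>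
    measure lebesgue (fundamental_cell c) \<le> 2 ^ n / (fact n * sidon_density n (T k))" for k
  proof -
    let ?t = "T k"
    obtain G :: "nat monoid" and b where G: "comm_group G" "finite (carrier G)"
      "card (carrier G) = min_sidon_group_order (?t - 1) n" "sidon_set G (?t - 1) n b"
      using min_sidon_group_order_attained[OF n0] by blast
    obtain c :: "'n \<Rightarrow> real ^ 'n" where c: "inj (comb c)"
      "\<And>x. x \<in> int_lattice c \<Longrightarrow> x \<noteq> 0 \<Longrightarrow> 2 \<le> l1_norm x"
      "measure lebesgue (fundamental_cell c) \<le> 2 * real (card (carrier G)) / real ?t ^ (CARD('n) - 1)"
      using sidon_lattice[OF G(1,2) G(4)[unfolded n] T(1)] by blast
    have g: "0 < real (card (carrier G))" using min_sidon_group_order_pos[OF n0] G(3) by simp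
    have t: "0 < real ?t" using T(1)[of k] by linarith
    have "2 ^ n = (2::real) * 2 ^ (n - 1)" using n0 by (metis Suc_diff_1 power_Suc)
    then have "2 * real (card (carrier G)) / real ?t ^ (n - 1) = 2 ^ n / (fact n * sidon_density n ?t)"
      using g t by (simp add: sidon_density_def G(3) power_mult_distrib field_simps)
    then show ?thesis using c unfolding n by metis
  qed
  then obtain c :: "nat \<Rightarrow> 'n \<Rightarrow> real ^ 'n" where c: "\<And>k. inj (comb (c k))"
    "\<And>k x. x \<in> int_lattice (c k) \<Longrightarrow> x \<noteq> 0 \<Longrightarrow> 2 \<le> l1_norm x"
    "\<And>k. measure lebesgue (fundamental_cell (c k)) \<le> 2 ^ n / (fact n * sidon_density n (T k))"
    by metis
  obtain b :: "'n \<Rightarrow> real ^ 'n" where b: "inj (comb b)"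
    "\<And>x. x \<in> int_lattice b \<Longrightarrow> x \<noteq> 0 \<Longrightarrow> 2 \<le> l1_norm x"
    "measure lebesgue (fundamental_cell b) \<le> 2 ^ n / (fact n * d)"
  proof (rule lattice_limit)
    show "inj (comb (c k))" for k by (rule c(1))
    show "2 \<le> l1_norm x" if "x \<in> int_lattice (c k)" "x \<noteq> 0" for k x by (rule c(2)[OF that])
    show "measure lebesgue (fundamental_cell (c k)) \<le> 2 ^ n / (fact n * sidon_density n (T k))" for k
      by (rule c(3))
    show "(\<lambda>k. 2 ^ n / (fact n * sidon_density n (T k))) \<longlonglongrightarrow> 2 ^ n / (fact n * d)"
      using d0 by (intro tendsto_intros lim) auto
  qed (rule that)
  let ?L = "int_lattice b"
  let ?V = "measure lebesgue (fundamental_cell b)"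
  have V: "0 < ?V" by (rule cell_measure_pos[OF b(1,2)])
  have det: "lattice_det ?L = ?V" using lattice_det_eq[of b ?L] b(1) by (simp add: lattice_basis_iff)
  \<comment> \<open>The solution of \<open>packing_density ?L r = d\<close>. The volume bound for
    the limit cell gives \<open>r \<le> 1\<close>, so the separation by 2 is enough for this
    radius.\<close>
  define r where "r = root n (d * (fact n * ?V)) / 2"
  have dV: "0 < d * (fact n * ?V)" using d0 V by simp
  have r0: "0 < r" unfolding r_def using n0 dV by simp
  have rn: "(2 * r) ^ n = d * (fact n * ?V)" unfolding r_def using n0 dV by simp
  have "d * (fact n * ?V) \<le> 2 ^ n" using b(3) d0 by (simp add: field_simps)
  then have "(2 * r) ^ n \<le> 2 ^ n" unfolding rn .
  then have r1: "r \<le> 1" using n0 r0 power_mono_iff[of "2 * r" 2 n] by simp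
  have "euclidean_lattice ?L"
    unfolding euclidean_lattice_def
  proof (intro conjI ballI int_lattice_zero int_lattice_diff)
    show "discrete ?L"
      using uniform_discrete_if_l1_separated[OF int_lattice_diff b(2)] uniform_discrete_imp_discrete by blast
    have bL: "b i \<in> ?L" for i
    proof -
      have "(\<chi> j. of_int (if j = i then 1 else 0)) = axis i (1 :: real)"
        by (simp add: vec_eq_iff axis_def)
      then have "b i = comb b (\<chi> j. of_int (if j = i then 1 else 0))" by simp
      then show ?thesis unfolding int_lattice_def comb_int
        by (rule image_eqI[where x="\<lambda>j. if j = i then 1 else 0"]) simp
    qed
    have "comb b x \<in> span ?L" for x
      unfolding comb_def by (intro span_sum span_scale span_base bL)
    moreover have "surj (comb b)" using b(1) linear_injective_imp_surjective linear_comb by blast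
    ultimately show "span ?L = UNIV" by (metis UNIV_eq_I surjD)
  qed
  moreover have "2 * r \<le> l1_norm (x - y)" if "x \<in> ?L" "y \<in> ?L" "x \<noteq> y" for x y
    using b(2)[OF int_lattice_diff[OF that(1,2)]] that(3) r1 by simp
  ultimately have "cross_polytope_packing ?L r" using r0 by (simp add: cross_polytope_packing_def)
  moreover have "packing_density ?L r = d"
    unfolding packing_density_def det n[symmetric] rn using V by simp
  ultimately show ?thesis unfolding d_def by blast
qed

theorem theorem3p1:
  fixes n :: nat
  assumes n: "n = CARD('n::finite)"
  shows "bdd_above (sidon_density n ` {1..}) \<and>
    (\<exists>(L :: (real ^ 'n) set) r. cross_polytope_packing L r \<and>
       packing_density L r = (SUP t\<in>{1..}. sidon_density n t)) \<and>
    (\<exists>t\<ge>1. \<forall>s\<ge>1. primepow_density n s \<le> primepow_density n t) \<and>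
    (SUP t\<in>{1..}. sidon_density n t) \<ge> (SUP t\<in>{1..}. primepow_density n t) \<and>
    (n \<ge> 4 \<longrightarrow>
       (SUP t\<in>{1..}. sidon_density n t) > (SUP t\<in>{1..}. primepow_density n t))"
proof -
  have n0: "0 < n" using n by simp
  have bdd: "bdd_above (sidon_density n ` {1..})" using n0 by (rule bdd_above_sidon_density)
  have le_Sup: "sidon_density n t \<le> (SUP t\<in>{1..}. sidon_density n t)" if "1 \<le> t" for t
    using that bdd by (intro cSUP_upper) auto
  obtain t where t: "1 \<le> t" "\<And>s. 1 \<le> s \<Longrightarrow> primepow_density n s \<le> primepow_density n t"
    using primepow_density_attains_max[of n] by blast
  have max: "(SUP t\<in>{1..}. primepow_density n t) = primepow_density n t"
    using t by (intro cSup_eq_maximum) auto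
  have strict: "(SUP t\<in>{1..}. primepow_density n t) < (SUP t\<in>{1..}. sidon_density n t)" if n4: "4 \<le> n"
  proof -
    have "\<exists>s\<ge>1. primepow_density n t < sidon_density n s"
    proof (cases "n = 4")
      case True
      then show ?thesis using primepow_density_4_less[OF t(1)] by (intro exI[of _ 3]) simp
    next
      case False
      then have "5 \<le> n" using n4 by simp
      then have "3 \<le> t" using t by (rule primepow_density_max_ge_3)
      then show ?thesis using primepow_density_less_sidon_density[OF n0] t(1) by blast
    qed
    then show ?thesis unfolding max using le_Sup less_le_trans by blast
  qed
  have "(SUP t\<in>{1..}. primepow_density n t) \<le> (SUP t\<in>{1..}. sidon_density n t)"
    unfolding max using primepow_density_le_sidon_density[OF n0 t(1)] le_Sup[OF t(1)] by linarith
  then show ?thesis using bdd lattice_packing_with_density_Sup[OF n] t strict by blast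
qed

end
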